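(* Let $\varepsilon_1=\varepsilon_1(n)$ and $\eta$ be Harnack constants in dimension $n$ (as fixed in the context). Let $\alpha=-\log_2(1-\eta)$ and $\gamma=\frac{1}{1-\alpha}$, and define the constants $$r_\circ=\frac{1}{2^{16}n^2},\qquad \varepsilon_\circ=\left(\frac{\varepsilon_1^{\gamma\alpha}}{2^{33+5\alpha}n^3}\right)^{\frac{8}{\gamma\alpha^2}}.$$ If $E\subset B_1$ is a minimal set in $B_1$ (so that $\partial E$ is a minimal surface in $B_1$), $0\in\partial E$, and $$\partial E\cap B_1\subset\{|x_n|\le\varepsilon\}$$ for some $\varepsilon\le\varepsilon_\circ$, then there exists $\nu\in\mathbb{S}^{n-1}$ such that $$\partial E\cap B_{r_\circ}\subset\left\{|x\cdot\nu|\le\frac{\varepsilon}{2}r_\circ\right\}.$$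
   Context: Let $n\ge 2$. $B_r(x)\subset\mathbb{R}^n$ is the Euclidean ball of radius $r$ and centre $x$, $B_r=B_r(0)$; points of $\mathbb{R}^n$ are written $x=(x',x_n)\in\mathbb{R}^{n-1}\times\mathbb{R}$. For measurable $E\subset B_1$, its perimeter in $B_1$ is $P(E)=\sup\{\int_E \mathrm{div}(g): g\in C_0^1(B_1;\mathbb{R}^n),\ \|g\|_{L^\infty}\le 1\}$, where $C^1_0$ denotes compactly supported $C^1$ vector fields. $E\subset B_1$ is minimal in $B_1$ if $P(E)\le P(F)$ for every $F\subset B_1$ such that $(E\setminus F)\cup(F\setminus E)\subset\subset B_1$. The boundary is understood in the measure sense: $x\in\partial E$ iff $|B_r(x)\cap E|>0$ and $|B_r(x)\cap E^c|>0$ for every $r>0$, where $E^c=\mathbb{R}^n\setminus E$. The boundary of a minimal set is called a minimal surface. Harnack constants: $\varepsilon_1=\varepsilon_1(n)>0$ and $\eta>0$ are fixed constants for which the following (known) Harnack inequality holds: if $E$ is minimal in $B_1$, $0\in\partial E$, and $\partial E\cap B_1\subset\{|x_n|\le\varepsilon\}$ for some $0<\varepsilon\le\varepsilon_1$, then $\partial E\cap B_{1/2}\subset\{|x_n|\le\varepsilon(1-\eta)\}$. Standing assumption on these constants: $\varepsilon_1\le\frac14$, $\eta\le\frac15$ and $-\log_2(1-\eta)\le\frac14$.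
   Formalization: Minimal sets are required to have finite perimeter in B_1, both in the Harnack inequality and in the theorem; without this, any set with infinite perimeter near the sphere is trivially minimal and the assumed Harnack inequality fails for all constants. *)

theory Defs
  imports "HOL-Analysis.Analysis"
begin

definition C1_compact_support_field :: "(real^'n) set \<Rightarrow> (real^'n \<Rightarrow> real^'n) \<Rightarrow> bool" where
  "C1_compact_support_field U g \<longleftrightarrow>
     (\<forall>x. g differentiable (at x)) \<and>
     (\<forall>v. continuous_on UNIV (\<lambda>x. frechet_derivative g (at x) v)) \<and>
     compact (closure {x. g x \<noteq> 0}) \<and> closure {x. g x \<noteq> 0} \<subseteq> U"

definition divergence :: "(real^'n \<Rightarrow> real^'n) \<Rightarrow> real^'n \<Rightarrow> real" where
  "divergence g x = (\<Sum>i\<in>UNIV. frechet_derivative g (at x) (axis i 1) $ i)"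

definition perimeter :: "(real^'n) set \<Rightarrow> ereal" where
  "perimeter E =
     (SUP g \<in> {g. C1_compact_support_field (ball 0 1) g \<and> (AE x in lebesgue. norm (g x) \<le> 1)}.
        ereal (LINT x:E|lebesgue. divergence g x))"

text \<open>
  Sets of finite perimeter are meant. Without that clause, a set whose perimeter is infinite
  in every shell around the centre, \<open>{x. s < norm x \<and> norm x < 1}\<close>, would be minimal
  whatever it looks like near the centre, because all its competitors have infinite perimeter
  too; then no Harnack inequality could hold.
\<close>

definition minimal_set :: "(real^'n) set \<Rightarrow> bool" where
  "minimal_set E \<longleftrightarrow>
     E \<in> sets lebesgue \<and> E \<subseteq> ball 0 1 \<and> perimeter E < \<infinity> \<and>
     (\<forall>F. F \<in> sets lebesgue \<and> F \<subseteq> ball 0 1 \<and> closure ((E - F) \<union> (F - E)) \<subseteq> ball 0 1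
        \<longrightarrow> perimeter E \<le> perimeter F)"

definition measure_boundary :: "(real^'n) set \<Rightarrow> (real^'n) set" where
  "measure_boundary E =
     {x. \<forall>r>0. emeasure lebesgue (ball x r \<inter> E) > 0 \<and> emeasure lebesgue (ball x r \<inter> - E) > 0}"

text \<open>
  The index \<open>k\<close> plays the role of the last coordinate: \<open>x $ k\<close> is $x_n$ and
  \<open>CARD('n)\<close> is the dimension.
\<close>

definition harnack_constants :: "'n::finite \<Rightarrow> real \<Rightarrow> real \<Rightarrow> bool" where
  "harnack_constants k \<epsilon>\<^sub>1 \<eta> \<longleftrightarrow>
     \<epsilon>\<^sub>1 > 0 \<and> \<eta> > 0 \<and>
     (\<forall>(E :: (real^'n) set) \<epsilon>.
        minimal_set E \<and> 0 \<in> measure_boundary E \<and> 0 < \<epsilon> \<and> \<epsilon> \<le> \<epsilon>\<^sub>1 \<and>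
        measure_boundary E \<inter> ball 0 1 \<subseteq> {x. \<bar>x $ k\<bar> \<le> \<epsilon>}
        \<longrightarrow> measure_boundary E \<inter> ball 0 (1/2) \<subseteq> {x. \<bar>x $ k\<bar> \<le> \<epsilon> * (1 - \<eta>)})"

end

theory Submission
  imports Defs
begin

text \<open>
  Iterating the Harnack inequality down to a fixed scale shows that, at that scale, the boundary
  oscillates vertically by a tiny fraction of \<open>\<epsilon>\<close>, so its sup- and inf-convolutions with parabolas
  nearly coincide. A minimal set cannot be touched from one side by the graph of a strict
  supersolution of the minimal surface equation: adding (or, by complementation, removing) the thin
  region between the two would lower the perimeter, the unit normal field of the graph being a
  calibration. At a contact point the convolution parabola controls the gradient and the Hessian of
  the touching function, so the minimal surface operator is a tiny perturbation of the Laplacian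
  there, and the boundary is squeezed between vertical translates of a harmonic graph. The Dirichlet
  problem is only solved for polynomial data, by harmonic polynomials, and Weierstrass approximation
  suffices. The linear part of the harmonic polynomial at the origin gives the direction \<open>\<nu>\<close>, and
  Bernstein's method bounds the quadratic error.
\<close>

section \<open>Polynomials in the horizontal variables\<close>

text \<open>The boundary is a bare closed set, not known to be a graph or to carry a normal.
  Minimality is therefore exploited only through test fields, and every touching function is a
  polynomial (harmonic polynomial plus paraboloids), so all its derivatives are algebraic. Balance
  of the constants: with \<open>q = 1 / (2^33 * n^3)\<close>, a number \<open>N\<close> of Harnack
  steps with \<open>(1 - \<eta>) ^ N \<le> q\<close> reduces the oscillation at scale
  \<open>s = (1/2) ^ N\<close> to order q \<epsilon>. A parabola of opening \<epsilon> A that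
  reaches the slab height 2 \<epsilon> within distance s / 6 needs A of order s^(-2). At contact
  points the nonlinear terms are then of order \<epsilon>^3 A^2 and must lose against q \<epsilon>,
  which forces \<epsilon> below a power of s. As N is about log2(1/q) / \<alpha>, this is a
  threshold of the shape of \<open>\<epsilon>\<^sub>0\<close>. At radius \<open>r\<^sub>0\<close>
  the quadratic error is of order n \<epsilon> r0^2 and the approximation error of order q
  \<epsilon>. With r0 of order n^(-2) and q of order n^(-3), both stay well below \<epsilon> r0 /
  2.\<close>

text \<open>Functions of the horizontal variables are encoded as functions on the whole space that do not depend on
  the coordinate \<open>k\<close>, so that the dimension never changes.\<close>

inductive hpoly :: "'n \<Rightarrow> (real^'n \<Rightarrow> real) \<Rightarrow> bool" for k :: "'n::finite" where
  const: "hpoly k (\<lambda>x. c)"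
| coord: "i \<noteq> k \<Longrightarrow> hpoly k (\<lambda>x. x $ i)"
| add: "hpoly k f \<Longrightarrow> hpoly k g \<Longrightarrow> hpoly k (\<lambda>x. f x + g x)"
| mult: "hpoly k f \<Longrightarrow> hpoly k g \<Longrightarrow> hpoly k (\<lambda>x. f x * g x)"

definition pd :: "'n::finite \<Rightarrow> (real^'n \<Rightarrow> real) \<Rightarrow> real^'n \<Rightarrow> real" where
  "pd i f = (\<lambda>x. frechet_derivative f (at x) (axis i 1))"

definition lap :: "(real^'n \<Rightarrow> real) \<Rightarrow> real^'n \<Rightarrow> real" where
  "lap f = (\<lambda>x. \<Sum>i\<in>UNIV. pd i (pd i f) x)"

definition proj :: "'n::finite \<Rightarrow> real^'n \<Rightarrow> real^'n" where
  "proj k x = (\<chi> i. if i = k then 0 else x $ i)"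

lemma hpoly_scale: "hpoly k f \<Longrightarrow> hpoly k (\<lambda>x. c * f x)"
  by (rule hpoly.mult[OF hpoly.const])

lemma hpoly_uminus: "hpoly k f \<Longrightarrow> hpoly k (\<lambda>x. - f x)"
  using hpoly_scale[of k f "-1"] by simp

lemma hpoly_diff: "hpoly k f \<Longrightarrow> hpoly k g \<Longrightarrow> hpoly k (\<lambda>x. f x - g x)"
  using hpoly.add[OF _ hpoly_uminus, of k f g] by simp

lemma hpoly_sum: "finite I \<Longrightarrow> (\<And>i. i \<in> I \<Longrightarrow> hpoly k (f i)) \<Longrightarrow> hpoly k (\<lambda>x. \<Sum>i\<in>I. f i x)"
  by (induction I rule: finite_induct) (auto intro: hpoly.add hpoly.const)

lemma hpoly_power: "hpoly k f \<Longrightarrow> hpoly k (\<lambda>x. f x ^ m)"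
  by (induction m) (auto intro: hpoly.mult hpoly.const)

lemmas hpoly_intros = hpoly.const hpoly.coord hpoly.add hpoly.mult hpoly_scale hpoly_uminus
  hpoly_diff hpoly_sum hpoly_power

lemma hpoly_differentiable: "hpoly k f \<Longrightarrow> f differentiable (at x)"
proof (induction rule: hpoly.induct)
  case (coord i)
  show ?case
    by (intro bounded_linear_imp_differentiable bounded_linear_vec_nth)
qed (auto intro: differentiable_add differentiable_mult)

lemma linear_eq_sum_axis:
  fixes L :: "real^'n \<Rightarrow> real"
  assumes "linear L"
  shows "L v = (\<Sum>i\<in>UNIV. v $ i * L (axis i 1))"
proof -
  have "L v = L (\<Sum>i\<in>UNIV. v $ i *\<^sub>R axis i 1)"
    by (simp flip: scalar_mult_eq_scaleR add: basis_expansion)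
  also have "\<dots> = (\<Sum>i\<in>UNIV. v $ i * L (axis i 1))"
    using assms by (simp add: linear_sum linear_scale)
  finally show ?thesis .
qed

lemma differentiable_has_derivative_pd:
  fixes f :: "real^'n \<Rightarrow> real"
  assumes "f differentiable (at x)"
  shows "(f has_derivative (\<lambda>v. \<Sum>i\<in>UNIV. v $ i * pd i f x)) (at x)"
proof -
  have d: "(f has_derivative frechet_derivative f (at x)) (at x)"
    using assms frechet_derivative_works by blast
  have "frechet_derivative f (at x) = (\<lambda>v. \<Sum>i\<in>UNIV. v $ i * pd i f x)"
    unfolding pd_def using linear_eq_sum_axis[OF has_derivative_linear[OF d]] by blast
  then show ?thesis using d by simp
qed

lemmas hpoly_has_derivative = differentiable_has_derivative_pd[OF hpoly_differentiable]

lemma has_derivative_pd: "(f has_derivative f') (at x) \<Longrightarrow> pd i f x = f' (axis i 1)"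
  unfolding pd_def by (simp add: frechet_derivative_at[symmetric])

lemma pd_const [simp]: "pd i (\<lambda>x. c) = (\<lambda>x. 0)"
  by (rule ext, subst has_derivative_pd[OF has_derivative_const]) simp

lemma pd_coord [simp]: "pd i (\<lambda>x. x $ j) = (\<lambda>x. if i = j then 1 else 0)"
  by (rule ext, subst has_derivative_pd[OF bounded_linear_imp_has_derivative[OF bounded_linear_vec_nth]])
    (simp add: axis_def)

lemma pd_add: "hpoly k f \<Longrightarrow> hpoly k g \<Longrightarrow> pd i (\<lambda>x. f x + g x) = (\<lambda>x. pd i f x + pd i g x)"
  by (rule ext, subst has_derivative_pd[OF has_derivative_add[OF hpoly_has_derivative hpoly_has_derivative]])
    (auto simp: axis_def if_distrib if_distribR cong: if_cong)

lemma pd_mult: "hpoly k f \<Longrightarrow> hpoly k g \<Longrightarrow>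
    pd i (\<lambda>x. f x * g x) = (\<lambda>x. pd i f x * g x + f x * pd i g x)"
  by (rule ext, subst has_derivative_pd[OF has_derivative_mult[OF hpoly_has_derivative hpoly_has_derivative]])
    (auto simp: axis_def if_distrib if_distribR cong: if_cong)

lemma pd_scale: "hpoly k f \<Longrightarrow> pd i (\<lambda>x. c * f x) = (\<lambda>x. c * pd i f x)"
  using pd_mult[OF hpoly.const, of k f i c] by simp

lemma pd_uminus: "hpoly k f \<Longrightarrow> pd i (\<lambda>x. - f x) = (\<lambda>x. - pd i f x)"
  using pd_scale[of k f i "-1"] by simp

lemma pd_diff: "hpoly k f \<Longrightarrow> hpoly k g \<Longrightarrow> pd i (\<lambda>x. f x - g x) = (\<lambda>x. pd i f x - pd i g x)"
  using pd_add[OF _ hpoly_uminus, of k f g i] by (simp add: pd_uminus)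

lemma pd_sum: "finite I \<Longrightarrow> (\<And>j. j \<in> I \<Longrightarrow> hpoly k (f j)) \<Longrightarrow>
    pd i (\<lambda>x. \<Sum>j\<in>I. f j x) = (\<lambda>x. \<Sum>j\<in>I. pd i (f j) x)"
proof (induction I rule: finite_induct)
  case (insert a I)
  then have "pd i (\<lambda>x. f a x + (\<Sum>j\<in>I. f j x)) = (\<lambda>x. pd i (f a) x + pd i (\<lambda>x. \<Sum>j\<in>I. f j x) x)"
    by (intro pd_add[of k]) (auto intro: hpoly_sum)
  with insert show ?case by simp
qed simp

lemma hpoly_pd: "hpoly k f \<Longrightarrow> hpoly k (pd i f)"
  by (induction rule: hpoly.induct) (auto simp: pd_add pd_mult intro!: hpoly_intros)

lemma hpoly_lap: "hpoly k f \<Longrightarrow> hpoly k (lap f)"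
  unfolding lap_def by (intro hpoly_sum hpoly_pd) auto

lemma pd_commute: "hpoly k f \<Longrightarrow> pd i (pd j f) = pd j (pd i f)"
proof (induction rule: hpoly.induct)
  case (add f g)
  then show ?case by (simp add: pd_add[of k] hpoly_pd)
next
  case (mult f g)
  then show ?case by (simp add: pd_add[of k] pd_mult[of k] hpoly_pd hpoly.mult add_ac)
qed (auto simp: if_distrib cong: if_cong)

lemma pd_missing: "hpoly k f \<Longrightarrow> pd k f = (\<lambda>x. 0)"
  by (induction rule: hpoly.induct) (auto simp: pd_add[of k] pd_mult[of k])

lemma hpoly_proj: "hpoly k f \<Longrightarrow> f (proj k x) = f x"
  by (induction rule: hpoly.induct) (auto simp: proj_def)

lemma hpoly_continuous: "hpoly k f \<Longrightarrow> continuous_on A f"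
  by (meson continuous_at_imp_continuous_on differentiable_imp_continuous_within hpoly_differentiable)

lemma hpoly_shift: "hpoly k f \<Longrightarrow> hpoly k (\<lambda>x. f (x + w))"
proof (induction rule: hpoly.induct)
  case (coord i)
  then show ?case by (simp add: hpoly.add hpoly.coord hpoly.const)
qed (auto intro: hpoly_intros)

lemma pd_shift: "hpoly k f \<Longrightarrow> pd i (\<lambda>x. f (x + w)) = (\<lambda>x. pd i f (x + w))"
proof (induction rule: hpoly.induct)
  case (coord i)
  then show ?case by (simp add: pd_add[of k] hpoly.coord hpoly.const)
next
  case (add f g)
  then show ?case by (simp add: pd_add[of k] hpoly_shift)
next
  case (mult f g)
  then show ?case by (simp add: pd_mult[of k] hpoly_shift)
qed simp

lemma lap_add: "hpoly k f \<Longrightarrow> hpoly k g \<Longrightarrow> lap (\<lambda>x. f x + g x) = (\<lambda>x. lap f x + lap g x)"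
  by (simp add: lap_def pd_add[of k] hpoly_pd sum.distrib)

lemma lap_scale: "hpoly k f \<Longrightarrow> lap (\<lambda>x. c * f x) = (\<lambda>x. c * lap f x)"
  by (simp add: lap_def pd_scale[of k] hpoly_pd sum_distrib_left)

lemma lap_diff: "hpoly k f \<Longrightarrow> hpoly k g \<Longrightarrow> lap (\<lambda>x. f x - g x) = (\<lambda>x. lap f x - lap g x)"
  by (simp add: lap_def pd_diff[of k] hpoly_pd sum_subtractf)

lemma lap_mult: "hpoly k f \<Longrightarrow> hpoly k g \<Longrightarrow>
   lap (\<lambda>x. f x * g x) = (\<lambda>x. lap f x * g x + 2 * (\<Sum>i\<in>UNIV. pd i f x * pd i g x) + f x * lap g x)"
  by (simp add: lap_def pd_add[of k] pd_mult[of k] hpoly_pd hpoly.mult sum.distrib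
      sum_distrib_left sum_distrib_right algebra_simps)

lemma pd_lap: "hpoly k f \<Longrightarrow> pd i (lap f) = lap (pd i f)"
  by (simp add: lap_def pd_sum[of _ k] hpoly_pd pd_commute[of k _ i] pd_commute[of k "pd _ f" i])

lemma proj_nth [simp]: "proj k x $ i = (if i = k then 0 else x $ i)"
  by (simp add: proj_def)

lemma linear_proj: "linear (proj k)"
  by (auto intro!: linearI simp: vec_eq_iff)

lemma norm_proj_sq: "(norm (proj k x))\<^sup>2 = (\<Sum>i\<in>UNIV - {k}. (x $ i)\<^sup>2)"
proof -
  have "(norm (proj k x))\<^sup>2 = (\<Sum>i\<in>UNIV. (if i = k then 0 else x $ i)\<^sup>2)"
    by (simp add: norm_vec_def L2_set_def sum_nonneg)
  also have "\<dots> = (\<Sum>i\<in>UNIV - {k}. (x $ i)\<^sup>2)"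
    by (simp add: if_distrib if_distribR sum.If_cases Compl_eq_Diff_UNIV cong: if_cong)
  finally show ?thesis .
qed

definition projsq :: "'n::finite \<Rightarrow> real^'n \<Rightarrow> real" where
  "projsq k x = (\<Sum>i\<in>UNIV - {k}. x $ i * x $ i)"

lemma projsq_eq: "projsq k x = (norm (proj k x))\<^sup>2"
  by (simp add: projsq_def norm_proj_sq) (simp add: power2_eq_square)

lemma hpoly_projsq: "hpoly k (projsq k)"
  unfolding projsq_def by (intro hpoly_intros) auto

lemma pd_projsq: "pd i (projsq k) = (\<lambda>x. if i = k then 0 else 2 * x $ i)"
proof (cases "i = k")
  case True
  then show ?thesis using pd_missing[OF hpoly_projsq, of k] by simp
next
  case False
  have "pd i (\<lambda>x. \<Sum>j\<in>UNIV - {k}. x $ j * x $ j) = (\<lambda>x. \<Sum>j\<in>UNIV - {k}. pd i (\<lambda>x. x $ j * x $ j) x)"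
    by (rule pd_sum[of _ k]) (auto intro!: hpoly_intros)
  also have "\<dots> = (\<lambda>x. \<Sum>j\<in>UNIV - {k}. if i = j then 2 * x $ i else 0)"
    by (intro ext sum.cong refl) (auto simp: pd_mult[of k] hpoly.coord)
  also have "\<dots> = (\<lambda>x. 2 * x $ i)"
    using False by (simp add: sum.delta')
  finally show ?thesis using False by (simp add: projsq_def[abs_def])
qed

lemma lap_projsq: "lap (projsq (k::'n::finite)) = (\<lambda>x. 2 * real (CARD('n) - 1))"
proof -
  have "pd i (pd i (projsq k)) = (\<lambda>x. if i = k then 0 else 2)" for i
  proof (cases "i = k")
    case False
    then have "pd i (\<lambda>x. 2 * x $ i) = (\<lambda>x. 2)"
      by (subst pd_scale[of k]) (auto intro: hpoly.coord)
    with False show ?thesis by (simp add: pd_projsq)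
  qed (simp add: pd_projsq)
  moreover have "(\<Sum>i\<in>UNIV. if i = k then 0 else (2::real)) = (\<Sum>i\<in>UNIV - {k}. 2)"
    by (simp add: sum.remove[of UNIV k])
  moreover have "real (CARD('n) - 1) = real CARD('n) - 1"
    by (simp add: of_nat_diff Suc_leI)
  ultimately show ?thesis
    by (simp add: lap_def card_Diff_singleton mult.commute)
qed

section \<open>Derivatives along lines and the second-derivative test\<close>

lemma has_derivative_line:
  assumes "hpoly k f"
  shows "((\<lambda>s. f (x + s *\<^sub>R u)) has_real_derivative (\<Sum>i\<in>UNIV. u $ i * pd i f (x + s *\<^sub>R u))) (at s)"
proof -
  have "((\<lambda>s. x + s *\<^sub>R u) has_derivative (\<lambda>t. t *\<^sub>R u)) (at s)"
    by (auto intro!: derivative_eq_intros)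
  from has_derivative_compose[OF this hpoly_has_derivative[OF assms]]
  show ?thesis
    unfolding has_field_derivative_def
    by (rule has_derivative_eq_rhs) (auto simp: sum_distrib_left sum_distrib_right mult_ac)
qed

lemma has_derivative_line2:
  assumes "hpoly k f"
  shows "((\<lambda>s. \<Sum>i\<in>UNIV. u $ i * pd i f (x + s *\<^sub>R u)) has_real_derivative
    (\<Sum>i\<in>UNIV. \<Sum>j\<in>UNIV. u $ i * u $ j * pd j (pd i f) (x + s *\<^sub>R u))) (at s)"
  by (auto intro!: derivative_eq_intros has_derivative_line[OF hpoly_pd[OF assms]]
      simp: sum_distrib_left mult_ac)

text \<open>If \<open>g2\<close> were positive, \<open>g'\<close> would be positive just to the
  right of its zero at 0, and by the mean value theorem \<open>g\<close> would exceed
  \<open>g 0\<close> there.\<close>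

lemma second_derivative_local_max:
  fixes g :: "real \<Rightarrow> real"
  assumes d1: "\<And>s. (g has_real_derivative g' s) (at s)"
    and d2: "(g' has_real_derivative g2) (at 0)"
    and "\<delta> > 0" and max: "\<And>s. \<bar>s\<bar> < \<delta> \<Longrightarrow> g s \<le> g 0"
  shows "g2 \<le> 0"
proof (rule ccontr)
  assume "\<not> g2 \<le> 0"
  then have "g2 > 0" by simp
  have "g' 0 = 0"
    using DERIV_local_max[OF d1[of 0] \<open>\<delta> > 0\<close>] max by simp
  from DERIV_pos_inc_right[OF d2 \<open>g2 > 0\<close>] obtain d where d: "d > 0"
    "\<And>h. h > 0 \<Longrightarrow> h < d \<Longrightarrow> g' 0 < g' h" by auto
  define s where "s = min d \<delta> / 2"
  have s: "s > 0" "s < d" "s < \<delta>" using d(1) \<open>\<delta> > 0\<close> by (auto simp: s_def)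
  obtain z where z: "0 < z" "z < s" "g s - g 0 = (s - 0) * g' z"
    using MVT2[of 0 s g g'] s d1 by auto
  have "g' z > 0" using d(2)[of z] z s \<open>g' 0 = 0\<close> by auto
  then have "g s > g 0" using z s by (smt (verit) mult_pos_pos)
  with max[of s] s show False by auto
qed

text \<open>Only maximality along one line is required; \<open>u\<close> will be a coordinate vector
  in the maximum principle and a gradient at contact points.\<close>

lemma hpoly_second_derivative_local_max:
  assumes "hpoly k f" and "\<delta> > 0" and max: "\<And>s. \<bar>s\<bar> < \<delta> \<Longrightarrow> f (x + s *\<^sub>R u) \<le> f x"
  shows "(\<Sum>i\<in>UNIV. \<Sum>j\<in>UNIV. u $ i * u $ j * pd j (pd i f) x) \<le> 0"
  using second_derivative_local_max[OF has_derivative_line[OF assms(1), of x u]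
    has_derivative_line2[OF assms(1), of u x 0] assms(2)] max by simp

lemma double_sum_axis:
  fixes a :: "'n::finite \<Rightarrow> 'n \<Rightarrow> real"
  shows "(\<Sum>i\<in>UNIV. \<Sum>j\<in>UNIV. axis m (1::real) $ i * axis m 1 $ j * a i j) = a m m"
proof -
  have "(\<Sum>i\<in>UNIV. \<Sum>j\<in>UNIV. axis m (1::real) $ i * axis m 1 $ j * a i j)
      = (\<Sum>i\<in>UNIV. \<Sum>j\<in>UNIV. if i = m then (if j = m then a i j else 0) else 0)"
    by (intro sum.cong refl) (auto simp: axis_def)
  also have "\<dots> = (\<Sum>i\<in>UNIV. if i = m then a i m else 0)"
    by (intro sum.cong refl) auto
  finally show ?thesis by simp
qed

section \<open>Maximum principle on horizontal discs and the interior gradient bound\<close>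

abbreviation disc :: "'n::finite \<Rightarrow> real \<Rightarrow> (real^'n) set" where
  "disc k R \<equiv> {x. x $ k = 0 \<and> norm x \<le> R}"

lemma compact_disc: "compact (disc k R)"
proof -
  have "disc k R = {x. x $ k = 0} \<inter> cball 0 R" by auto
  moreover have "closed {x::real^'a. x $ k = 0}"
    by (intro closed_Collect_eq continuous_intros)
  ultimately show ?thesis by (metis compact_cball closed_Int_compact)
qed

lemma proj_disc: "x $ k = 0 \<Longrightarrow> proj k x = x"
  by (auto simp: vec_eq_iff)

lemma norm_proj_le: "norm (proj k x) \<le> norm x"
  by (rule norm_le_componentwise_cart) auto

text \<open>At an interior maximum each pure second derivative is nonpositive, so the Laplacian
  cannot be positive. The maximum is taken within the slice \<open>x $ k = 0\<close>; the direction
  \<open>k\<close> contributes zero by \<open>pd_missing\<close>.\<close>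

lemma strict_subharmonic_max:
  assumes w: "hpoly k w" and lap: "\<And>x. x \<in> disc k R \<Longrightarrow> norm x < R \<Longrightarrow> lap w x > 0"
    and bd: "\<And>x. x $ k = 0 \<Longrightarrow> norm x = R \<Longrightarrow> w x \<le> M"
    and x: "x \<in> disc k R"
  shows "w x \<le> M"
proof (rule ccontr)
  assume neg: "\<not> w x \<le> M"
  obtain y where y: "y \<in> disc k R" "\<And>z. z \<in> disc k R \<Longrightarrow> w z \<le> w y"
    using continuous_attains_sup[OF compact_disc, of k R w] x hpoly_continuous[OF w] by blast
  have "w y > M" using y(2)[OF x] neg by linarith
  with bd[of y] y(1) have yR: "norm y < R" by force
  have "pd i (pd i w) y \<le> 0" for i
  proof (cases "i = k")
    case True
    then show ?thesis using pd_missing[OF w] by simp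
  next
    case False
    have "(\<Sum>a\<in>UNIV. \<Sum>j\<in>UNIV. axis i (1::real) $ a * axis i 1 $ j * pd j (pd a w) y) \<le> 0"
    proof (rule hpoly_second_derivative_local_max[OF w])
      show "R - norm y > 0" using yR by simp
      fix s :: real assume s: "\<bar>s\<bar> < R - norm y"
      have "norm (y + s *\<^sub>R axis i 1) \<le> norm y + \<bar>s\<bar>"
        by (metis norm_triangle_ineq norm_scaleR norm_axis_1 mult.right_neutral)
      then have "y + s *\<^sub>R axis i 1 \<in> disc k R"
        using s y(1) False by (auto simp: axis_def)
      then show "w (y + s *\<^sub>R axis i 1) \<le> w y" by (rule y(2))
    qed
    then show ?thesis using double_sum_axis[of i "\<lambda>a j. pd j (pd a w) y"] by simp
  qed
  then have "lap w y \<le> 0" unfolding lap_def by (intro sum_nonpos) auto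
  with lap[OF y(1) yR] show False by simp
qed

text \<open>Adding \<open>\<delta> * projsq k x\<close> makes the Laplacian strictly positive, since
  \<open>CARD('n) \<ge> 2\<close> leaves at least one horizontal direction. The choice of
  \<open>\<delta>\<close> keeps the rise of the boundary values below \<open>e\<close>.\<close>

lemma subharmonic_max:
  fixes k :: "'n::finite"
  assumes n: "CARD('n) \<ge> 2"
    and w: "hpoly k w" and lap: "\<And>x. x \<in> disc k R \<Longrightarrow> norm x < R \<Longrightarrow> lap w x \<ge> 0"
    and bd: "\<And>x. x $ k = 0 \<Longrightarrow> norm x = R \<Longrightarrow> w x \<le> M"
    and x: "x \<in> disc k R"
  shows "w x \<le> M"
proof (rule field_le_epsilon)
  fix e :: real assume e: "e > 0"
  define \<delta> where "\<delta> = e / (R\<^sup>2 + 1)"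
  have \<delta>: "\<delta> > 0" using e by (simp add: \<delta>_def sum_power2_gt_zero_iff add_nonneg_pos)
  let ?w = "\<lambda>x. w x + \<delta> * projsq k x"
  have "?w x \<le> M + \<delta> * R\<^sup>2"
  proof (rule strict_subharmonic_max[OF _ _ _ x])
    show "hpoly k ?w" by (intro hpoly_intros w hpoly_projsq)
    fix y assume y: "y \<in> disc k R" "norm y < R"
    have "lap ?w y = lap w y + \<delta> * (2 * real (CARD('n) - 1))"
      using w by (simp add: lap_add[of k] lap_scale[of k] hpoly_projsq hpoly_scale lap_projsq)
    then show "lap ?w y > 0" using lap[OF y] \<delta> n by (simp add: add_nonneg_pos)
  next
    fix y :: "real^'n" assume "y $ k = 0" "norm y = R"
    then show "?w y \<le> M + \<delta> * R\<^sup>2" using bd[of y] by (simp add: projsq_eq proj_disc)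
  qed
  moreover have "\<delta> * projsq k x \<ge> 0" using \<delta> by (simp add: projsq_eq)
  moreover have "\<delta> * R\<^sup>2 \<le> e"
    using e by (simp add: \<delta>_def divide_le_eq add_nonneg_pos algebra_simps not_less)
  ultimately show "w x \<le> M + e" by linarith
qed

text \<open>Derivatives with constant coefficients commute with the Laplacian; this allows the
  gradient bound to be applied a second time, to a derivative.\<close>

lemma lap_directional_derivative:
  assumes v: "hpoly k v" and harm: "lap v = (\<lambda>x. 0)"
  shows "lap (\<lambda>x. \<Sum>i\<in>I. u $ i * pd i v x) = (\<lambda>x. 0)"
proof (induction I rule: infinite_finite_induct)
  case (insert a I)
  then show ?case
    using v by (simp add: lap_add[of k] lap_scale[of k] hpoly_sum hpoly_scale hpoly_pd
        pd_lap[of k, symmetric] harm)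
qed (simp_all add: lap_def)

text \<open>Bernstein's trick: with \<open>\<eta> = R\<^sup>2 - |x|\<^sup>2\<close>, the function
  \<open>\<eta>\<^sup>2 (\<partial>\<^sub>u v)\<^sup>2 + (12 + 2d) R\<^sup>2 v\<^sup>2\<close> is subharmonic.\<close>

lemma harmonic_gradient_bound:
  fixes k :: "'n::finite"
  assumes n: "CARD('n) \<ge> 2" and v: "hpoly k v" and harm: "lap v = (\<lambda>x. 0)"
    and R: "R > 0" and M: "\<And>x. x \<in> disc k R \<Longrightarrow> \<bar>v x\<bar> \<le> M"
    and u: "norm u = 1" and x: "x \<in> disc k (R / 2)"
  shows "\<bar>\<Sum>i\<in>UNIV. u $ i * pd i v x\<bar> \<le> 8 * sqrt (real CARD('n)) / R * M"
proof -
  define d where "d = real (CARD('n) - 1)"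
  define g where "g = (\<lambda>x. \<Sum>i\<in>UNIV. u $ i * pd i v x)"
  define \<eta> where "\<eta> = (\<lambda>x. R\<^sup>2 - projsq k x)"
  \<comment> \<open>\<open>L\<close> is chosen so that \<open>2 * L * (g x)\<^sup>2\<close> exactly
    cancels the two negative terms below: 24 R^2 g^2 left over from completing the square, and 4 d
    R^2 g^2 from the Laplacian of \<open>\<eta>\<close>.\<close>
  define L where "L = (12 + 2 * d) * R\<^sup>2"
  have d: "d \<ge> 0" by (simp add: d_def)
  have hg: "hpoly k g" unfolding g_def by (intro hpoly_sum hpoly_scale hpoly_pd v) auto
  have h\<eta>: "hpoly k \<eta>" unfolding \<eta>_def by (intro hpoly_intros hpoly_projsq)
  have lg: "lap g = (\<lambda>x. 0)"
    unfolding g_def by (rule lap_directional_derivative[OF v harm])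
  have p\<eta>: "pd i \<eta> = (\<lambda>x. if i = k then 0 else - 2 * x $ i)" for i
    unfolding \<eta>_def by (subst pd_diff[of k]) (auto simp: hpoly.const hpoly_projsq pd_projsq)
  have l\<eta>: "lap \<eta> = (\<lambda>x. - 2 * d)"
    unfolding \<eta>_def by (subst lap_diff[of k]) (auto simp: hpoly.const hpoly_projsq lap_projsq d_def, simp add: lap_def)
  define w where "w = (\<lambda>x. (\<eta> x * g x) * (\<eta> x * g x) + L * (v x * v x))"
  have hw: "hpoly k w" unfolding w_def by (intro hpoly_intros h\<eta> hg v)
  have lw: "lap w x \<ge> 0" if "x \<in> disc k R" for x
  proof -
    have nx: "norm x \<le> R" "x $ k = 0" using that by auto
    then have \<eta>0: "\<eta> x \<ge> 0" "\<eta> x \<le> R\<^sup>2"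
      using power_mono[of "norm x" R 2] by (auto simp: \<eta>_def projsq_eq proj_disc)
    let ?S = "\<lambda>a b. \<Sum>i\<in>UNIV. a i * (b i :: real)"
    define G where "G = (\<lambda>i. pd i g x)"
    define H where "H = (\<lambda>i. pd i \<eta> x)"
    define V where "V = (\<lambda>i. pd i v x)"
    have lap1: "lap (\<lambda>x. \<eta> x * g x) x = - 2 * d * g x + 2 * ?S H G"
      using lap_mult[OF h\<eta> hg] by (simp add: lg l\<eta> G_def H_def)
    have "pd i (\<lambda>x. \<eta> x * g x) x = H i * g x + \<eta> x * G i" for i
      using pd_mult[OF h\<eta> hg] by (simp add: G_def H_def)
    then have lap2: "lap (\<lambda>x. (\<eta> x * g x) * (\<eta> x * g x)) x
       = 2 * (\<eta> x * g x) * (- 2 * d * g x + 2 * ?S H G) + 2 * (\<Sum>i\<in>UNIV. (H i * g x + \<eta> x * G i)\<^sup>2)"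
      using lap_mult[OF hpoly.mult[OF h\<eta> hg] hpoly.mult[OF h\<eta> hg]]
      by (simp add: lap1 power2_eq_square algebra_simps)
    have lap3: "lap (\<lambda>x. v x * v x) x = 2 * ?S V V"
      using lap_mult[OF v v] by (simp add: harm V_def)
    have lapw: "lap w x = 2 * (\<eta> x * g x) * (- 2 * d * g x + 2 * ?S H G)
        + 2 * (\<Sum>i\<in>UNIV. (H i * g x + \<eta> x * G i)\<^sup>2) + L * (2 * ?S V V)"
      using lap2 lap3 unfolding w_def
      by (simp add: lap_add[of k] lap_scale[of k] hpoly_intros h\<eta> hg v)
    have "4 * (\<eta> x * g x) * ?S H G + 2 * (\<Sum>i\<in>UNIV. (H i * g x + \<eta> x * G i)\<^sup>2)
       = (\<Sum>i\<in>UNIV. 4 * (\<eta> x * g x) * (H i * G i) + 2 * (H i * g x + \<eta> x * G i)\<^sup>2)"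
      by (simp add: sum_distrib_left sum.distrib)
    also have "\<dots> \<ge> (\<Sum>i\<in>UNIV. - 6 * (g x)\<^sup>2 * (H i * H i))"
    proof (rule sum_mono)
      \<comment> \<open>Completing the square coordinatewise: the indefinite mixed term is absorbed
        at the price of 6 g^2 H^2.\<close>
      fix i
      have "4 * (\<eta> x * g x) * (H i * G i) + 2 * (H i * g x + \<eta> x * G i)\<^sup>2 + 6 * (g x)\<^sup>2 * (H i * H i)
         = 2 * (2 * g x * H i + \<eta> x * G i)\<^sup>2" by (simp add: power2_eq_square algebra_simps)
      also have "\<dots> \<ge> 0" by simp
      finally show "- 6 * (g x)\<^sup>2 * (H i * H i) \<le> 4 * (\<eta> x * g x) * (H i * G i) + 2 * (H i * g x + \<eta> x * G i)\<^sup>2"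
        by linarith
    qed
    finally have A: "4 * (\<eta> x * g x) * ?S H G + 2 * (\<Sum>i\<in>UNIV. (H i * g x + \<eta> x * G i)\<^sup>2)
        \<ge> - 6 * (g x)\<^sup>2 * ?S H H" by (simp add: sum_distrib_left)
    have "?S H H = 4 * projsq k x"
      by (simp add: H_def p\<eta> projsq_def sum_distrib_left sum.remove[of UNIV k])
    also have "\<dots> \<le> 4 * R\<^sup>2" using \<eta>0 by (simp add: \<eta>_def)
    finally have HH: "?S H H \<le> 4 * R\<^sup>2" .
    have VV: "(g x)\<^sup>2 \<le> ?S V V"
    proof -
      define Vv :: "real^'n" where "Vv = (\<chi> i. V i)"
      have "g x = u \<bullet> Vv" by (simp add: g_def Vv_def V_def inner_vec_def)
      then have "(g x)\<^sup>2 \<le> (u \<bullet> u) * (Vv \<bullet> Vv)" using Cauchy_Schwarz_ineq by metis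
      also have "\<dots> = ?S V V" using u dot_square_norm[of u] by (simp add: Vv_def inner_vec_def)
      finally show ?thesis .
    qed
    have "(g x)\<^sup>2 * ?S H H \<le> (g x)\<^sup>2 * (4 * R\<^sup>2)" using HH by (rule mult_left_mono) simp
    moreover have "d * (g x)\<^sup>2 * \<eta> x \<le> d * (g x)\<^sup>2 * R\<^sup>2" using \<eta>0 d by (intro mult_left_mono) auto
    moreover have "L * (g x)\<^sup>2 \<le> L * ?S V V" using VV d by (intro mult_left_mono) (auto simp: L_def)
    moreover have "lap w x = (4 * (\<eta> x * g x) * ?S H G + 2 * (\<Sum>i\<in>UNIV. (H i * g x + \<eta> x * G i)\<^sup>2))
        - 4 * (d * (g x)\<^sup>2 * \<eta> x) + 2 * (L * ?S V V)"
      unfolding lapw by (simp add: algebra_simps power2_eq_square)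
    ultimately have "lap w x \<ge> - 6 * ((g x)\<^sup>2 * (4 * R\<^sup>2)) - 4 * (d * (g x)\<^sup>2 * R\<^sup>2) + 2 * (L * (g x)\<^sup>2)"
      using A by linarith
    also have "- 6 * ((g x)\<^sup>2 * (4 * R\<^sup>2)) - 4 * (d * (g x)\<^sup>2 * R\<^sup>2) + 2 * (L * (g x)\<^sup>2) = 0"
      by (simp add: L_def algebra_simps)
    finally show ?thesis by simp
  qed
  have x': "x \<in> disc k R" "norm x \<le> R / 2" "x $ k = 0" using x R by auto
  have M0: "M \<ge> 0" using M[OF x'(1)] by linarith
  have vv: "v y * v y \<le> M\<^sup>2" if "y \<in> disc k R" for y
    using M[OF that] by (metis abs_le_square_iff abs_of_nonneg M0 power2_eq_square)
  have "w x \<le> L * M\<^sup>2"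
  proof (rule subharmonic_max[OF n hw _ _ x'(1)])
    fix y :: "real^'n" assume y: "y $ k = 0" "norm y = R"
    then have "\<eta> y = 0" by (simp add: \<eta>_def projsq_eq proj_disc)
    then have "w y = L * (v y * v y)" by (simp add: w_def)
    also have "\<dots> \<le> L * M\<^sup>2" using vv[of y] y d by (intro mult_left_mono) (auto simp: L_def)
    finally show "w y \<le> L * M\<^sup>2" .
  qed (use lw in auto)
  moreover have "L * (v x * v x) \<ge> 0" using d by (simp add: L_def)
  ultimately have "(\<eta> x * g x) * (\<eta> x * g x) \<le> L * M\<^sup>2" by (simp add: w_def)
  then have *: "(\<eta> x)\<^sup>2 * (g x)\<^sup>2 \<le> L * M\<^sup>2" by (simp add: power2_eq_square mult_ac)
  \<comment> \<open>On the half disc \<open>\<eta>\<close> is at least 3/4 R^2 and can be divided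
    out. The later estimate 12 + 2 d \<le> 9 n is where the dimension being at least 2
    enters.\<close>
  have "(norm x)\<^sup>2 \<le> (R/2)\<^sup>2" using x'(2) by (intro power_mono) auto
  then have "\<eta> x \<ge> 3/4 * R\<^sup>2" using x'(3) by (simp add: \<eta>_def projsq_eq proj_disc power_divide)
  then have "(\<eta> x)\<^sup>2 \<ge> (3/4 * R\<^sup>2)\<^sup>2" by (intro power_mono) auto
  then have "(3/4 * R\<^sup>2)\<^sup>2 * (g x)\<^sup>2 \<le> L * M\<^sup>2" using * by (meson mult_right_mono order_trans zero_le_power2)
  then have "R\<^sup>2 * (9/16 * R\<^sup>2 * (g x)\<^sup>2) \<le> R\<^sup>2 * ((12 + 2 * d) * M\<^sup>2)"
    by (simp add: L_def power2_eq_square algebra_simps)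
  then have "9/16 * R\<^sup>2 * (g x)\<^sup>2 \<le> (12 + 2 * d) * M\<^sup>2" using R by simp
  also have "\<dots> \<le> 9 * real CARD('n) * M\<^sup>2" using n by (intro mult_right_mono) (auto simp: d_def of_nat_diff)
  finally have "9/16 * R\<^sup>2 * (g x)\<^sup>2 \<le> 9 * real CARD('n) * M\<^sup>2" .
  moreover have "real CARD('n) * M\<^sup>2 \<ge> 0" by simp
  ultimately have "R\<^sup>2 * (g x)\<^sup>2 \<le> 64 * real CARD('n) * M\<^sup>2" by (simp only: mult.assoc)
  also have "64 * real CARD('n) * M\<^sup>2 = R\<^sup>2 * (8 * sqrt (real CARD('n)) / R * M)\<^sup>2"
    using R by (simp add: power_mult_distrib power_divide)
  finally have "(g x)\<^sup>2 \<le> (8 * sqrt (real CARD('n)) / R * M)\<^sup>2"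
    using R by simp
  moreover have "0 \<le> 8 * sqrt (real CARD('n)) / R * M" using M0 R by simp
  ultimately have "\<bar>g x\<bar> \<le> 8 * sqrt (real CARD('n)) / R * M"
    using abs_le_square_iff[of "g x" "8 * sqrt (real CARD('n)) / R * M"] by linarith
  then show ?thesis by (simp add: g_def)
qed

section \<open>Harmonic polynomials\<close>

definition euler :: "'n::finite \<Rightarrow> (real^'n \<Rightarrow> real) \<Rightarrow> real^'n \<Rightarrow> real" where
  "euler k f = (\<lambda>x. \<Sum>j\<in>UNIV - {k}. x $ j * pd j f x)"

lemma euler_add: "hpoly k f \<Longrightarrow> hpoly k g \<Longrightarrow> euler k (\<lambda>x. f x + g x) = (\<lambda>x. euler k f x + euler k g x)"
  by (simp add: euler_def pd_add[of k] algebra_simps sum.distrib)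

lemma euler_mult: "hpoly k f \<Longrightarrow> hpoly k g \<Longrightarrow>
    euler k (\<lambda>x. f x * g x) = (\<lambda>x. euler k f x * g x + f x * euler k g x)"
  by (simp add: euler_def pd_mult[of k] algebra_simps sum.distrib sum_distrib_left)

lemma euler_scale: "hpoly k f \<Longrightarrow> euler k (\<lambda>x. c * f x) = (\<lambda>x. c * euler k f x)"
  using euler_mult[OF hpoly.const, of k f c] by (simp add: euler_def)

lemma euler_projsq: "euler k (projsq k) = (\<lambda>x. 2 * projsq k x)"
  by (simp add: euler_def pd_projsq projsq_def sum_distrib_left mult_ac)

lemma euler_coord: "i \<noteq> k \<Longrightarrow> euler k (\<lambda>x. x $ i) = (\<lambda>x. x $ i)"
  by (rule ext) (simp add: euler_def if_distrib sum.If_cases cong: if_cong)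

text \<open>The commutator of the Euler operator with \<open>pd i\<close> is \<open>- pd i\<close>:
  differentiation lowers the degree of homogeneity by one.\<close>

lemma euler_pd:
  assumes h: "hpoly k h" and i: "i \<noteq> k"
  shows "euler k (pd i h) = (\<lambda>x. pd i (euler k h) x - pd i h x)"
proof
  fix x :: "real^'a"
  have "pd i (euler k h) x = (\<Sum>j\<in>UNIV - {k}. pd i (\<lambda>x. x $ j * pd j h x) x)"
    unfolding euler_def by (subst pd_sum[of _ k]) (auto intro!: hpoly.mult hpoly.coord hpoly_pd h)
  also have "\<dots> = (\<Sum>j\<in>UNIV - {k}. (if i = j then pd j h x else 0) + x $ j * pd j (pd i h) x)"
    by (intro sum.cong refl)
      (simp add: pd_mult[of k] hpoly.coord hpoly_pd h pd_commute[OF h, of i])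
  also have "\<dots> = pd i h x + euler k (pd i h) x"
    using i by (simp add: sum.distrib euler_def)
  finally show "euler k (pd i h) x = pd i (euler k h) x - pd i h x" by simp
qed

lemma sum_remove_missing:
  assumes "hpoly k f"
  shows "(\<Sum>j\<in>UNIV. a j * pd j f x) = (\<Sum>j\<in>UNIV - {k}. a j * pd j f x)"
  by (simp add: sum.remove[of UNIV k] pd_missing[OF assms])

text \<open>Along the ray through \<open>x\<close>, the derivative of \<open>h\<close> is the Euler
  operator divided by the parameter, hence zero for positive parameters; continuity extends the
  constancy to the origin.\<close>

lemma euler_zero_const:
  assumes h: "hpoly k h" and e: "\<And>x. euler k h x = 0"
  shows "h x = h 0"
proof -
  have z: "(\<Sum>i\<in>UNIV. x $ i * pd i h (0 + s *\<^sub>R x)) = 0" if "s \<noteq> 0" for s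
  proof -
    have "s * (\<Sum>i\<in>UNIV. x $ i * pd i h (s *\<^sub>R x)) = (\<Sum>i\<in>UNIV. (s *\<^sub>R x) $ i * pd i h (s *\<^sub>R x))"
      by (simp add: sum_distrib_left mult_ac)
    also have "\<dots> = euler k h (s *\<^sub>R x)" by (simp only: sum_remove_missing[OF h] euler_def)
    finally show ?thesis using e that by simp
  qed
  have "continuous_on {0..1} (\<lambda>s. h (0 + s *\<^sub>R x))"
    by (rule continuous_at_imp_continuous_on) (blast intro: DERIV_isCont has_derivative_line[OF h])
  moreover have "((\<lambda>s. h (0 + s *\<^sub>R x)) has_real_derivative 0) (at s)" if "0 < s" for s
    using has_derivative_line[OF h, of 0 x s] z[of s] that by simp
  ultimately have "h (0 + 1 *\<^sub>R x) = h (0 + 0 *\<^sub>R x)"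
    by (intro DERIV_isconst2[of 0 1 "\<lambda>s. h (0 + s *\<^sub>R x)"]) auto
  then show ?thesis by simp
qed

text \<open>Sums of homogeneous harmonic polynomials, with homogeneity expressed by Euler's
  identity. The decomposition is built in because the degree \<open>m\<close> of each summand enters
  the divisor d + 2 m - 2 used for multiplication by a coordinate.\<close>

inductive harm :: "'n \<Rightarrow> (real^'n \<Rightarrow> real) \<Rightarrow> bool" for k :: "'n::finite" where
  zero: "harm k (\<lambda>x. 0)"
| add: "harm k f \<Longrightarrow> hpoly k h \<Longrightarrow> lap h = (\<lambda>x. 0) \<Longrightarrow> euler k h = (\<lambda>x. real m * h x) \<Longrightarrow>
    harm k (\<lambda>x. f x + h x)"

lemma harm_hpoly: "harm k f \<Longrightarrow> hpoly k f"
  by (induction rule: harm.induct) (auto intro: hpoly_intros)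

lemma harm_lap: "harm k f \<Longrightarrow> lap f = (\<lambda>x. 0)"
  by (induction rule: harm.induct) (auto simp: lap_add[of k] harm_hpoly, simp add: lap_def)

lemma harm_plus: "harm k g \<Longrightarrow> harm k f \<Longrightarrow> harm k (\<lambda>x. f x + g x)"
  by (induction rule: harm.induct) (auto simp: add.assoc[symmetric] intro: harm.add)

lemma harm_homogeneous: "hpoly k h \<Longrightarrow> lap h = (\<lambda>x. 0) \<Longrightarrow> euler k h = (\<lambda>x. real m * h x) \<Longrightarrow> harm k h"
  using harm.add[OF harm.zero] by fastforce

lemma harm_scale: "harm k f \<Longrightarrow> harm k (\<lambda>x. c * f x)"
proof (induction rule: harm.induct)
  case (add f h m)
  have "harm k (\<lambda>x. c * f x + c * h x)"
    by (rule harm.add[where m = m]) (use add in \<open>auto simp: lap_scale[of k] euler_scale intro: hpoly_scale\<close>)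
  then show ?case by (simp add: algebra_simps)
qed (simp add: harm.zero)

text \<open>For \<open>h\<close> harmonic and homogeneous of degree \<open>m\<close>, the function
  \<open>x\<^sub>i h - (|x|\<^sup>2 - R\<^sup>2) \<partial>\<^sub>i h / (d + 2 m - 2)\<close> is harmonic and agrees with \<open>x\<^sub>i h\<close> on the sphere.\<close>

lemma harm_mult_coord_homogeneous:
  fixes k :: "'n::finite"
  assumes n: "CARD('n) \<ge> 2" and h: "hpoly k h" and lh: "lap h = (\<lambda>x. 0)"
    and eh: "euler k h = (\<lambda>x. real m * h x)" and i: "i \<noteq> k"
  shows "\<exists>g. harm k g \<and> (\<forall>x. projsq k x = R\<^sup>2 \<longrightarrow> g x = x $ i * h x)"
proof (cases "m = 0")
  \<comment> \<open>In degree 0 the divisor d + 2 m - 2 need not be positive. But then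
    \<open>h\<close> is constant, and \<open>x $ i * h x\<close> is harmonic as it stands.\<close>
  case True
  then have "euler k h x = 0" for x by (simp add: eh)
  from euler_zero_const[OF h this] have hc: "h = (\<lambda>x. h 0)" by blast
  have "harm k (\<lambda>x. h 0 * x $ i)"
  proof (rule harm_scale, rule harm_homogeneous[where m = 1])
    show "lap (\<lambda>x::real^'n. x $ i) = (\<lambda>x. 0)"
      by (simp add: lap_def if_distrib[where f = "\<lambda>c. pd _ (\<lambda>x. c) _"])
  qed (use i in \<open>auto simp: euler_coord intro: hpoly.coord\<close>)
  then have "harm k (\<lambda>x. x $ i * h x)" by (subst hc) (simp add: mult.commute)
  then show ?thesis by blast
next
  case False
  define d where "d = real (CARD('n) - 1)"
  define c where "c = 1 / (d + 2 * real m - 2)"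
  have dm: "d + 2 * real m - 2 > 0" using n False by (simp add: d_def of_nat_diff)
  let ?p = "pd i h"
  have hp: "hpoly k ?p" by (rule hpoly_pd[OF h])
  have lp: "lap ?p = (\<lambda>x. 0)" using pd_lap[OF h, of i] lh by simp
  have ep: "euler k ?p = (\<lambda>x. (real m - 1) * ?p x)"
    by (simp add: euler_pd[OF h i] eh pd_scale[OF h] algebra_simps)
  \<comment> \<open>The harmonic extension is split into its pieces of degree m + 1 and m - 1,
    because \<open>harm\<close> accepts homogeneous summands only.\<close>
  define h1 where "h1 = (\<lambda>x. x $ i * h x + (- c) * (projsq k x * ?p x))"
  define h2 where "h2 = (\<lambda>x. (c * R\<^sup>2) * ?p x)"
  have hc: "hpoly k (\<lambda>x. x $ i * h x)" by (intro hpoly_intros h i)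
  have hq: "hpoly k (\<lambda>x. projsq k x * ?p x)" by (intro hpoly_intros hpoly_projsq hp)
  have h1: "hpoly k h1" unfolding h1_def by (intro hpoly_intros hc hq)
  have lapc: "lap (\<lambda>x. x $ i * h x) = (\<lambda>x. 2 * ?p x)"
  proof -
    have "lap (\<lambda>x::real^'n. x $ i) = (\<lambda>x. 0)"
      by (simp add: lap_def if_distrib[where f = "\<lambda>c. pd _ (\<lambda>x. c) _"])
    then show ?thesis
      using lap_mult[OF hpoly.coord[OF i] h] by (simp add: lh if_distrib if_distribR cong: if_cong)
  qed
  have grad: "(\<Sum>j\<in>UNIV. pd j (projsq k) x * pd j ?p x) = 2 * ((real m - 1) * ?p x)" for x
  proof -
    have "(\<Sum>j\<in>UNIV. pd j (projsq k) x * pd j ?p x) = (\<Sum>j\<in>UNIV-{k}. 2 * (x $ j * pd j ?p x))"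
      unfolding sum_remove_missing[OF hp] by (intro sum.cong) (auto simp: pd_projsq)
    also have "\<dots> = 2 * euler k ?p x" by (simp add: euler_def sum_distrib_left)
    finally show ?thesis by (simp add: ep)
  qed
  \<comment> \<open>The Laplacian of \<open>projsq k\<close> contributes 2 d and the gradient term 4
    (m - 1); \<open>c\<close> is the factor for which the total cancels
    \<open>2 * ?p x\<close>.\<close>
  have lapq: "lap (\<lambda>x. projsq k x * ?p x) = (\<lambda>x. (2 * (d + 2 * real m - 2)) * ?p x)"
    unfolding lap_mult[OF hpoly_projsq hp] lap_projsq grad lp d_def[symmetric]
    by (simp add: algebra_simps)
  have "lap h1 = (\<lambda>x. 2 * ?p x + (- c) * ((2 * (d + 2 * real m - 2)) * ?p x))"
    unfolding h1_def by (subst lap_add[OF hc hpoly_scale[OF hq]], subst lap_scale[OF hq]) (simp add: lapc lapq)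
  also have "\<dots> = (\<lambda>x. 0)"
  proof
    fix x
    have "2 * ?p x + (- c) * ((2 * (d + 2 * real m - 2)) * ?p x) = 2 * ?p x * (1 - c * (d + 2 * real m - 2))"
      by (simp add: algebra_simps)
    also have "c * (d + 2 * real m - 2) = 1" using dm by (simp add: c_def)
    finally show "2 * ?p x + (- c) * ((2 * (d + 2 * real m - 2)) * ?p x) = 0" by simp
  qed
  finally have l1: "lap h1 = (\<lambda>x. 0)" .
  have e1: "euler k h1 = (\<lambda>x. real (Suc m) * h1 x)"
    unfolding h1_def
    by (subst euler_add[OF hc hpoly_scale[OF hq]], subst euler_scale[OF hq],
        subst euler_mult[OF hpoly.coord[OF i] h], subst euler_mult[OF hpoly_projsq hp])
      (simp add: euler_coord i eh ep euler_projsq algebra_simps)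
  have "harm k h1" by (rule harm_homogeneous[OF h1 l1 e1])
  moreover have "harm k h2"
    unfolding h2_def using False
    by (intro harm_scale harm_homogeneous[OF hp lp, of "m - 1"]) (simp add: ep of_nat_diff)
  ultimately have "harm k (\<lambda>x. h1 x + h2 x)" by (rule harm_plus[rotated])
  moreover have "h1 x + h2 x = x $ i * h x" if "projsq k x = R\<^sup>2" for x
    using that by (simp add: h1_def h2_def)
  ultimately show ?thesis by blast
qed

lemma harm_mult_coord:
  fixes k :: "'n::finite"
  assumes n: "CARD('n) \<ge> 2" and i: "i \<noteq> k" and f: "harm k f"
  shows "\<exists>g. harm k g \<and> (\<forall>x. projsq k x = R\<^sup>2 \<longrightarrow> g x = x $ i * f x)"
  using f
proof (induction rule: harm.induct)
  case (add f h m)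
  obtain g1 where g1: "harm k g1" "\<And>x. projsq k x = R\<^sup>2 \<Longrightarrow> g1 x = x $ i * f x"
    using add.IH by blast
  obtain g2 where g2: "harm k g2" "\<And>x. projsq k x = R\<^sup>2 \<Longrightarrow> g2 x = x $ i * h x"
    using harm_mult_coord_homogeneous[OF n add.hyps(2-4) i, of R] by blast
  show ?case
    by (rule exI[of _ "\<lambda>x. g1 x + g2 x"]) (use g1 g2 harm_plus in \<open>auto simp: algebra_simps\<close>)
qed (auto intro: harm.zero)

text \<open>The harmonic factor \<open>f\<close> is carried along for the product case:
  \<open>q x * f x\<close> is first replaced by a harmonic function with the same values on the
  sphere, and that one is multiplied by \<open>p\<close>. With \<open>f\<close> constantly 1 this
  solves the Dirichlet problem with data \<open>p\<close>.\<close>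

lemma harm_mult_hpoly:
  fixes k :: "'n::finite"
  assumes n: "CARD('n) \<ge> 2" and p: "hpoly k p" and f: "harm k f"
  shows "\<exists>g. harm k g \<and> (\<forall>x. projsq k x = R\<^sup>2 \<longrightarrow> g x = p x * f x)"
  using p f
proof (induction arbitrary: f rule: hpoly.induct)
  case (const c)
  then show ?case using harm_scale by blast
next
  case (coord i)
  then show ?case using harm_mult_coord[OF n] by blast
next
  case (add p q)
  obtain g1 where g1: "harm k g1" "\<And>x. projsq k x = R\<^sup>2 \<Longrightarrow> g1 x = p x * f x"
    using add by blast
  obtain g2 where g2: "harm k g2" "\<And>x. projsq k x = R\<^sup>2 \<Longrightarrow> g2 x = q x * f x"
    using add by blast
  show ?case
    by (rule exI[of _ "\<lambda>x. g1 x + g2 x"]) (use g1 g2 harm_plus in \<open>auto simp: algebra_simps\<close>)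
next
  case (mult p q)
  obtain g1 where g1: "harm k g1" "\<And>x. projsq k x = R\<^sup>2 \<Longrightarrow> g1 x = q x * f x"
    using mult by blast
  obtain g2 where g2: "harm k g2" "\<And>x. projsq k x = R\<^sup>2 \<Longrightarrow> g2 x = p x * g1 x"
    using mult.IH(1)[OF g1(1)] by blast
  show ?case
    by (rule exI[of _ g2]) (use g1 g2 in \<open>auto simp: algebra_simps\<close>)
qed

lemma hpoly_of_polynomial:
  fixes p :: "real^'n \<Rightarrow> real"
  assumes "real_polynomial_function p"
  shows "hpoly k (\<lambda>x. p (proj k x))"
  using assms
proof (induction rule: real_polynomial_function.induct)
  case (linear L)
  have "L (proj k x) = (\<Sum>i\<in>UNIV - {k}. L (axis i 1) * x $ i)" for x
    using linear_eq_sum_axis[OF bounded_linear.linear[OF linear], of "proj k x"]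
    by (simp add: sum.remove[of UNIV k] mult.commute)
  then show ?case
    by simp (intro hpoly_sum hpoly_scale hpoly.coord, auto)
qed (auto intro: hpoly_intros)

text \<open>Replacing the Weierstrass polynomial by its harmonic counterpart preserves it on the
  sphere only, so closeness is claimed there; control inside the disc comes later from the maximum
  principle.\<close>

lemma harmonic_approximation:
  fixes k :: "'n::finite"
  assumes n: "CARD('n) \<ge> 2" and f: "continuous_on (disc k R) f" and e: "e > 0" and R: "R > 0"
  obtains v where "hpoly k v" "lap v = (\<lambda>x. 0)" "\<And>x. x $ k = 0 \<Longrightarrow> norm x = R \<Longrightarrow> \<bar>f x - v x\<bar> < e"
proof -
  obtain p where p: "real_polynomial_function p" "\<And>x. x \<in> disc k R \<Longrightarrow> \<bar>f x - p x\<bar> < e"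
    using Stone_Weierstrass_real_polynomial_function[OF compact_disc f e] by blast
  have one: "harm k (\<lambda>x. 1)"
    by (rule harm_homogeneous[where m = 0]) (auto simp: lap_def euler_def intro: hpoly.const)
  obtain v where v: "harm k v" "\<And>x. projsq k x = R\<^sup>2 \<Longrightarrow> v x = p (proj k x)"
    using harm_mult_hpoly[OF n hpoly_of_polynomial[OF p(1), of k] one, of R] by auto
  show ?thesis
  proof
    show "hpoly k v" "lap v = (\<lambda>x. 0)" using v(1) harm_hpoly harm_lap by auto
    fix x :: "real^'n" assume x: "x $ k = 0" "norm x = R"
    then have "v x = p x" using v(2)[of x] by (simp add: projsq_eq proj_disc)
    then show "\<bar>f x - v x\<bar> < e" using p(2)[of x] x by simp
  qed
qed

text \<open>The gradient bound is used twice, for \<open>v\<close> on radius \<open>R\<close> and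
  for its derivative in the direction of \<open>x\<close> on radius \<open>R / 2\<close>; Taylor's
  formula on the segment from the origin does the rest. The constant 64 is half of 2 * 8 *
  8.\<close>

lemma harmonic_second_order:
  fixes k :: "'n::finite"
  assumes n: "CARD('n) \<ge> 2" and v: "hpoly k v" and harm: "lap v = (\<lambda>x. 0)"
    and R: "R > 0" and M: "\<And>x. x \<in> disc k R \<Longrightarrow> \<bar>v x\<bar> \<le> M"
    and x: "x \<in> disc k (R / 4)"
  shows "\<bar>v x - v 0 - (\<Sum>i\<in>UNIV. x $ i * pd i v 0)\<bar> \<le> 64 * real CARD('n) / R\<^sup>2 * M * (norm x)\<^sup>2"
proof (cases "x = 0")
  case False
  define r where "r = norm x"
  define u where "u = (1 / r) *\<^sub>R x"
  have r: "r > 0" "r \<le> R / 4" using False x by (auto simp: r_def)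
  have u: "norm u = 1" "x = r *\<^sub>R u" "u $ k = 0" using False x by (auto simp: u_def r_def)
  define g where "g = (\<lambda>x. \<Sum>i\<in>UNIV. u $ i * pd i v x)"
  have hg: "hpoly k g" unfolding g_def by (intro hpoly_sum hpoly_scale hpoly_pd v) auto
  have lg: "lap g = (\<lambda>x. 0)"
    unfolding g_def by (rule lap_directional_derivative[OF v harm])
  define C where "C = 8 * sqrt (real CARD('n)) / (R / 2) * (8 * sqrt (real CARD('n)) / R * M)"
  have C: "C = 128 * real CARD('n) / R\<^sup>2 * M"
    by (simp add: C_def power2_eq_square)
  have g1: "\<bar>g x\<bar> \<le> 8 * sqrt (real CARD('n)) / R * M" if "x \<in> disc k (R / 2)" for x
    unfolding g_def by (rule harmonic_gradient_bound[OF n v harm R M u(1) that])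
  have g2: "\<bar>\<Sum>i\<in>UNIV. u $ i * pd i g x\<bar> \<le> C" if "x \<in> disc k (R / 4)" for x
    unfolding C_def by (rule harmonic_gradient_bound[OF n hg lg _ g1 u(1)]) (use R that in auto)
  let ?f = "\<lambda>s. v (0 + s *\<^sub>R u)" and ?g = "\<lambda>s. g (0 + s *\<^sub>R u)"
  let ?h = "\<lambda>s. \<Sum>i\<in>UNIV. u $ i * pd i g (0 + s *\<^sub>R u)"
  \<comment> \<open>Taylor's theorem asks for a sequence of derivatives; the expansion has order 2,
    so the values beyond that index are arbitrary.\<close>
  define diff where "diff = (\<lambda>m::nat. if m = 0 then ?f else if m = 1 then ?g else ?h)"
  have "\<exists>t. 0 < t \<and> t < r \<and> v (r *\<^sub>R u) = (\<Sum>m<2. (diff m 0 / fact m) * (r - 0) ^ m) + (diff 2 t / fact 2) * (r - 0) ^ 2"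
  proof -
    have "\<exists>t. (if r < 0 then r < t \<and> t < 0 else 0 < t \<and> t < r) \<and>
      ?f r = (\<Sum>m<2. diff m 0 / fact m * (r - 0) ^ m) + diff 2 t / fact 2 * (r - 0) ^ 2"
    proof (rule Taylor)
      show "\<forall>m t. m < 2 \<and> 0 \<le> t \<and> t \<le> r \<longrightarrow> (diff m has_real_derivative diff (Suc m) t) (at t)"
        using has_derivative_line[OF v, of 0 u] has_derivative_line[OF hg, of 0 u]
        by (auto simp: diff_def less_2_cases_iff g_def[symmetric])
          (auto simp: g_def)
    qed (use r in \<open>auto simp: diff_def\<close>)
    then show ?thesis using r by auto
  qed
  then obtain t where t: "0 < t" "t < r"
    "v (r *\<^sub>R u) = (\<Sum>m<2. (diff m 0 / fact m) * (r - 0) ^ m) + (diff 2 t / fact 2) * (r - 0) ^ 2" by blast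
  have "v x = v 0 + g 0 * r + ?h t / 2 * r\<^sup>2"
    using t(3) unfolding u(2)[symmetric] by (simp add: diff_def numeral_2_eq_2)
  moreover have "g 0 * r = (\<Sum>i\<in>UNIV. x $ i * pd i v 0)"
  proof -
    have "x $ i = r * u $ i" for i using arg_cong[OF u(2), of "\<lambda>y. y $ i"] by simp
    then show ?thesis by (simp add: g_def sum_distrib_left sum_distrib_right mult_ac)
  qed
  ultimately have "\<bar>v x - v 0 - (\<Sum>i\<in>UNIV. x $ i * pd i v 0)\<bar> = \<bar>?h t\<bar> / 2 * r\<^sup>2"
    by (simp add: abs_mult)
  also have "\<dots> \<le> C / 2 * r\<^sup>2"
    using g2[of "0 + t *\<^sub>R u"] t r u by (intro mult_right_mono divide_right_mono) auto
  also have "\<dots> = 64 * real CARD('n) / R\<^sup>2 * M * (norm x)\<^sup>2" by (simp add: C r_def)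
  finally show ?thesis .
qed simp

section \<open>Continuously differentiable functions and the divergence theorem\<close>

text \<open>The differentiability clauses of \<open>C1_compact_support_field\<close>, separated from
  the support so that they can be used for scalar functions and for fields on the whole
  space.\<close>

definition C1 :: "(real^'n \<Rightarrow> 'b::real_normed_vector) \<Rightarrow> bool" where
  "C1 f \<longleftrightarrow> (\<forall>x. f differentiable (at x)) \<and>
     (\<forall>v. continuous_on UNIV (\<lambda>x. frechet_derivative f (at x) v))"

lemma frechet_derivative_eqI: "(f has_derivative f') (at x) \<Longrightarrow> frechet_derivative f (at x) v = f' v"
  by (simp add: frechet_derivative_at[symmetric])

lemma C1I:
  assumes "\<And>x. (f has_derivative f' x) (at x)" "\<And>v. continuous_on UNIV (\<lambda>x. f' x v)"
  shows "C1 f"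
proof -
  have "frechet_derivative f (at x) = f' x" for x
    using frechet_derivative_at[OF assms(1)] by simp
  then show ?thesis using assms by (auto simp: C1_def differentiable_def)
qed

lemma C1_has_derivative: "C1 f \<Longrightarrow> (f has_derivative frechet_derivative f (at x)) (at x)"
  by (simp add: C1_def frechet_derivative_works)

lemma C1_continuous_derivative: "C1 f \<Longrightarrow> continuous_on UNIV (\<lambda>x. frechet_derivative f (at x) v)"
  by (simp add: C1_def)

lemma C1_continuous: "C1 f \<Longrightarrow> continuous_on A f"
  by (meson C1_has_derivative has_derivative_at_withinI has_derivative_continuous_on)

lemma C1_const: "C1 (\<lambda>x. c)"
  by (rule C1I[OF has_derivative_const]) simp

lemma C1_add: "C1 f \<Longrightarrow> C1 g \<Longrightarrow> C1 (\<lambda>x. f x + g x)"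
  by (rule C1I[OF has_derivative_add[OF C1_has_derivative C1_has_derivative]])
    (auto intro: continuous_on_add C1_continuous_derivative)

lemma C1_diff: "C1 f \<Longrightarrow> C1 g \<Longrightarrow> C1 (\<lambda>x. f x - g x)"
  by (rule C1I[OF has_derivative_diff[OF C1_has_derivative C1_has_derivative]])
    (auto intro: continuous_on_diff C1_continuous_derivative)

lemma C1_scaleR: "C1 f \<Longrightarrow> C1 g \<Longrightarrow> C1 (\<lambda>x. f x *\<^sub>R g x)"
  by (rule C1I[OF has_derivative_scaleR[OF C1_has_derivative C1_has_derivative]])
    (assumption | intro continuous_on_add continuous_on_scaleR C1_continuous_derivative
      C1_continuous[where f = f] C1_continuous[where f = g])+

lemma C1_mult: "C1 f \<Longrightarrow> C1 g \<Longrightarrow> C1 (\<lambda>x. f x * g x :: real)"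
  using C1_scaleR[of f g] by simp

lemma C1_uminus: "C1 f \<Longrightarrow> C1 (\<lambda>x. - f x)"
  using C1_diff[OF C1_const, of f 0] by simp

lemma C1_compose_real:
  assumes f: "C1 f" and h: "\<And>x. (h has_real_derivative h' (f x)) (at (f x))"
    and c: "continuous_on S h'" and S: "\<And>x. f x \<in> S"
  shows "C1 (\<lambda>x. h (f x))"
proof (rule C1I)
  fix x
  show "((\<lambda>x. h (f x)) has_derivative (\<lambda>v. h' (f x) * frechet_derivative f (at x) v)) (at x)"
    using has_derivative_compose[OF C1_has_derivative[OF f] h[unfolded has_field_derivative_def]] .
next
  fix v
  show "continuous_on UNIV (\<lambda>x. h' (f x) * frechet_derivative f (at x) v)"
    by (intro continuous_intros C1_continuous_derivative f continuous_on_compose2[OF c C1_continuous[OF f]])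
      (use S in auto)
qed

lemma pd_compose_real:
  assumes f: "C1 f" and h: "(h has_real_derivative h') (at (f x))"
  shows "pd i (\<lambda>x. h (f x)) x = h' * pd i f x"
  using has_derivative_pd[OF has_derivative_compose[OF C1_has_derivative[OF f] h[unfolded has_field_derivative_def]]]
  by (simp add: pd_def)

lemma C1_bounded_linear:
  assumes "bounded_linear L" "C1 f"
  shows "C1 (\<lambda>x. L (f x))"
  by (rule C1I[OF bounded_linear.has_derivative[OF assms(1) C1_has_derivative[OF assms(2)]]])
    (intro bounded_linear.continuous_on[OF assms(1)] C1_continuous_derivative assms(2))

lemma C1_nth: "C1 g \<Longrightarrow> C1 (\<lambda>x. g x $ i)"
  by (rule C1_bounded_linear[OF bounded_linear_vec_nth])

lemma C1_coord: "C1 (\<lambda>x. x $ i)"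
  by (rule C1I[OF bounded_linear_imp_has_derivative[OF bounded_linear_vec_nth]]) simp

lemma C1_sum: "finite I \<Longrightarrow> (\<And>i. i \<in> I \<Longrightarrow> C1 (f i)) \<Longrightarrow> C1 (\<lambda>x. \<Sum>i\<in>I. f i x)"
  by (induction I rule: finite_induct) (auto intro: C1_add C1_const)

lemma C1_vec: "(\<And>i. C1 (\<lambda>x. g x $ i)) \<Longrightarrow> C1 (g :: real^'n \<Rightarrow> real^'m)"
proof -
  assume *: "\<And>i. C1 (\<lambda>x. g x $ i)"
  have "g = (\<lambda>x. \<Sum>i\<in>UNIV. (g x $ i) *\<^sub>R axis i 1)"
    by (rule ext) (simp flip: scalar_mult_eq_scaleR add: basis_expansion)
  moreover have "C1 (\<lambda>x. \<Sum>i\<in>UNIV. (g x $ i) *\<^sub>R axis i (1::real))"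
    by (intro C1_sum C1_scaleR * C1_const) simp
  ultimately show ?thesis by simp
qed

lemma C1_hpoly: "hpoly k f \<Longrightarrow> C1 f"
  by (rule C1I[OF hpoly_has_derivative])
    (assumption | intro continuous_intros hpoly_continuous[of k] hpoly_pd)+

lemma C1_affine:
  assumes g: "C1 g"
  shows "C1 (\<lambda>x. g (r *\<^sub>R (x - a)))"
    and "frechet_derivative (\<lambda>x. g (r *\<^sub>R (x - a))) (at x) v = r *\<^sub>R frechet_derivative g (at (r *\<^sub>R (x - a))) v"
proof -
  have d: "((\<lambda>x. g (r *\<^sub>R (x - a))) has_derivative (\<lambda>v. r *\<^sub>R frechet_derivative g (at (r *\<^sub>R (x - a))) v)) (at x)" for x
  proof -
    have "((\<lambda>x. r *\<^sub>R (x - a)) has_derivative (\<lambda>v. r *\<^sub>R v)) (at x)"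
      by (auto intro!: derivative_eq_intros)
    from has_derivative_compose[OF this C1_has_derivative[OF g]]
    show ?thesis
      using linear_scale[OF has_derivative_linear[OF C1_has_derivative[OF g]]] by simp
  qed
  show "frechet_derivative (\<lambda>x. g (r *\<^sub>R (x - a))) (at x) v = r *\<^sub>R frechet_derivative g (at (r *\<^sub>R (x - a))) v"
    by (rule frechet_derivative_eqI[OF d])
  show "C1 (\<lambda>x. g (r *\<^sub>R (x - a)))"
    by (rule C1I[OF d])
      (intro continuous_intros continuous_on_compose2[OF C1_continuous_derivative[OF g]]; auto)
qed

section \<open>Cutoff functions of class C1\<close>

definition ramp :: "real \<Rightarrow> real" where
  "ramp s = (max 0 s)\<^sup>2"

lemma ramp_deriv: "(ramp has_real_derivative 2 * max 0 s) (at s)"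
proof (cases "s = 0")
  case True
  have "((\<lambda>h. (ramp (0 + h) - ramp 0) / h) \<longlongrightarrow> 0) (at 0)"
  proof (rule tendsto_rabs_zero_cancel, rule tendsto_sandwich[of "\<lambda>_. 0"])
    show "\<forall>\<^sub>F h in at 0. \<bar>(ramp (0 + h) - ramp 0) / h\<bar> \<le> \<bar>h\<bar>"
      by (rule always_eventually) (auto simp: ramp_def max_def power2_eq_square)
    show "((\<lambda>h. \<bar>h\<bar>) \<longlongrightarrow> 0) (at (0::real))" by (auto intro!: tendsto_eq_intros)
  qed auto
  then show ?thesis using True by (simp add: DERIV_def)
next
  case False
  show ?thesis
  proof (cases "s > 0")
    case True
    have "((\<lambda>s. s\<^sup>2) has_real_derivative 2 * max 0 s) (at s)"
      using True by (auto intro!: derivative_eq_intros)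
    then show ?thesis
      by (rule DERIV_cong_ev[THEN iffD1, rotated 3])
        (use True in \<open>auto simp: ramp_def intro!: eventually_mono[OF eventually_nhds_in_open[of "{0<..}" s]]\<close>)
  next
    case neg: False
    have "((\<lambda>s. 0) has_real_derivative 2 * max 0 s) (at s)"
      using neg by (auto intro!: derivative_eq_intros)
    then show ?thesis
      by (rule DERIV_cong_ev[THEN iffD1, rotated 3])
        (use neg False in \<open>auto simp: ramp_def max_def intro!: eventually_mono[OF eventually_nhds_in_open[of "{..<0}" s]]\<close>)
  qed
qed

text \<open>A decreasing C1 transition from 1 on s \<le> 0 to 0 on s \<ge> 1: the inner ramp makes
  it flat at 0, the outer one makes it flat at 1.\<close>

definition cutoff :: "real \<Rightarrow> real" where
  "cutoff s = ramp (1 - ramp s)"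

definition cutoff' :: "real \<Rightarrow> real" where
  "cutoff' s = - (4 * max 0 (1 - ramp s) * max 0 s)"

lemma cutoff_deriv: "(cutoff has_real_derivative cutoff' s) (at s)"
  unfolding cutoff_def[abs_def] cutoff'_def
  by (rule DERIV_cong[OF DERIV_chain2[OF ramp_deriv DERIV_diff[OF DERIV_const ramp_deriv]]]) simp

lemma continuous_cutoff': "continuous_on UNIV cutoff'"
  unfolding cutoff'_def[abs_def] ramp_def by (intro continuous_intros)

lemma cutoff_simps: "s \<le> 0 \<Longrightarrow> cutoff s = 1" "s \<ge> 1 \<Longrightarrow> cutoff s = 0" "s \<le> 0 \<Longrightarrow> cutoff' s = 0"
  "cutoff' s \<le> 0" "0 \<le> cutoff s" "cutoff s \<le> 1"
proof -
  show "s \<ge> 1 \<Longrightarrow> cutoff s = 0"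
    using power_mono[of 1 s 2] by (simp add: cutoff_def ramp_def)
  show "cutoff s \<le> 1"
    using power_le_one[of "max 0 (1 - ramp s)" 2] by (auto simp: cutoff_def ramp_def)
qed (simp_all add: cutoff_def cutoff'_def ramp_def)

lemma C1_cutoff: "C1 f \<Longrightarrow> C1 (\<lambda>x. cutoff (f x))"
  by (rule C1_compose_real[OF _ cutoff_deriv continuous_cutoff' UNIV_I])

lemma pd_cutoff: "C1 f \<Longrightarrow> pd i (\<lambda>x. cutoff (f x)) x = cutoff' (f x) * pd i f x"
  by (rule pd_compose_real[OF _ cutoff_deriv])

text \<open>The squared distance keeps the function differentiable at the centre
  \<open>y\<close>.\<close>

definition bump :: "real^'n \<Rightarrow> real \<Rightarrow> real \<Rightarrow> real^'n \<Rightarrow> real" where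
  "bump y a b x = cutoff (((norm (x - y))\<^sup>2 - a\<^sup>2) / (b\<^sup>2 - a\<^sup>2))"

lemma C1_bump: "C1 (bump y a b)"
proof -
  have "((norm (x - y))\<^sup>2 - a\<^sup>2) / (b\<^sup>2 - a\<^sup>2)
     = ((\<Sum>i\<in>UNIV. (x $ i - y $ i) * (x $ i - y $ i)) - a\<^sup>2) * (1 / (b\<^sup>2 - a\<^sup>2))" for x
    by (simp add: norm_vec_def L2_set_def sum_nonneg power2_eq_square)
  then show ?thesis
    unfolding bump_def[abs_def]
    by (simp only:) (intro C1_cutoff C1_mult C1_diff C1_sum C1_const C1_coord; simp)
qed

lemma bump_range: "0 \<le> bump y a b x" "bump y a b x \<le> 1"
  by (simp_all add: bump_def cutoff_simps)

lemma bump_inside: "0 \<le> a \<Longrightarrow> a < b \<Longrightarrow> norm (x - y) \<le> a \<Longrightarrow> bump y a b x = 1"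
  unfolding bump_def
  by (intro cutoff_simps(1) divide_nonpos_pos) (simp_all add: power_strict_mono power_mono)

lemma bump_outside: "0 \<le> a \<Longrightarrow> a < b \<Longrightarrow> norm (x - y) \<ge> b \<Longrightarrow> bump y a b x = 0"
  unfolding bump_def
  by (intro cutoff_simps(2)) (simp add: power_strict_mono power_mono)

section \<open>Divergence of compactly supported fields\<close>

lemma C1_compact_support_field_iff:
  "C1_compact_support_field U g \<longleftrightarrow> C1 g \<and> (\<exists>K. compact K \<and> K \<subseteq> U \<and> (\<forall>x. x \<notin> K \<longrightarrow> g x = 0))"
proof
  assume g: "C1_compact_support_field U g"
  then have "x \<notin> closure {x. g x \<noteq> 0} \<Longrightarrow> g x = 0" for x
    using closure_subset[of "{x. g x \<noteq> 0}"] by auto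
  with g show "C1 g \<and> (\<exists>K. compact K \<and> K \<subseteq> U \<and> (\<forall>x. x \<notin> K \<longrightarrow> g x = 0))"
    unfolding C1_compact_support_field_def C1_def by blast
next
  assume *: "C1 g \<and> (\<exists>K. compact K \<and> K \<subseteq> U \<and> (\<forall>x. x \<notin> K \<longrightarrow> g x = 0))"
  then obtain K where K: "compact K" "K \<subseteq> U" "\<forall>x. x \<notin> K \<longrightarrow> g x = 0" by blast
  then have "closure {x. g x \<noteq> 0} \<subseteq> K"
    by (intro closure_minimal) (auto intro: compact_imp_closed)
  moreover have "compact (closure {x. g x \<noteq> 0})"
    using calculation compact_Int_closed[OF K(1) closed_closure, of "{x. g x \<noteq> 0}"]
    by (simp add: inf.absorb2)
  ultimately show "C1_compact_support_field U g"
    using K(2) * unfolding C1_compact_support_field_def C1_def by auto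
qed

lemma divergence_eq_pd:
  assumes "C1 g"
  shows "divergence g x = (\<Sum>i\<in>UNIV. pd i (\<lambda>x. g x $ i) x)"
proof -
  have "pd i (\<lambda>x. g x $ i) x = frechet_derivative g (at x) (axis i 1) $ i" for i
    by (rule has_derivative_pd[OF bounded_linear.has_derivative[OF bounded_linear_vec_nth C1_has_derivative[OF assms]]])
  then show ?thesis by (simp add: divergence_def)
qed

lemma frechet_derivative_C1_add: "C1 f \<Longrightarrow> C1 g \<Longrightarrow>
    frechet_derivative (\<lambda>x. f x + g x) (at x) v = frechet_derivative f (at x) v + frechet_derivative g (at x) v"
  by (rule frechet_derivative_eqI[OF has_derivative_add[OF C1_has_derivative C1_has_derivative]])

lemma frechet_derivative_C1_scaleR: "C1 f \<Longrightarrow> C1 g \<Longrightarrow>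
    frechet_derivative (\<lambda>x. f x *\<^sub>R g x) (at x) v = f x *\<^sub>R frechet_derivative g (at x) v + frechet_derivative f (at x) v *\<^sub>R g x"
  by (rule frechet_derivative_eqI[OF has_derivative_scaleR[OF C1_has_derivative C1_has_derivative]])

lemma divergence_add: "C1 f \<Longrightarrow> C1 g \<Longrightarrow> divergence (\<lambda>x. f x + g x) x = divergence f x + divergence g x"
  by (simp add: divergence_def frechet_derivative_C1_add sum.distrib)

lemma divergence_scaleR: "C1 a \<Longrightarrow> C1 g \<Longrightarrow>
    divergence (\<lambda>x. a x *\<^sub>R g x) x = (\<Sum>i\<in>UNIV. pd i a x * g x $ i) + a x * divergence g x"
  by (simp add: divergence_def frechet_derivative_C1_scaleR sum.distrib sum_distrib_left pd_def)

lemma divergence_minus: "C1 g \<Longrightarrow> divergence (\<lambda>x. - g x) x = - divergence g x"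
  using divergence_scaleR[OF C1_const, of g "-1" x] by simp

lemma divergence_diff: "C1 f \<Longrightarrow> C1 g \<Longrightarrow> divergence (\<lambda>x. f x - g x) x = divergence f x - divergence g x"
  using divergence_add[OF _ C1_uminus, of f g x] by (simp add: divergence_minus)

lemma divergence_affine: "C1 g \<Longrightarrow> divergence (\<lambda>x. g (r *\<^sub>R (x - a))) x = r * divergence g (r *\<^sub>R (x - a))"
  by (simp add: divergence_def C1_affine(2) sum_distrib_left)

lemma continuous_divergence: "C1 g \<Longrightarrow> continuous_on A (divergence g)"
  unfolding divergence_def[abs_def]
  by (rule continuous_on_subset[OF _ subset_UNIV]) (intro continuous_intros C1_continuous_derivative)

lemma frechet_derivative_outside:
  assumes "closed K" "\<And>x. x \<notin> K \<Longrightarrow> g x = 0" "x \<notin> K"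
  shows "frechet_derivative g (at x) = (\<lambda>v. 0)"
proof -
  have "(g has_derivative (\<lambda>v. 0)) (at x)"
    by (rule has_derivative_transform_within_open[of "\<lambda>x. 0" _ _ _ "- K"]) (use assms in auto)
  then show ?thesis by (simp add: frechet_derivative_at[symmetric])
qed

lemma divergence_outside:
  assumes "closed K" "\<And>x. x \<notin> K \<Longrightarrow> g x = 0" "x \<notin> K"
  shows "divergence g x = 0"
  using frechet_derivative_outside[OF assms] by (simp add: divergence_def)

lemma integrable_lborel_compact_support:
  fixes f :: "'a::euclidean_space \<Rightarrow> real"
  assumes f: "continuous_on UNIV f" and K: "compact K" "\<And>x. x \<notin> K \<Longrightarrow> f x = 0"
  shows "integrable lborel f"
proof -
  have "integrable lborel (\<lambda>x. indicator K x *\<^sub>R f x)"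
    by (rule borel_integrable_compact[OF K(1) continuous_on_subset[OF f subset_UNIV]])
  moreover have "(\<lambda>x. indicator K x *\<^sub>R f x) = f"
  proof
    show "indicator K x *\<^sub>R f x = f x" for x using K(2) by (cases "x \<in> K") auto
  qed
  ultimately show ?thesis by simp
qed

lemma integrable_lebesgue_compact_support:
  fixes f :: "'a::euclidean_space \<Rightarrow> real"
  assumes f: "continuous_on UNIV f" and K: "compact K" "\<And>x. x \<notin> K \<Longrightarrow> f x = 0"
  shows "integrable lebesgue f"
  using integrable_lborel_compact_support[OF assms] borel_measurable_continuous_onI[OF f]
  by (simp add: integrable_completion)

lemma integrable_divergence:
  assumes "C1 g" "compact K" "\<And>x. x \<notin> K \<Longrightarrow> g x = 0"
  shows "integrable lebesgue (divergence g)"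
  by (rule integrable_lebesgue_compact_support[OF continuous_divergence[OF assms(1)] assms(2)])
    (use divergence_outside compact_imp_closed assms in blast)

text \<open>By translation invariance every difference quotient of \<open>f\<close> has integral
  zero, and dominated convergence passes this on to the derivative.\<close>

lemma integral_pd_zero:
  fixes f :: "real^'n \<Rightarrow> real"
  assumes f: "C1 f" and K: "compact K" "\<And>x. x \<notin> K \<Longrightarrow> f x = 0"
  shows "integral\<^sup>L lborel (pd i f) = 0"
proof -
  obtain r where r: "K \<subseteq> cball 0 r"
    using compact_imp_bounded[OF K(1)] unfolding bounded_iff by (auto simp: subset_iff)
  let ?e = "axis i (1::real) :: real^'n"
  have cpd: "continuous_on UNIV (pd i f)"
    unfolding pd_def by (rule C1_continuous_derivative[OF f])
  have pd0: "pd i f x = 0" if "x \<notin> K" for x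
    using frechet_derivative_outside[OF compact_imp_closed[OF K(1)] K(2) that] by (simp add: pd_def)
  obtain B where B: "\<And>x. \<bar>pd i f x\<bar> \<le> B"
  proof -
    have "bounded (pd i f ` K)"
      by (intro compact_imp_bounded compact_continuous_image K continuous_on_subset[OF cpd]) auto
    then obtain B where "\<And>x. x \<in> K \<Longrightarrow> \<bar>pd i f x\<bar> \<le> B" by (auto simp: bounded_iff)
    then have "\<bar>pd i f x\<bar> \<le> max B 0" for x using pd0[of x] by (cases "x \<in> K") (auto simp: le_max_iff_disj)
    then show thesis using that by blast
  qed
  have fi: "integrable lborel f"
    by (rule integrable_lborel_compact_support[OF C1_continuous[OF f] K])
  define h where "h = (\<lambda>m::nat. 1 / real (Suc m))"
  have h0: "h m > 0" "h m \<le> 1" for m by (auto simp: h_def)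
  have hlim: "h \<longlonglongrightarrow> 0" unfolding h_def by (rule LIMSEQ_Suc[OF lim_1_over_n])
  define s where "s = (\<lambda>m x. (f (h m *\<^sub>R ?e + x) - f x) / h m)"
  have dline: "((\<lambda>t. f (t *\<^sub>R ?e + x)) has_real_derivative pd i f (t *\<^sub>R ?e + x)) (at t)" for x t
  proof -
    have "((\<lambda>t. t *\<^sub>R ?e + x) has_derivative (\<lambda>u. u *\<^sub>R ?e)) (at t)"
      by (auto intro!: derivative_eq_intros)
    from has_derivative_compose[OF this C1_has_derivative[OF f]]
    show ?thesis
      unfolding has_field_derivative_def pd_def
      by (rule has_derivative_eq_rhs)
        (auto simp: linear_scale[OF has_derivative_linear[OF C1_has_derivative[OF f]]])
  qed
  have trans: "integrable lborel (\<lambda>x. f (c + x))" "(\<integral>x. f (c + x) \<partial>lborel) = (\<integral>x. f x \<partial>lborel)" for c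
  proof -
    have m: "f \<in> borel_measurable borel" by (rule borel_measurable_continuous_onI[OF C1_continuous[OF f]])
    show "integrable lborel (\<lambda>x. f (c + x))"
      using fi integrable_distr_eq[of "(+) c" lborel borel f] m by (simp add: lborel_distr_plus)
    show "(\<integral>x. f (c + x) \<partial>lborel) = (\<integral>x. f x \<partial>lborel)"
      using integral_distr[of "(+) c" lborel borel f] m by (simp add: lborel_distr_plus)
  qed
  have "(\<integral>x. s m x \<partial>lborel) = 0" for m
    using trans fi by (simp add: s_def)
  moreover have "(\<lambda>m. \<integral>x. s m x \<partial>lborel) \<longlonglongrightarrow> (\<integral>x. pd i f x \<partial>lborel)"
  proof (rule integral_dominated_convergence)
    \<comment> \<open>The steps \<open>h m\<close> are at most 1, so all difference quotients vanish
      outside the ball of radius \<open>r + 1\<close>; the mean value theorem bounds them by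
      \<open>B\<close>.\<close>
    show "integrable lborel (\<lambda>x::real^'n. indicator (cball 0 (r + 1)) x * B :: real)"
      using emeasure_bounded_finite[OF bounded_cball, of "0::real^'n" "r + 1"]
      by (intro integrable_mult_left integrable_real_indicator) auto
    show "pd i f \<in> borel_measurable lborel"
      using borel_measurable_continuous_onI[OF cpd] by simp
    show "s m \<in> borel_measurable lborel" for m
      unfolding s_def using trans(1) fi by (intro borel_measurable_integrable) auto
    show "AE x in lborel. (\<lambda>m. s m x) \<longlonglongrightarrow> pd i f x"
    proof (rule AE_I2)
      fix x
      have "((\<lambda>t. (f ((0 + t) *\<^sub>R ?e + x) - f (0 *\<^sub>R ?e + x)) / t) \<longlongrightarrow> pd i f (0 *\<^sub>R ?e + x)) (at 0)"
        using dline[of x 0] unfolding DERIV_def .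
      then have "((\<lambda>t. (f (t *\<^sub>R ?e + x) - f x) / t) \<longlongrightarrow> pd i f x) (at 0)" by simp
      then show "(\<lambda>m. s m x) \<longlonglongrightarrow> pd i f x"
        unfolding s_def
        by (rule filterlim_compose) (use hlim h0 in \<open>auto simp: filterlim_at intro!: always_eventually less_imp_neq[symmetric]\<close>)
    qed
    show "AE x in lborel. norm (s m x) \<le> indicator (cball 0 (r + 1)) x * B" for m
    proof (rule AE_I2)
      fix x
      obtain t where t: "0 < t" "t < h m" "f (h m *\<^sub>R ?e + x) - f (0 *\<^sub>R ?e + x) = (h m - 0) * pd i f (t *\<^sub>R ?e + x)"
        using MVT2[of 0 "h m" "\<lambda>t. f (t *\<^sub>R ?e + x)" "\<lambda>t. pd i f (t *\<^sub>R ?e + x)"] dline h0[of m] by auto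
      then have s: "s m x = pd i f (t *\<^sub>R ?e + x)" using h0[of m] by (simp add: s_def)
      show "norm (s m x) \<le> indicator (cball 0 (r + 1)) x * B"
      proof (cases "x \<in> cball 0 (r + 1)")
        case True
        then show ?thesis using s B by simp
      next
        case False
        have "norm x \<le> norm (t *\<^sub>R ?e + x) + norm (t *\<^sub>R ?e)"
          by (metis add_diff_cancel_left' norm_triangle_ineq4 add.commute)
        also have "norm (t *\<^sub>R ?e) \<le> 1" using t h0[of m] by simp
        finally have "t *\<^sub>R ?e + x \<notin> K" using False r by auto
        then show ?thesis using s pd0 False by simp
      qed
    qed
  qed
  ultimately show ?thesis by (simp add: LIMSEQ_const_iff)
qed

lemma integral_divergence_zero:
  assumes g: "C1 g" and K: "compact K" "\<And>x. x \<notin> K \<Longrightarrow> g x = 0"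
  shows "integral\<^sup>L lebesgue (divergence g) = 0"
proof -
  have "integral\<^sup>L lebesgue (divergence g) = integral\<^sup>L lborel (divergence g)"
    using borel_measurable_continuous_onI[OF continuous_divergence[OF g]]
    by (simp add: integral_completion)
  also have "\<dots> = (\<integral>x. (\<Sum>i\<in>UNIV. pd i (\<lambda>x. g x $ i) x) \<partial>lborel)"
    using divergence_eq_pd[OF g] by (metis (no_types))
  also have "\<dots> = (\<Sum>i\<in>UNIV. integral\<^sup>L lborel (pd i (\<lambda>x. g x $ i)))"
  proof (rule Bochner_Integration.integral_sum)
    fix i
    have "pd i (\<lambda>x. g x $ i) x = 0" if "x \<notin> K" for x
      using frechet_derivative_outside[OF compact_imp_closed[OF K(1)], of "\<lambda>x. g x $ i"] K(2) that by (simp add: pd_def)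
    moreover have "continuous_on UNIV (pd i (\<lambda>x. g x $ i))"
      unfolding pd_def by (rule C1_continuous_derivative[OF C1_nth[OF g]])
    ultimately show "integrable lborel (pd i (\<lambda>x. g x $ i))"
      using K(1) by (intro integrable_lborel_compact_support)
  qed
  also have "\<dots> = 0"
    using integral_pd_zero[OF C1_nth[OF g] K(1)] K(2) by simp
  finally show ?thesis .
qed

section \<open>Localization and rescaling of minimal sets\<close>

text \<open>For a set with smooth boundary this is the outward flux of \<open>g\<close> through the
  boundary.\<close>

definition flux :: "(real^'n) set \<Rightarrow> (real^'n \<Rightarrow> real^'n) \<Rightarrow> real" where
  "flux E g = (LINT x:E|lebesgue. divergence g x)"

definition test :: "(real^'n) set \<Rightarrow> (real^'n \<Rightarrow> real^'n) \<Rightarrow> bool" where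
  "test U g \<longleftrightarrow> C1 g \<and> (\<exists>K. compact K \<and> K \<subseteq> U \<and> (\<forall>x. x \<notin> K \<longrightarrow> g x = 0))"

definition admissible :: "(real^'n) set \<Rightarrow> (real^'n \<Rightarrow> real^'n) \<Rightarrow> bool" where
  "admissible U g \<longleftrightarrow> test U g \<and> (\<forall>x. norm (g x) \<le> 1)"

text \<open>The total variation in \<open>U\<close> of the indicator function of \<open>E\<close>; a
  variable \<open>U\<close> allows perimeters to be compared on small balls.\<close>

definition tv :: "(real^'n) set \<Rightarrow> (real^'n) set \<Rightarrow> ereal" where
  "tv E U = (SUP g \<in> {g. admissible U g}. ereal (flux E g))"

text \<open>The set where the bound fails is open and null, hence empty. This turns the essential
  bound in \<open>perimeter\<close> into a pointwise one.\<close>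

lemma AE_continuous_bound:
  fixes g :: "real^'n \<Rightarrow> real"
  assumes g: "continuous_on UNIV g" and ae: "AE x in lebesgue. g x \<le> c"
  shows "g x \<le> c"
proof (rule ccontr)
  let ?S = "{x. c < g x}"
  assume "\<not> g x \<le> c"
  then have "x \<in> ?S" by simp
  then have "?S \<noteq> {}" by blast
  moreover have "open ?S" by (intro open_Collect_less g continuous_intros)
  moreover have "negligible ?S"
  proof -
    have "{x \<in> space lebesgue. \<not> g x \<le> c} \<in> null_sets lebesgue"
      using ae \<open>open ?S\<close> by (subst (asm) AE_iff_null) (auto simp: not_le)
    then show ?thesis by (simp add: negligible_iff_null_sets not_le)
  qed
  ultimately show False using open_not_negligible by blast
qed

lemma perimeter_eq_tv: "perimeter E = tv E (ball 0 1)"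
proof -
  have "{g. C1_compact_support_field (ball 0 1) g \<and> (AE x in lebesgue. norm (g x) \<le> 1)}
      = {g :: real^'a \<Rightarrow> real^'a. admissible (ball 0 1) g}"
  proof (rule Collect_cong, rule iffI)
    fix g :: "real^'a \<Rightarrow> real^'a"
    assume g: "C1_compact_support_field (ball 0 1) g \<and> (AE x in lebesgue. norm (g x) \<le> 1)"
    then have "C1 g" by (simp add: C1_compact_support_field_iff)
    then have "norm (g x) \<le> 1" for x
      using AE_continuous_bound[of "\<lambda>x. norm (g x)" 1 x] g continuous_on_norm[OF C1_continuous] by blast
    with g show "admissible (ball 0 1) g" by (simp add: admissible_def test_def C1_compact_support_field_iff)
  qed (simp add: admissible_def test_def C1_compact_support_field_iff)
  then show ?thesis by (simp add: perimeter_def tv_def flux_def)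
qed

lemma test_C1: "test U g \<Longrightarrow> C1 g"
  by (simp add: test_def)

lemma test_mono: "test U g \<Longrightarrow> U \<subseteq> V \<Longrightarrow> test V g"
  unfolding test_def by blast

lemma admissible_mono: "admissible U g \<Longrightarrow> U \<subseteq> V \<Longrightarrow> admissible V g"
  unfolding admissible_def using test_mono by blast

lemma test_add: "test U f \<Longrightarrow> test U g \<Longrightarrow> test U (\<lambda>x. f x + g x)"
proof -
  assume "test U f" "test U g"
  then obtain K L where "C1 f" "C1 g" "compact K" "compact L" "K \<subseteq> U" "L \<subseteq> U"
    "\<forall>x. x \<notin> K \<longrightarrow> f x = 0" "\<forall>x. x \<notin> L \<longrightarrow> g x = 0" unfolding test_def by auto
  then show ?thesis unfolding test_def
    by (intro conjI C1_add exI[of _ "K \<union> L"]) auto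
qed

lemma test_scaleR: "C1 a \<Longrightarrow> test U g \<Longrightarrow> test U (\<lambda>x. a x *\<^sub>R g x)"
  unfolding test_def by (auto intro: C1_scaleR)

lemma test_uminus: "test U g \<Longrightarrow> test U (\<lambda>x. - g x)"
  unfolding test_def by (auto intro: C1_uminus)

lemma integrable_flux:
  assumes "E \<in> sets lebesgue" "test U g"
  shows "set_integrable lebesgue E (divergence g)"
proof -
  have "integrable lebesgue (divergence g)"
    using assms(2) unfolding test_def by (auto intro: integrable_divergence)
  with assms(1) show ?thesis
    unfolding set_integrable_def by (rule integrable_mult_indicator)
qed

lemma flux_add: "E \<in> sets lebesgue \<Longrightarrow> test U f \<Longrightarrow> test V g \<Longrightarrow> flux E (\<lambda>x. f x + g x) = flux E f + flux E g"
proof -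
  assume *: "E \<in> sets lebesgue" "test U f" "test V g"
  have "divergence (\<lambda>x. f x + g x) = (\<lambda>x. divergence f x + divergence g x)"
    using divergence_add[OF test_C1[OF *(2)] test_C1[OF *(3)]] by blast
  then show ?thesis
    unfolding flux_def using set_integral_add(2)[OF integrable_flux[OF *(1,2)] integrable_flux[OF *(1,3)]] by simp
qed

lemma flux_uminus: "test U g \<Longrightarrow> flux E (\<lambda>x. - g x) = - flux E g"
  by (simp add: flux_def set_lebesgue_integral_def divergence_minus[OF test_C1])

lemma flux_UNIV: "test U g \<Longrightarrow> flux UNIV g = 0"
  unfolding test_def flux_def using integral_divergence_zero by (auto simp: set_lebesgue_integral_def)

lemma flux_zero [simp]: "flux E (\<lambda>x. 0) = 0"
  by (simp add: flux_def divergence_def frechet_derivative_at[OF has_derivative_const, symmetric])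

lemma flux_cong:
  assumes "\<And>x. divergence g x \<noteq> 0 \<Longrightarrow> x \<in> E \<longleftrightarrow> x \<in> F"
  shows "flux E g = flux F g"
  unfolding flux_def set_lebesgue_integral_def
  by (rule Bochner_Integration.integral_cong) (use assms in \<open>auto simp: indicator_def\<close>)

lemma flux_Un:
  assumes "E \<in> sets lebesgue" "F \<in> sets lebesgue" "E \<inter> F = {}" "test U g"
  shows "flux (E \<union> F) g = flux E g + flux F g"
  unfolding flux_def using assms by (intro set_integral_Un integrable_flux) auto

lemma flux_compl:
  assumes "E \<in> sets lebesgue" "test U g"
  shows "flux (- E) g = - flux E g"
proof -
  have "- E \<in> sets lebesgue"
    using sets.compl_sets[OF assms(1)] by (simp add: Compl_eq_Diff_UNIV)
  then have "flux (- E \<union> E) g = flux (- E) g + flux E g"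
    using assms by (intro flux_Un) auto
  then show ?thesis using flux_UNIV[OF assms(2)] by simp
qed

lemma admissible_zero: "admissible U (\<lambda>x. 0)"
  unfolding admissible_def test_def using C1_const by (auto intro!: exI[of _ "{}"])

lemma flux_le_tv: "admissible U g \<Longrightarrow> ereal (flux E g) \<le> tv E U"
  unfolding tv_def by (rule SUP_upper) simp

lemma tv_nonneg: "0 \<le> tv E U"
  using flux_le_tv[OF admissible_zero, of E U] by (simp add: zero_ereal_def)

lemma tv_least: "(\<And>g. admissible U g \<Longrightarrow> ereal (flux E g) \<le> c) \<Longrightarrow> tv E U \<le> c"
  unfolding tv_def by (rule SUP_least) simp

lemma minimal_set_tv:
  "minimal_set E \<longleftrightarrow> E \<in> sets lebesgue \<and> E \<subseteq> ball 0 1 \<and> tv E (ball 0 1) < \<infinity> \<and>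
     (\<forall>F. F \<in> sets lebesgue \<and> F \<subseteq> ball 0 1 \<and> closure ((E - F) \<union> (F - E)) \<subseteq> ball 0 1
        \<longrightarrow> tv E (ball 0 1) \<le> tv F (ball 0 1))"
  by (simp add: minimal_set_def perimeter_eq_tv)

lemma compact_in_ball:
  fixes x0 :: "'a::euclidean_space"
  assumes "compact K" "K \<subseteq> ball x0 r" "r > 0"
  obtains s where "0 < s" "s < r" "K \<subseteq> cball x0 s"
proof (cases "K = {}")
  case True
  then show thesis using that[of "r/2"] assms(3) by auto
next
  case False
  have "continuous_on K (dist x0)" by (intro continuous_intros)
  then obtain z where z: "z \<in> K" "\<And>y. y \<in> K \<Longrightarrow> dist x0 y \<le> dist x0 z"
    using continuous_attains_sup[OF assms(1) False, of "dist x0"] by blast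
  show thesis
  proof (rule that[of "(dist x0 z + r) / 2"])
    have "dist x0 z < r" using z(1) assms(2) by auto
    then show "0 < (dist x0 z + r) / 2" "(dist x0 z + r) / 2 < r" using assms(3) by (auto simp: add_nonneg_pos)
    show "K \<subseteq> cball x0 ((dist x0 z + r) / 2)" using z(2) \<open>dist x0 z < r\<close> by fastforce
  qed
qed

text \<open>Fields are glued. A field \<open>h\<close> on the unit ball splits into
  \<open>\<xi> x *\<^sub>R h x\<close>, whose flux out of \<open>F\<close> is at most the local
  variation \<open>T\<close> of \<open>F\<close>, and a rest that does not see the difference
  between \<open>E\<close> and \<open>F\<close>. The rest plus \<open>g\<close> is admissible for
  \<open>E\<close>, so the flux of \<open>h\<close> out of \<open>F\<close> is at most T + P - flux
  E g. Taking the supremum over \<open>h\<close> and using minimality, \<open>P\<close> cancels;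
  here the finiteness of the perimeter enters.\<close>

lemma minimal_local:
  assumes E: "minimal_set E" and r: "r > 0" "ball x0 r \<subseteq> ball 0 1"
    and F: "F \<in> sets lebesgue" "F \<subseteq> ball 0 1"
    and K: "compact K" "K \<subseteq> ball x0 r" "(E - F) \<union> (F - E) \<subseteq> K"
  shows "tv E (ball x0 r) \<le> tv F (ball x0 r)"
proof (cases "tv F (ball x0 r) = \<infinity>")
  case False
  let ?B = "ball 0 1 :: (real^'a) set"
  obtain T where T: "tv F (ball x0 r) = ereal T"
    using False tv_nonneg[of F "ball x0 r"] by (cases "tv F (ball x0 r)") auto
  have El: "E \<in> sets lebesgue" using E by (simp add: minimal_set_def)
  obtain P where P: "tv E ?B = ereal P"
    using E tv_nonneg[of E ?B] by (cases "tv E ?B") (auto simp: minimal_set_tv)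
  have "closure ((E - F) \<union> (F - E)) \<subseteq> ?B"
    using closure_minimal[OF K(3) compact_imp_closed[OF K(1)]] K(2) r(2) by blast
  then have EF: "tv E ?B \<le> tv F ?B" using E F by (simp add: minimal_set_tv)
  have "flux E g \<le> T" if g: "admissible (ball x0 r) g" for g
  proof -
    obtain L where L: "compact L" "L \<subseteq> ball x0 r" "\<And>x. x \<notin> L \<Longrightarrow> g x = 0" and gC: "C1 g"
      using g unfolding admissible_def test_def by auto
    obtain s where s: "0 < s" "s < r" "K \<union> L \<subseteq> cball x0 s"
      using compact_in_ball[of "K \<union> L" x0 r] K L r by auto
    \<comment> \<open>Two intermediate radii: \<open>\<xi>\<close> has to be 1 on a neighbourhood of
      \<open>K\<close> and of the support of \<open>g\<close>, and still have compact support in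
      \<open>ball x0 r\<close>.\<close>
    define s1 s2 where "s1 = s + (r - s) / 3" and "s2 = s + 2 * (r - s) / 3"
    have s12: "s < s1" "s1 < s2" "s2 < r" using s by (simp_all add: s1_def s2_def field_simps)
    define \<xi> where "\<xi> = bump x0 s1 s2"
    have \<xi>C: "C1 \<xi>" unfolding \<xi>_def by (rule C1_bump)
    have \<xi>r: "0 \<le> \<xi> x" "\<xi> x \<le> 1" for x unfolding \<xi>_def by (rule bump_range)+
    have \<xi>1: "\<xi> x = 1" if "x \<in> ball x0 s1" for x
      unfolding \<xi>_def by (rule bump_inside) (use s s12 that in \<open>auto simp: dist_norm norm_minus_commute\<close>)
    have \<xi>0: "\<xi> x = 0" if "x \<notin> cball x0 s2" for x
      unfolding \<xi>_def by (rule bump_outside) (use s s12 that in \<open>auto simp: dist_norm norm_minus_commute\<close>)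
    have "flux F h \<le> T + P - flux E g" if h: "admissible ?B h" for h
    proof -
      let ?h1 = "\<lambda>x. \<xi> x *\<^sub>R h x" and ?h2 = "\<lambda>x. (1 - \<xi> x) *\<^sub>R h x"
      have th: "test ?B h" using h by (simp add: admissible_def)
      have hn: "norm (h x) \<le> 1" for x using h by (simp add: admissible_def)
      have t1: "test ?B ?h1" by (rule test_scaleR[OF \<xi>C th])
      have t2: "test ?B ?h2" by (rule test_scaleR[OF C1_diff[OF C1_const \<xi>C] th])
      have a1: "admissible (ball x0 r) ?h1"
        unfolding admissible_def test_def
      proof (intro conjI exI[of _ "cball x0 s2"] allI impI)
        show "C1 ?h1" using t1 test_C1 by blast
        show "norm (?h1 x) \<le> 1" for x using \<xi>r[of x] hn[of x] by (simp add: mult_le_one)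
      qed (use s12 \<xi>0 in auto)
      have a2: "admissible ?B (\<lambda>x. g x + ?h2 x)"
        unfolding admissible_def
      proof (intro conjI allI)
        show "test ?B (\<lambda>x. g x + ?h2 x)"
          using g test_mono r(2) t2 by (intro test_add) (auto simp: admissible_def)
        fix x show "norm (g x + ?h2 x) \<le> 1"
        proof (cases "x \<in> L")
          case True
          then have "x \<in> ball x0 s1" using s(3) s12 by force
          then show ?thesis using \<xi>1[of x] g by (simp add: admissible_def)
        next
          case False
          then show ?thesis using L(3)[of x] \<xi>r[of x] hn[of x] by (simp add: mult_le_one)
        qed
      qed
      have "h = (\<lambda>x. ?h1 x + ?h2 x)" by (auto simp: algebra_simps)
      then have "flux F h = flux F ?h1 + flux F ?h2"
        using flux_add[OF F(1) t1 t2] by simp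
      also have "flux F ?h2 = flux E ?h2"
      proof (rule flux_cong)
        fix x assume "divergence ?h2 x \<noteq> 0"
        then have "x \<notin> ball x0 s1"
          using divergence_outside[of "- ball x0 s1" ?h2 x] \<xi>1 by auto
        then have "x \<notin> K" using s(3) s12 by force
        then show "x \<in> F \<longleftrightarrow> x \<in> E" using K(3) by auto
      qed
      also have "flux E ?h2 \<le> P - flux E g"
        using flux_le_tv[OF a2, of E] flux_add[OF El _ t2, of "ball x0 r" g] g P by (simp add: admissible_def)
      also have "flux F ?h1 \<le> T" using flux_le_tv[OF a1, of F] T by simp
      finally show ?thesis by simp
    qed
    then have "tv F ?B \<le> ereal (T + P - flux E g)" by (intro tv_least) simp
    then show ?thesis using EF P by (metis add_diff_eq diff_add_cancel ereal_less_eq(3) order.trans add.commute le_diff_eq add_le_cancel_left)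
  qed
  then show ?thesis unfolding T by (intro tv_least) simp
qed simp

section \<open>Dilations and complements of minimal sets\<close>

lemma affine_measurable:
  fixes x0 :: "'a::euclidean_space"
  assumes "r \<noteq> 0"
  shows "(\<lambda>y. x0 + r *\<^sub>R y) \<in> lebesgue \<rightarrow>\<^sub>M lebesgue"
    and "lebesgue = density (distr lebesgue lebesgue (\<lambda>y. x0 + r *\<^sub>R y)) (\<lambda>_. ennreal (\<bar>r\<bar> ^ DIM('a)))"
  using lebesgue_affine_measurable[of "\<lambda>_. r" x0] lebesgue_affine_euclidean[of "\<lambda>_. r" x0] assms
  unfolding scaleR_scaleR[symmetric] scaleR_sum_right[symmetric] euclidean_representation prod_constant by simp_all

lemma sets_affine_preimage:
  assumes "r \<noteq> 0" "E \<in> sets lebesgue"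
  shows "{y. x0 + r *\<^sub>R y \<in> E} \<in> sets lebesgue"
  using measurable_sets[OF affine_measurable(1)[OF assms(1)] assms(2)] by (simp add: vimage_def)

lemma flux_rescale:
  fixes x0 :: "real^'n"
  assumes r: "r > 0" and E: "E \<in> sets lebesgue" and g: "test U g"
  shows "flux E (\<lambda>x. g ((1 / r) *\<^sub>R (x - x0))) = r ^ CARD('n) / r * flux {y. x0 + r *\<^sub>R y \<in> E} g"
proof -
  let ?T = "\<lambda>y. x0 + r *\<^sub>R y"
  let ?f = "\<lambda>x. indicator E x *\<^sub>R divergence (\<lambda>x. g ((1 / r) *\<^sub>R (x - x0))) x"
  have C: "C1 g" using g test_C1 by blast
  have f: "?f \<in> borel_measurable lebesgue"
    using E borel_measurable_continuous_onI[OF continuous_divergence[OF C1_affine(1)[OF C]], of "1/r" x0]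
    by (intro borel_measurable_scaleR borel_measurable_indicator) (auto simp: measurable_completion)
  have "flux E (\<lambda>x. g ((1 / r) *\<^sub>R (x - x0))) = integral\<^sup>L lebesgue ?f"
    by (simp add: flux_def set_lebesgue_integral_def)
  also have "\<dots> = integral\<^sup>L (density (distr lebesgue lebesgue ?T) (\<lambda>_. ennreal (\<bar>r\<bar> ^ CARD('n)))) ?f"
    using affine_measurable(2)[of r x0] r by simp
  also have "\<dots> = integral\<^sup>L (distr lebesgue lebesgue ?T) (\<lambda>x. (\<bar>r\<bar> ^ CARD('n)) *\<^sub>R ?f x)"
    using f by (intro integral_density) auto
  also have "\<dots> = (\<integral>y. (\<bar>r\<bar> ^ CARD('n)) *\<^sub>R ?f (?T y) \<partial>lebesgue)"
    using f r affine_measurable(1)[of r x0] by (intro integral_distr) auto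
  also have "\<dots> = (\<integral>y. (r ^ CARD('n) / r) *\<^sub>R (indicator {y. ?T y \<in> E} y *\<^sub>R divergence g y) \<partial>lebesgue)"
    by (rule Bochner_Integration.integral_cong)
      (use r in \<open>auto simp: divergence_affine[OF C] indicator_def\<close>)
  also have "\<dots> = r ^ CARD('n) / r * flux {y. ?T y \<in> E} g"
    by (simp add: flux_def set_lebesgue_integral_def)
  finally show ?thesis .
qed

lemma test_rescale:
  assumes r: "r > 0" and g: "test (ball 0 1) g"
  shows "test (ball x0 r) (\<lambda>x. g ((1 / r) *\<^sub>R (x - x0)))"
proof -
  obtain K where K: "compact K" "K \<subseteq> ball 0 1" "\<And>x. x \<notin> K \<Longrightarrow> g x = 0" and C: "C1 g"
    using g unfolding test_def by auto
  let ?K = "(\<lambda>y. x0 + r *\<^sub>R y) ` K"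
  show ?thesis unfolding test_def
  proof (intro conjI exI[of _ ?K] allI impI)
    show "C1 (\<lambda>x. g ((1 / r) *\<^sub>R (x - x0)))" by (rule C1_affine(1)[OF C])
    show "compact ?K" by (intro compact_continuous_image K continuous_intros)
    show "?K \<subseteq> ball x0 r" using K(2) r by (auto simp: dist_norm)
    fix x assume "x \<notin> ?K"
    moreover have "x0 + r *\<^sub>R ((1 / r) *\<^sub>R (x - x0)) = x" using r by simp
    ultimately have "(1 / r) *\<^sub>R (x - x0) \<notin> K" by (metis image_eqI)
    then show "g ((1 / r) *\<^sub>R (x - x0)) = 0" by (rule K(3))
  qed
qed

lemma admissible_rescale:
  assumes "r > 0" "admissible (ball 0 1) g"
  shows "admissible (ball x0 r) (\<lambda>x. g ((1 / r) *\<^sub>R (x - x0)))"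
  using assms test_rescale[of r g x0] by (simp add: admissible_def)

lemma admissible_unscale:
  fixes x0 :: "real^'n"
  assumes r: "r > 0" and g: "admissible (ball x0 r) g"
  obtains h where "admissible (ball 0 1) h" "g = (\<lambda>x. h ((1 / r) *\<^sub>R (x - x0)))"
proof
  obtain K where K: "compact K" "K \<subseteq> ball x0 r" "\<And>x. x \<notin> K \<Longrightarrow> g x = 0" and C: "C1 g" and n: "\<And>x. norm (g x) \<le> 1"
    using g unfolding test_def admissible_def by auto
  let ?h = "\<lambda>y. g (r *\<^sub>R (y - (- (1 / r)) *\<^sub>R x0))"
  have T: "r *\<^sub>R (y - (- (1 / r)) *\<^sub>R x0) = x0 + r *\<^sub>R y" for y
    using r by (simp add: algebra_simps)
  let ?K = "(\<lambda>x. (1 / r) *\<^sub>R (x - x0)) ` K"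
  show "admissible (ball 0 1) ?h"
    unfolding test_def admissible_def
  proof (intro conjI exI[of _ ?K] allI impI n)
    show "C1 ?h" by (rule C1_affine(1)[OF C])
    show "compact ?K" by (intro compact_continuous_image K continuous_intros)
    show "?K \<subseteq> ball 0 1" using K(2) r by (auto simp: dist_norm norm_minus_commute)
    fix y assume y: "y \<notin> ?K"
    have "(1 / r) *\<^sub>R ((x0 + r *\<^sub>R y) - x0) = y" using r by simp
    with y have "x0 + r *\<^sub>R y \<notin> K" by (metis image_eqI)
    then show "?h y = 0" unfolding T by (rule K(3))
  qed
  show "g = (\<lambda>x. ?h ((1 / r) *\<^sub>R (x - x0)))"
    unfolding T using r by simp
qed

text \<open>A competitor of the blow-up is transported back and completed by \<open>E\<close>
  outside \<open>ball x0 r\<close>. The blow-up knows only the part of \<open>E\<close> in that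
  ball, so minimality is needed in the form \<open>minimal_local\<close>; all fluxes scale by the
  same power of \<open>r\<close>.\<close>

lemma minimal_rescale:
  fixes x0 :: "real^'n"
  assumes E: "minimal_set E" and r: "r > 0" "ball x0 r \<subseteq> ball 0 1"
  shows "minimal_set {y \<in> ball 0 1. x0 + r *\<^sub>R y \<in> E}"
proof -
  let ?B = "ball 0 1 :: (real^'n) set" and ?T = "\<lambda>y. x0 + r *\<^sub>R y"
  define E' where "E' = {y \<in> ?B. ?T y \<in> E}"
  define c where "c = r ^ CARD('n) / r"
  have c: "c > 0" using r by (simp add: c_def)
  have El: "E \<in> sets lebesgue" using E by (simp add: minimal_set_def)
  have E'l: "E' \<in> sets lebesgue"
  proof -
    have "E' = ?B \<inter> {y. ?T y \<in> E}" by (auto simp: E'_def)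
    then show ?thesis using sets_affine_preimage[of r E x0] El r by (simp add: sets.Int)
  qed
  have flux_eq: "flux F (\<lambda>x. g ((1 / r) *\<^sub>R (x - x0))) = c * flux F' g"
    if F: "F \<in> sets lebesgue" and F': "\<And>y. y \<in> ?B \<Longrightarrow> y \<in> F' \<longleftrightarrow> ?T y \<in> F" and g: "test ?B g" for F F' g
  proof -
    have "flux {y. ?T y \<in> F} g = flux F' g"
    proof (rule flux_cong)
      fix x assume "divergence g x \<noteq> 0"
      moreover obtain K where "compact K" "K \<subseteq> ?B" "\<And>x. x \<notin> K \<Longrightarrow> g x = 0"
        using g unfolding test_def by auto
      ultimately have "x \<in> ?B" using divergence_outside[of K g x] compact_imp_closed by blast
      then show "x \<in> {y. ?T y \<in> F} \<longleftrightarrow> x \<in> F'" using F' by auto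
    qed
    then show ?thesis using flux_rescale[OF r(1) F g, of x0] by (simp add: c_def)
  qed
  have E'_eq: "y \<in> ?B \<Longrightarrow> y \<in> E' \<longleftrightarrow> ?T y \<in> E" for y by (simp add: E'_def)
  obtain P where P: "tv E ?B = ereal P"
    using E tv_nonneg[of E ?B] by (cases "tv E ?B") (auto simp: minimal_set_tv)
  have "tv E' ?B \<le> ereal (P / c)"
  proof (rule tv_least)
    fix g assume g: "admissible ?B g"
    have "flux E (\<lambda>x. g ((1 / r) *\<^sub>R (x - x0))) \<le> P"
      using flux_le_tv[OF admissible_mono[OF admissible_rescale[OF r(1) g] r(2)], of E] P by simp
    then show "ereal (flux E' g) \<le> ereal (P / c)"
      using flux_eq[OF El E'_eq, of g] g c by (simp add: admissible_def field_simps)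
  qed
  then have fin: "tv E' ?B < \<infinity>" by (rule order.strict_trans1) simp
  have "tv E' ?B \<le> tv F' ?B"
    if F': "F' \<in> sets lebesgue" "F' \<subseteq> ?B" "closure ((E' - F') \<union> (F' - E')) \<subseteq> ?B" for F'
  proof (cases "tv F' ?B = \<infinity>")
    case False
    obtain Q where Q: "tv F' ?B = ereal Q"
      using False tv_nonneg[of F' ?B] by (cases "tv F' ?B") auto
    let ?K' = "closure ((E' - F') \<union> (F' - E'))"
    have cK': "compact ?K'"
      unfolding compact_eq_bounded_closed using bounded_subset[OF bounded_ball F'(3)] closed_closure by blast
    \<comment> \<open>The inverse dilation is written in affine form, so that
      \<open>sets_affine_preimage\<close> applies to it as well.\<close>
    define F where "F = {x. (- (1/r)) *\<^sub>R x0 + (1/r) *\<^sub>R x \<in> F'} \<union> (E - ball x0 r)"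
    have inv: "(- (1/r)) *\<^sub>R x0 + (1/r) *\<^sub>R ?T y = y" for y using r by (simp add: algebra_simps)
    have inv2: "?T ((- (1/r)) *\<^sub>R x0 + (1/r) *\<^sub>R x) = x" for x using r by (simp add: algebra_simps)
    have Tball: "?T y \<in> ball x0 r \<longleftrightarrow> y \<in> ?B" for y using r by (auto simp: dist_norm)
    have Fl: "F \<in> sets lebesgue"
      unfolding F_def using F' El r by (intro sets.Un sets.Diff sets_affine_preimage) auto
    have FB: "F \<subseteq> ?B"
    proof
      fix x assume "x \<in> F"
      then show "x \<in> ?B"
      proof (cases "x \<in> E")
        case True then show ?thesis using E by (auto simp: minimal_set_def)
      next
        case False
        then have "(- (1/r)) *\<^sub>R x0 + (1/r) *\<^sub>R x \<in> ?B" using \<open>x \<in> F\<close> F'(2) by (auto simp: F_def)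
        then show ?thesis using Tball inv2 r(2) by (metis subsetD)
      qed
    qed
    have F'_eq: "y \<in> ?B \<Longrightarrow> y \<in> F' \<longleftrightarrow> ?T y \<in> F" for y
      using Tball[of y] unfolding F_def Un_iff mem_Collect_eq inv by blast
    have diff: "(E - F) \<union> (F - E) \<subseteq> ?T ` ?K'"
    proof
      fix x assume x: "x \<in> (E - F) \<union> (F - E)"
      let ?y = "(- (1/r)) *\<^sub>R x0 + (1/r) *\<^sub>R x"
      have xb: "?y \<in> ?B"
      proof (rule ccontr)
        assume "?y \<notin> ?B"
        then have "x \<notin> ball x0 r" "?y \<notin> F'" using Tball[of ?y] inv2[of x] F'(2) by auto
        then show False using x by (auto simp: F_def)
      qed
      have "?y \<in> (E' - F') \<union> (F' - E')"
        using x E'_eq[OF xb] F'_eq[OF xb] unfolding inv2 by auto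
      then have "?y \<in> ?K'" using closure_subset[of "(E' - F') \<union> (F' - E')"] by blast
      then show "x \<in> ?T ` ?K'" using inv2[of x] by (metis image_eqI)
    qed
    have loc: "tv E (ball x0 r) \<le> tv F (ball x0 r)"
    proof (rule minimal_local[OF E r Fl FB _ _ diff])
      show "compact (?T ` ?K')" by (intro compact_continuous_image cK' continuous_intros)
      show "?T ` ?K' \<subseteq> ball x0 r" using F'(3) Tball by blast
    qed
    have "tv F (ball x0 r) \<le> ereal (c * Q)"
    proof (rule tv_least)
      fix g assume "admissible (ball x0 r) g"
      then obtain h where h: "admissible ?B h" "g = (\<lambda>x. h ((1 / r) *\<^sub>R (x - x0)))"
        using admissible_unscale[OF r(1)] by blast
      have "flux F g = c * flux F' h"
        unfolding h(2) using flux_eq[OF Fl F'_eq] h(1) by (simp add: admissible_def)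
      also have "\<dots> \<le> c * Q" using flux_le_tv[OF h(1), of F'] Q c by simp
      finally show "ereal (flux F g) \<le> ereal (c * Q)" by simp
    qed
    with loc have EQ: "tv E (ball x0 r) \<le> ereal (c * Q)" by (rule order.trans)
    show ?thesis unfolding Q
    proof (rule tv_least)
      fix g assume g: "admissible ?B g"
      have "ereal (flux E (\<lambda>x. g ((1 / r) *\<^sub>R (x - x0)))) \<le> ereal (c * Q)"
        using flux_le_tv[OF admissible_rescale[OF r(1) g], of E] EQ by (rule order.trans)
      then show "ereal (flux E' g) \<le> ereal Q"
        using flux_eq[OF El E'_eq, of g] g c by (simp add: admissible_def)
    qed
  qed simp
  then have "minimal_set E'"
    unfolding minimal_set_tv using E'l fin by (auto simp: E'_def)
  then show ?thesis by (simp add: E'_def)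
qed

text \<open>Changing the sign of the field shows that a set and its complement in the ball have the
  same variation. Thereby removing a region from \<open>E\<close> becomes adding it to the
  complement, and only additions have to be treated.\<close>

lemma minimal_complement:
  assumes E: "minimal_set E"
  shows "minimal_set (ball 0 1 - E)"
proof -
  let ?B = "ball 0 1 :: (real^'a) set"
  have El: "E \<in> sets lebesgue" "E \<subseteq> ?B" using E by (auto simp: minimal_set_def)
  have le: "tv (?B - F) ?B \<le> tv F ?B" if F: "F \<in> sets lebesgue" for F
  proof (rule tv_least)
    fix g assume g: "admissible ?B g"
    then have tg: "test ?B g" by (simp add: admissible_def)
    then obtain K where K: "compact K" "K \<subseteq> ?B" "\<And>x. x \<notin> K \<Longrightarrow> g x = 0"
      unfolding test_def by auto
    have "flux (?B - F) g = flux (- F) g"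
    proof (rule flux_cong)
      fix x assume "divergence g x \<noteq> 0"
      then have "x \<in> ?B" using divergence_outside[OF compact_imp_closed[OF K(1)], of g x] K(2,3) by blast
      then show "x \<in> ?B - F \<longleftrightarrow> x \<in> - F" by simp
    qed
    also have "\<dots> = flux F (\<lambda>x. - g x)" by (simp add: flux_compl[OF F tg] flux_uminus[OF tg])
    finally show "ereal (flux (?B - F) g) \<le> tv F ?B"
      using flux_le_tv[of ?B "\<lambda>x. - g x" F] g by (simp add: admissible_def test_uminus)
  qed
  show ?thesis unfolding minimal_set_tv
  proof (intro conjI allI impI)
    show "?B - E \<in> sets lebesgue" using El by (intro sets.Diff) auto
    show "tv (?B - E) ?B < \<infinity>" using le[OF El(1)] E by (auto simp: minimal_set_tv intro: order.strict_trans1)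
    fix F :: "(real^'a) set"
    assume F: "F \<in> sets lebesgue \<and> F \<subseteq> ?B \<and> closure (?B - E - F \<union> (F - (?B - E))) \<subseteq> ?B"
    have "tv (?B - E) ?B \<le> tv E ?B" by (rule le[OF El(1)])
    also have "\<dots> \<le> tv (?B - F) ?B"
    proof -
      have "(E - (?B - F)) \<union> ((?B - F) - E) = ?B - E - F \<union> (F - (?B - E))" using El F by auto
      moreover have "?B - F \<in> sets lebesgue" using F by (intro sets.Diff) auto
      moreover have "\<forall>F. F \<in> sets lebesgue \<and> F \<subseteq> ?B \<and> closure ((E - F) \<union> (F - E)) \<subseteq> ?B
          \<longrightarrow> tv E ?B \<le> tv F ?B"
        using E unfolding minimal_set_tv by blast
      ultimately show ?thesis using F by (metis Diff_subset)
    qed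
    also have "\<dots> \<le> tv F ?B" using le F by blast
    finally show "tv (?B - E) ?B \<le> tv F ?B" .
  qed auto
qed

section \<open>The measure boundary\<close>

lemma emeasure_pos_iff:
  fixes A :: "(real^'n) set"
  assumes "A \<in> sets lebesgue"
  shows "emeasure lebesgue A > 0 \<longleftrightarrow> \<not> negligible A"
  using assms by (auto simp: negligible_iff_null_sets null_sets_def zero_less_iff_neq_zero simp del: emeasure_completion)

lemma ball_sets: "ball x r \<inter> E \<in> sets lebesgue" "ball x r - E \<in> sets lebesgue" if "E \<in> sets lebesgue"
  for E :: "(real^'n) set"
proof -
  have "ball x r \<in> sets lebesgue" by simp
  then show "ball x r \<inter> E \<in> sets lebesgue" "ball x r - E \<in> sets lebesgue"
    using that by (auto intro: sets.Int sets.Diff)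
qed

lemma measure_boundary_iff:
  assumes "E \<in> sets lebesgue"
  shows "x \<notin> measure_boundary E \<longleftrightarrow> (\<exists>r>0. negligible (ball x r \<inter> E) \<or> negligible (ball x r - E))"
  using emeasure_pos_iff[OF ball_sets(1)[OF assms], of x] emeasure_pos_iff[OF ball_sets(2)[OF assms], of x]
  unfolding measure_boundary_def by (auto simp: Diff_eq[symmetric] simp del: emeasure_completion)

lemma ball_diff_subset: "ball y (r - dist x y) \<subseteq> ball x r"
proof
  fix z assume "z \<in> ball y (r - dist x y)"
  then show "z \<in> ball x r" using dist_triangle[of x z y] by simp
qed

lemma closed_measure_boundary:
  fixes E :: "(real^'n) set"
  assumes E: "E \<in> sets lebesgue"
  shows "closed (measure_boundary E)"
  unfolding closed_def open_contains_ball
proof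
  fix x assume "x \<in> - measure_boundary E"
  then obtain r where r: "r > 0" "negligible (ball x r \<inter> E) \<or> negligible (ball x r - E)"
    using measure_boundary_iff[OF E] by blast
  have "y \<notin> measure_boundary E" if "y \<in> ball x r" for y
  proof -
    have "ball y (r - dist x y) \<subseteq> ball x r" by (rule ball_diff_subset)
    then have "ball y (r - dist x y) \<inter> E \<subseteq> ball x r \<inter> E" "ball y (r - dist x y) - E \<subseteq> ball x r - E" by auto
    with r(2) have "negligible (ball y (r - dist x y) \<inter> E) \<or> negligible (ball y (r - dist x y) - E)"
      using negligible_subset by blast
    moreover have "r - dist x y > 0" using that by simp
    ultimately show ?thesis using measure_boundary_iff[OF E] by blast
  qed
  then show "\<exists>e>0. ball x e \<subseteq> - measure_boundary E" using r(1) by blast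
qed

lemma negligible_locally:
  fixes S :: "(real^'n) set"
  assumes "\<And>x. x \<in> S \<Longrightarrow> \<exists>r>0. negligible (ball x r \<inter> S)"
  shows "negligible S"
proof (rule locally_negligible_alt[THEN iffD2], rule ballI)
  fix x assume x: "x \<in> S"
  then obtain r where "r > 0" "negligible (ball x r \<inter> S)" using assms by blast
  moreover have "openin (top_of_set S) (S \<inter> ball x r)" by (simp add: openin_open_Int)
  ultimately show "\<exists>U. openin (top_of_set S) U \<and> x \<in> U \<and> negligible U"
    using x by (intro exI[of _ "S \<inter> ball x r"]) (simp add: Int_commute)
qed

text \<open>The points near which \<open>E\<close> is null and the points near which its complement
  is null form two disjoint open sets covering \<open>U\<close>. By connectedness one of them
  contains \<open>U\<close>, and local negligibility becomes global.\<close>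

lemma connected_avoiding_boundary:
  fixes E :: "(real^'n) set"
  assumes E: "E \<in> sets lebesgue" and U: "open U" "connected U" "U \<inter> measure_boundary E = {}"
  shows "negligible (U \<inter> E) \<or> negligible (U - E)"
proof -
  let ?P = "\<lambda>S x. \<exists>r>0. ball x r \<subseteq> U \<and> negligible (ball x r \<inter> S)"
  let ?A = "{x. ?P E x}" and ?B = "{x. ?P (- E) x}"
  have op: "open {x. ?P S x}" for S
    unfolding open_contains_ball
  proof
    fix x assume "x \<in> {x. ?P S x}"
    then obtain r where r: "r > 0" "ball x r \<subseteq> U" "negligible (ball x r \<inter> S)" by blast
    have "y \<in> {x. ?P S x}" if "y \<in> ball x r" for y
    proof -
      have sub: "ball y (r - dist x y) \<subseteq> ball x r" by (rule ball_diff_subset)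
      then have "negligible (ball y (r - dist x y) \<inter> S)"
        by (intro negligible_subset[OF r(3)] Int_mono) auto
      then show ?thesis using that sub r(2) by (intro CollectI exI[of _ "r - dist x y"]) auto
    qed
    then show "\<exists>e>0. ball x e \<subseteq> {x. ?P S x}" using r(1) by (intro exI[of _ r] conjI subsetI)
  qed
  have cover: "U \<subseteq> ?A \<union> ?B"
  proof
    fix x assume x: "x \<in> U"
    then obtain r where r: "r > 0" "negligible (ball x r \<inter> E) \<or> negligible (ball x r - E)"
      using U(3) measure_boundary_iff[OF E] by blast
    obtain e where e: "e > 0" "ball x e \<subseteq> U" using U(1) x open_contains_ball by blast
    have "ball x (min e r) \<subseteq> U" "ball x (min e r) \<inter> E \<subseteq> ball x r \<inter> E"
      "ball x (min e r) \<inter> - E \<subseteq> ball x r - E" using e by auto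
    moreover have "min e r > 0" using e r by simp
    ultimately show "x \<in> ?A \<union> ?B" using r(2) negligible_subset by blast
  qed
  have disj: "?A \<inter> ?B = {}"
  proof (rule ccontr)
    assume "?A \<inter> ?B \<noteq> {}"
    then obtain x r s where x: "r > 0" "negligible (ball x r \<inter> E)" "s > 0" "negligible (ball x s \<inter> - E)" by blast
    have "ball x (min r s) \<subseteq> (ball x r \<inter> E) \<union> (ball x s \<inter> - E)" by auto
    then have "negligible (ball x (min r s))"
      using negligible_subset[OF negligible_Un[OF x(2,4)]] by blast
    moreover have "ball x (min r s) \<noteq> {}" using x by simp
    ultimately show False using open_not_negligible[OF open_ball] by blast
  qed
  have "?A \<inter> U = {} \<or> ?B \<inter> U = {}"
    using connectedD[OF U(2) op op _ cover, of] disj by blast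
  then consider "U \<subseteq> ?B" | "U \<subseteq> ?A" using cover by blast
  then show ?thesis
  proof cases
    case 1
    have "negligible (U - E)"
    proof (rule negligible_locally)
      fix x assume "x \<in> U - E"
      then obtain r where "r > 0" "negligible (ball x r \<inter> - E)" using 1 by blast
      then show "\<exists>r>0. negligible (ball x r \<inter> (U - E))"
        using negligible_subset[of "ball x r \<inter> - E" "ball x r \<inter> (U - E)"] by blast
    qed
    then show ?thesis ..
  next
    case 2
    have "negligible (U \<inter> E)"
    proof (rule negligible_locally)
      fix x assume "x \<in> U \<inter> E"
      then obtain r where "r > 0" "negligible (ball x r \<inter> E)" using 2 by blast
      then show "\<exists>r>0. negligible (ball x r \<inter> (U \<inter> E))"
        using negligible_subset[of "ball x r \<inter> E" "ball x r \<inter> (U \<inter> E)"] by blast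
    qed
    then show ?thesis ..
  qed
qed

text \<open>Small balls around a point of the open unit ball do not notice whether the complement is
  taken in that ball or in the whole space.\<close>

lemma measure_boundary_complement:
  fixes E :: "(real^'n) set"
  assumes E: "E \<in> sets lebesgue" and x: "x \<in> ball 0 1"
  shows "x \<in> measure_boundary (ball 0 1 - E) \<longleftrightarrow> x \<in> measure_boundary E"
proof -
  let ?B = "ball 0 1 :: (real^'n) set"
  have E': "?B - E \<in> sets lebesgue" by (rule ball_sets(2)[OF E])
  obtain e where e: "e > 0" "ball x e \<subseteq> ?B" using x open_contains_ball open_ball by blast
  have *: "(\<exists>r>0. negligible (ball x r \<inter> F) \<or> negligible (ball x r - F)) \<longleftrightarrow>
      (\<exists>r>0. r \<le> e \<and> (negligible (ball x r \<inter> F) \<or> negligible (ball x r - F)))" (is "?l \<longleftrightarrow> ?r") for F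
  proof
    assume ?l
    then obtain r where r: "r > 0" "negligible (ball x r \<inter> F) \<or> negligible (ball x r - F)" by blast
    have "ball x (min r e) \<inter> F \<subseteq> ball x r \<inter> F" "ball x (min r e) - F \<subseteq> ball x r - F" by auto
    then show ?r using r e(1) negligible_subset by (intro exI[of _ "min r e"]) auto
  qed blast
  have "ball x r \<inter> (?B - E) = ball x r - E" "ball x r - (?B - E) = ball x r \<inter> E" if "r \<le> e" for r
  proof -
    have "ball x r \<subseteq> ?B" using e(2) subset_ball[OF that, of x] by blast
    then show "ball x r \<inter> (?B - E) = ball x r - E" "ball x r - (?B - E) = ball x r \<inter> E" by blast+
  qed
  then have "x \<notin> measure_boundary (?B - E) \<longleftrightarrow> x \<notin> measure_boundary E"
    unfolding measure_boundary_iff[OF E'] measure_boundary_iff[OF E] *[of "?B - E"] *[of E] by metis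
  then show ?thesis by blast
qed

lemma negligible_affine_preimage:
  fixes x0 :: "real^'n"
  assumes "r \<noteq> 0" "negligible N"
  shows "negligible {y. x0 + r *\<^sub>R y \<in> N}"
proof -
  let ?T = "\<lambda>y. x0 + r *\<^sub>R y"
  have N: "N \<in> sets lebesgue" "emeasure lebesgue N = 0"
    using assms(2) by (auto simp: negligible_iff_null_sets null_sets_def simp del: emeasure_completion)
  have "(\<lambda>x. (1/r) *\<^sub>R x + (- (1/r)) *\<^sub>R x0) ` N = {y. ?T y \<in> N}"
  proof (intro set_eqI iffI)
    fix y assume "y \<in> {y. ?T y \<in> N}"
    then have "?T y \<in> N" by simp
    moreover have "y = (1/r) *\<^sub>R ?T y + (- (1/r)) *\<^sub>R x0" using assms(1) by (simp add: algebra_simps)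
    ultimately show "y \<in> (\<lambda>x. (1/r) *\<^sub>R x + (- (1/r)) *\<^sub>R x0) ` N" by blast
  next
    fix y assume "y \<in> (\<lambda>x. (1/r) *\<^sub>R x + (- (1/r)) *\<^sub>R x0) ` N"
    then obtain x where "x \<in> N" "y = (1/r) *\<^sub>R x + (- (1/r)) *\<^sub>R x0" by blast
    then have "?T y = x" using assms(1) by (simp add: scaleR_add_right scaleR_diff_right)
    then show "y \<in> {y. ?T y \<in> N}" using \<open>x \<in> N\<close> by simp
  qed
  then have "emeasure lebesgue {y. ?T y \<in> N} = 0"
    using emeasure_lebesgue_affine[of "1/r" "(- (1/r)) *\<^sub>R x0" N] N by simp
  then show ?thesis
    using sets_affine_preimage[OF assms(1) N(1), of x0]
    by (auto simp: negligible_iff_null_sets null_sets_def simp del: emeasure_completion)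
qed

text \<open>Dilations preserve null sets; the radii are shrunk until the balls stay inside the unit
  ball, where the truncation of the blow-up is invisible.\<close>

lemma measure_boundary_rescale:
  fixes x0 :: "real^'n"
  assumes E: "E \<in> sets lebesgue" and r: "r > 0" and y: "y \<in> ball 0 1"
  shows "y \<in> measure_boundary {y \<in> ball 0 1. x0 + r *\<^sub>R y \<in> E} \<longleftrightarrow> x0 + r *\<^sub>R y \<in> measure_boundary E"
proof -
  let ?B = "ball 0 1 :: (real^'n) set" and ?T = "\<lambda>y. x0 + r *\<^sub>R y"
  let ?E' = "{y \<in> ?B. ?T y \<in> E}"
  have E': "?E' \<in> sets lebesgue"
  proof -
    have "?E' = ?B \<inter> {y. ?T y \<in> E}" by auto
    then show ?thesis using sets_affine_preimage[of r E x0] E r by (simp add: sets.Int)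
  qed
  have d: "dist (?T a) (?T b) = r * dist a b" for a b
    using r by (simp add: dist_norm flip: scaleR_diff_right)
  have "y \<notin> measure_boundary ?E'" if T: "?T y \<notin> measure_boundary E"
  proof -
    obtain s where s: "s > 0" "negligible (ball (?T y) s \<inter> E) \<or> negligible (ball (?T y) s - E)"
      using T measure_boundary_iff[OF E] by blast
    obtain e where e: "e > 0" "ball y e \<subseteq> ?B" using y open_contains_ball open_ball by blast
    define \<rho> where "\<rho> = min e (s / r)"
    have \<rho>: "\<rho> > 0" using e s r by (simp add: \<rho>_def)
    have lt: "?T z \<in> ball (?T y) s" if "z \<in> ball y \<rho>" for z
      using that r unfolding mem_ball d by (simp add: \<rho>_def field_simps)
    have "ball y \<rho> \<subseteq> ?B" using e(2) subset_ball[of \<rho> e y] by (auto simp: \<rho>_def)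
    then have sub: "ball y \<rho> \<inter> ?E' \<subseteq> {z. ?T z \<in> ball (?T y) s \<inter> E}"
        "ball y \<rho> - ?E' \<subseteq> {z. ?T z \<in> ball (?T y) s - E}"
      using lt by blast+
    have neg: "negligible {z. ?T z \<in> N}" if "negligible N" for N
      using r that by (intro negligible_affine_preimage) auto
    have "negligible (ball y \<rho> \<inter> ?E') \<or> negligible (ball y \<rho> - ?E')"
      using s(2) negligible_subset[OF neg sub(1)] negligible_subset[OF neg sub(2)] by blast
    then show ?thesis using \<rho> measure_boundary_iff[OF E'] by blast
  qed
  moreover have "?T y \<notin> measure_boundary E" if Y: "y \<notin> measure_boundary ?E'"
  proof -
    obtain s where s: "s > 0" "negligible (ball y s \<inter> ?E') \<or> negligible (ball y s - ?E')"
      using Y measure_boundary_iff[OF E'] by blast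
    obtain e where e: "e > 0" "ball y e \<subseteq> ?B" using y open_contains_ball open_ball by blast
    let ?R = "\<lambda>x. (- (1/r)) *\<^sub>R x0 + (1/r) *\<^sub>R x"
    have inv: "?T (?R x) = x" for x using r by (simp add: algebra_simps)
    define \<rho> where "\<rho> = r * min e s"
    have \<rho>: "\<rho> > 0" using e s r by (simp add: \<rho>_def)
    have lt: "dist y (?R x) < min e s" if "x \<in> ball (?T y) \<rho>" for x
    proof -
      have "r * dist y (?R x) = dist (?T y) x" using d[of y "?R x"] unfolding inv by (rule sym)
      also have "\<dots> < r * min e s" using that by (simp add: \<rho>_def)
      finally show ?thesis using r by (metis mult_less_cancel_left_pos)
    qed
    have sub1: "ball (?T y) \<rho> \<inter> E \<subseteq> {x. ?R x \<in> ball y s \<inter> ?E'}"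
    proof
      fix x assume x: "x \<in> ball (?T y) \<rho> \<inter> E"
      then have "?R x \<in> ball y s" "?R x \<in> ?B" using lt[of x] e(2) by auto
      then show "x \<in> {x. ?R x \<in> ball y s \<inter> ?E'}" using x inv[of x] by (simp del: mem_ball)
    qed
    have sub2: "ball (?T y) \<rho> - E \<subseteq> {x. ?R x \<in> ball y s - ?E'}"
    proof
      fix x assume x: "x \<in> ball (?T y) \<rho> - E"
      then have "?R x \<in> ball y s" using lt[of x] by auto
      then show "x \<in> {x. ?R x \<in> ball y s - ?E'}" using x inv[of x] by (simp del: mem_ball)
    qed
    have neg: "negligible {x. ?R x \<in> N}" if "negligible N" for N
      using r that by (intro negligible_affine_preimage) auto
    have "negligible (ball (?T y) \<rho> \<inter> E) \<or> negligible (ball (?T y) \<rho> - E)"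
      using s(2) negligible_subset[OF neg sub1] negligible_subset[OF neg sub2] by blast
    then show ?thesis using \<rho> measure_boundary_iff[OF E] by blast
  qed
  ultimately show ?thesis by blast
qed

section \<open>Decay of oscillation by the iterated Harnack inequality\<close>

text \<open>Each step applies the Harnack inequality to the blow-up of \<open>E\<close> at
  \<open>x0\<close>. The exponent is \<open>m + 1\<close> because the first ball has radius 1/2: it
  lies in the unit ball, and there the oscillation about \<open>x0\<close> is trivially at most 2
  \<epsilon>.\<close>

lemma harnack_iterate:
  fixes k :: "'n::finite" and E :: "(real^'n) set"
  assumes H: "harnack_constants k \<epsilon>\<^sub>1 \<eta>" and \<eta>: "\<eta> \<le> 1/5"
    and E: "minimal_set E" and flat: "measure_boundary E \<inter> ball 0 1 \<subseteq> {x. \<bar>x $ k\<bar> \<le> \<epsilon>}"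
    and \<epsilon>: "\<epsilon> > 0" and x0: "x0 \<in> measure_boundary E" "norm x0 < 1/2"
  shows "2 ^ (m + 1) * \<epsilon> \<le> \<epsilon>\<^sub>1 \<Longrightarrow>
    measure_boundary E \<inter> ball x0 ((1/2) ^ (m + 1)) \<subseteq> {x. \<bar>x $ k - x0 $ k\<bar> \<le> 2 * \<epsilon> * (1 - \<eta>) ^ m}"
proof (induction m)
  case 0
  show ?case
  proof
    fix x assume x: "x \<in> measure_boundary E \<inter> ball x0 ((1/2) ^ (0 + 1))"
    then have "dist x0 x < 1/2" by simp
    then have "norm x < 1" using x0(2) norm_triangle_ineq2[of x x0] by (simp add: dist_norm norm_minus_commute)
    then have "\<bar>x $ k\<bar> \<le> \<epsilon>" using x flat by auto
    moreover have "\<bar>x0 $ k\<bar> \<le> \<epsilon>" using x0 flat by auto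
    ultimately show "x \<in> {x. \<bar>x $ k - x0 $ k\<bar> \<le> 2 * \<epsilon> * (1 - \<eta>) ^ 0}" by simp
  qed
next
  case (Suc m)
  define r where "r = (1/2::real) ^ (m + 1)"
  have r: "r > 0" "r \<le> 1/2" by (auto simp: r_def power_le_one)
  have \<eta>0: "\<eta> > 0" and har: "\<And>(E :: (real^'n) set) \<epsilon>.
        minimal_set E \<Longrightarrow> 0 \<in> measure_boundary E \<Longrightarrow> 0 < \<epsilon> \<Longrightarrow> \<epsilon> \<le> \<epsilon>\<^sub>1 \<Longrightarrow>
        measure_boundary E \<inter> ball 0 1 \<subseteq> {x. \<bar>x $ k\<bar> \<le> \<epsilon>} \<Longrightarrow>
        measure_boundary E \<inter> ball 0 (1/2) \<subseteq> {x. \<bar>x $ k\<bar> \<le> \<epsilon> * (1 - \<eta>)}"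
    using H unfolding harnack_constants_def by blast+
  have El: "E \<in> sets lebesgue" using E by (simp add: minimal_set_def)
  have le1: "2 ^ (m + 1) * \<epsilon> \<le> \<epsilon>\<^sub>1" 
  proof -
    have "(2::real) ^ (m + 1) * \<epsilon> \<le> 2 ^ (Suc m + 1) * \<epsilon>"
      using \<epsilon> by (intro mult_right_mono power_increasing) auto
    then show ?thesis using Suc.prems by linarith
  qed
  note IH = Suc.IH[OF le1, folded r_def]
  have sub: "ball x0 r \<subseteq> ball 0 1"
  proof
    fix x assume "x \<in> ball x0 r"
    then show "x \<in> ball 0 1"
      using x0(2) r norm_triangle_ineq2[of x x0] by (simp add: dist_norm norm_minus_commute)
  qed
  define E' where "E' = {y \<in> ball 0 1. x0 + r *\<^sub>R y \<in> E}"
  have mb: "y \<in> measure_boundary E' \<longleftrightarrow> x0 + r *\<^sub>R y \<in> measure_boundary E" if "y \<in> ball 0 1" for y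
    unfolding E'_def by (rule measure_boundary_rescale[OF El r(1) that])
  \<comment> \<open>The slab height after magnification by 1 / r. Bounding the factor
    \<open>(1 - \<eta>) ^ m\<close> by 1 leaves \<open>2 ^ (m + 2) * \<epsilon>\<close>, which is
    what the premise for \<open>Suc m\<close> controls.\<close>
  define \<epsilon>' where "\<epsilon>' = 2 * \<epsilon> * (1 - \<eta>) ^ m / r"
  have "\<epsilon>' > 0" using \<epsilon> \<eta> r by (simp add: \<epsilon>'_def)
  moreover have "\<epsilon>' \<le> \<epsilon>\<^sub>1"
  proof -
    have "\<epsilon>' \<le> 2 * \<epsilon> * 1 / r"
      unfolding \<epsilon>'_def using \<epsilon> \<eta> \<eta>0 r by (intro divide_right_mono mult_left_mono power_le_one) auto
    also have "\<dots> = 2 ^ (Suc m + 1) * \<epsilon>" by (simp add: r_def power_divide)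
    finally show ?thesis using Suc.prems by simp
  qed
  moreover have "minimal_set E'" unfolding E'_def by (rule minimal_rescale[OF E r(1) sub])
  moreover have "0 \<in> measure_boundary E'" using mb[of 0] x0 by simp
  moreover have "measure_boundary E' \<inter> ball 0 1 \<subseteq> {y. \<bar>y $ k\<bar> \<le> \<epsilon>'}"
  proof
    fix y assume y: "y \<in> measure_boundary E' \<inter> ball 0 1"
    then have "x0 + r *\<^sub>R y \<in> measure_boundary E \<inter> ball x0 r" using mb[of y] r by (simp add: dist_norm)
    with IH have "\<bar>(x0 + r *\<^sub>R y) $ k - x0 $ k\<bar> \<le> 2 * \<epsilon> * (1 - \<eta>) ^ m" by blast
    then have "r * \<bar>y $ k\<bar> \<le> 2 * \<epsilon> * (1 - \<eta>) ^ m" using r by (simp add: abs_mult)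
    then show "y \<in> {y. \<bar>y $ k\<bar> \<le> \<epsilon>'}" using r by (simp add: \<epsilon>'_def field_simps)
  qed
  ultimately have conc: "measure_boundary E' \<inter> ball 0 (1/2) \<subseteq> {y. \<bar>y $ k\<bar> \<le> \<epsilon>' * (1 - \<eta>)}"
    using har by blast
  show ?case
  proof
    fix x assume x: "x \<in> measure_boundary E \<inter> ball x0 ((1/2) ^ (Suc m + 1))"
    define y where "y = (1 / r) *\<^sub>R (x - x0)"
    have xy: "x = x0 + r *\<^sub>R y" using r by (simp add: y_def)
    have "r * norm y < r * (1/2)" using x r unfolding xy by (simp add: dist_norm r_def)
    then have "norm y < 1/2" using r by simp
    then have "\<bar>y $ k\<bar> \<le> \<epsilon>' * (1 - \<eta>)" using conc mb[of y] x xy by auto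
    then have "r * \<bar>y $ k\<bar> \<le> r * (\<epsilon>' * (1 - \<eta>))" using r by simp
    also have "\<dots> = 2 * \<epsilon> * (1 - \<eta>) ^ Suc m" using r by (simp add: \<epsilon>'_def)
    finally show "x \<in> {x. \<bar>x $ k - x0 $ k\<bar> \<le> 2 * \<epsilon> * (1 - \<eta>) ^ Suc m}"
      using r by (simp add: xy abs_mult)
  qed
qed

section \<open>Touching a minimal set from one side\<close>

text \<open>The hypothesis \<open>cal\<close> forces \<open>\<nu>\<close> to be the unit vector
  along the gradient of \<open>\<Phi>\<close> wherever that gradient is nonzero. Any admissible
  \<open>h\<close> is bent towards \<open>\<nu>\<close> by a convex combination, which stays
  admissible and equals \<open>\<nu>\<close> on the added part \<open>D\<close> as far as
  divergences are concerned. As \<open>\<nu>\<close> has negative divergence there, adding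
  \<open>K0\<close> would lower the perimeter by the positive amount \<open>I\<close>.\<close>

lemma calibrated_addition:
  fixes E K0 :: "(real^'n) set"
  assumes E: "minimal_set E"
    and \<Phi>: "C1 \<Phi>" and \<nu>: "C1 \<nu>" "\<And>x. norm (\<nu> x) \<le> 1"
    and cal: "\<And>x h. norm h \<le> 1 \<Longrightarrow> (\<Sum>i\<in>UNIV. pd i \<Phi> x * (\<nu> x $ i - h $ i)) \<ge> 0"
    and K0: "compact K0" "K0 \<subseteq> ball y \<rho>\<^sub>1" "K0 \<subseteq> {x. \<Phi> x \<le> t}"
    and \<rho>: "0 < \<rho>\<^sub>1" "\<rho>\<^sub>1 < \<rho>\<^sub>2" "cball y \<rho>\<^sub>2 \<subseteq> ball 0 1"
    and null: "negligible ({x \<in> cball y \<rho>\<^sub>2. \<Phi> x \<le> t} - (E \<union> K0))"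
    and neg: "\<And>x. x \<in> K0 \<Longrightarrow> divergence \<nu> x < 0"
  shows "negligible (K0 - E)"
proof (rule ccontr)
  assume nn: "\<not> negligible (K0 - E)"
  let ?B = "ball 0 1 :: (real^'n) set"
  define D where "D = K0 - E"
  define F where "F = E \<union> K0"
  have El: "E \<in> sets lebesgue" "E \<subseteq> ?B" using E by (auto simp: minimal_set_def)
  have K0l: "K0 \<in> sets lebesgue" using K0(1) by (simp add: compact_imp_closed)
  have Dl: "D \<in> sets lebesgue" unfolding D_def using K0l El(1) by (rule sets.Diff)
  have F_eq: "F = E \<union> D" "E \<inter> D = {}" by (auto simp: F_def D_def)
  have Fl: "F \<in> sets lebesgue" unfolding F_def using El(1) K0l by (rule sets.Un)
  have mFl: "- F \<in> sets lebesgue" using sets.compl_sets[OF Fl] by (simp add: Compl_eq_Diff_UNIV)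
  have b12: "ball y \<rho>\<^sub>1 \<subseteq> cball y \<rho>\<^sub>2" using \<rho> by auto
  obtain P where P: "tv E ?B = ereal P"
    using E tv_nonneg[of E ?B] by (cases "tv E ?B") (auto simp: minimal_set_tv)
  define \<xi> where "\<xi> = bump y \<rho>\<^sub>1 \<rho>\<^sub>2"
  have \<xi>C: "C1 \<xi>" unfolding \<xi>_def by (rule C1_bump)
  have \<xi>r: "0 \<le> \<xi> x" "\<xi> x \<le> 1" for x unfolding \<xi>_def by (rule bump_range)+
  have \<xi>1: "\<xi> x = 1" if "x \<in> ball y \<rho>\<^sub>1" for x
    unfolding \<xi>_def by (rule bump_inside) (use \<rho> that in \<open>auto simp: dist_norm norm_minus_commute\<close>)
  have \<xi>0: "\<xi> x = 0" if "x \<notin> cball y \<rho>\<^sub>2" for x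
    unfolding \<xi>_def by (rule bump_outside) (use \<rho> that in \<open>auto simp: dist_norm norm_minus_commute\<close>)
  have pd\<xi>: "pd i \<xi> x = 0" if "x \<in> ball y \<rho>\<^sub>1" for i x
  proof -
    have "(\<xi> has_derivative (\<lambda>v. 0)) (at x)"
      by (rule has_derivative_transform_within_open[of "\<lambda>x. 1" _ _ _ "ball y \<rho>\<^sub>1"]) (use that \<xi>1 in auto)
    then show ?thesis using has_derivative_pd by fastforce
  qed
  \<comment> \<open>The gain in perimeter; it is positive exactly because \<open>D\<close> is
    supposed not to be null.\<close>
  define I where "I = - (LINT x:D|lebesgue. divergence \<nu> x)"
  have intD: "set_integrable lebesgue D (divergence \<nu>)"
  proof -
    have "integrable lborel (\<lambda>x. indicator K0 x *\<^sub>R divergence \<nu> x)"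
      by (rule borel_integrable_compact[OF K0(1) continuous_divergence[OF \<nu>(1)]])
    then have "set_integrable lebesgue K0 (divergence \<nu>)"
      unfolding set_integrable_def using integrable_completion[of "\<lambda>x. indicator K0 x *\<^sub>R divergence \<nu> x" lborel]
      by (metis borel_measurable_integrable)
    then show ?thesis by (rule set_integrable_subset[OF _ Dl]) (auto simp: D_def)
  qed
  have Ipos: "I > 0"
  proof -
    let ?f = "\<lambda>x. indicator D x *\<^sub>R (- divergence \<nu> x)"
    have fi: "integrable lebesgue ?f"
      using intD unfolding set_integrable_def by (simp only: scaleR_minus_right Bochner_Integration.integrable_minus)
    have f0: "?f x \<ge> 0" for x using neg[of x] by (auto simp: indicator_def D_def)
    have I: "I = integral\<^sup>L lebesgue ?f" by (simp add: I_def set_lebesgue_integral_def)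
    have "I \<ge> 0" unfolding I using f0 by (intro Bochner_Integration.integral_nonneg) auto
    moreover have "I \<noteq> 0"
    proof
      assume "I = 0"
      then have "AE x in lebesgue. ?f x = 0"
        using integral_nonneg_eq_0_iff_AE[OF fi] f0 I by simp
      then have "AE x in lebesgue. x \<notin> D"
      proof (rule AE_mp, intro AE_I2 impI)
        show "x \<notin> D" if "?f x = 0" for x
          using neg[of x] that by (cases "x \<in> D") (auto simp: D_def)
      qed
      then have "D \<in> null_sets lebesgue"
        using AE_iff_null_sets[OF Dl] by simp
      then show False using nn by (simp add: D_def negligible_iff_null_sets)
    qed
    ultimately show ?thesis by simp
  qed
  have key: "flux F h + I \<le> P" if h: "admissible ?B h" for h
  proof -
    have th: "test ?B h" and hn: "\<And>x. norm (h x) \<le> 1" using h by (auto simp: admissible_def)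
    have hC: "C1 h" using th by (rule test_C1)
    obtain L where L: "compact L" "L \<subseteq> ?B" "\<And>x. x \<notin> L \<Longrightarrow> h x = 0" using th unfolding test_def by auto
    define w where "w = (\<lambda>x. \<xi> x *\<^sub>R (\<nu> x - h x))"
    have wC: "C1 w" unfolding w_def by (intro C1_scaleR \<xi>C C1_diff \<nu>(1) hC)
    have w0: "w x = 0" if "x \<notin> cball y \<rho>\<^sub>2" for x using \<xi>0[OF that] by (simp add: w_def)
    have tw: "test ?B w" unfolding test_def using wC w0 \<rho>(3) by (intro conjI exI[of _ "cball y \<rho>\<^sub>2"]) auto
    \<comment> \<open>This cutoff drops from 1 to 0 between \<Phi> = t and \<Phi> = t + 1 / (j + 1).
      Its gradient is large, but enters the divergence with a sign known from \<open>cal\<close>, so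
      it can be discarded. The remaining error \<open>r j\<close> tends to 0, because outside
      \<open>F\<close> almost every point of the larger ball has \<Phi> > t.\<close>
    define \<theta> where "\<theta> = (\<lambda>j x. cutoff (real (Suc j) * (\<Phi> x - t)))"
    have \<theta>C: "C1 (\<theta> j)" for j unfolding \<theta>_def by (intro C1_cutoff C1_mult C1_diff C1_const \<Phi>)
    have \<theta>r: "0 \<le> \<theta> j x" "\<theta> j x \<le> 1" for j x by (auto simp: \<theta>_def cutoff_simps)
    have pd\<theta>: "pd i (\<theta> j) x = cutoff' (real (Suc j) * (\<Phi> x - t)) * (real (Suc j) * pd i \<Phi> x)" for i j x
    proof -
      have "pd i (\<lambda>x. real (Suc j) * (\<Phi> x - t)) x = real (Suc j) * pd i \<Phi> x"
        using has_derivative_pd[OF has_derivative_mult_right[OF has_derivative_diff[OF C1_has_derivative[OF \<Phi>] has_derivative_const]]]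
        by (simp add: pd_def)
      then show ?thesis
        unfolding \<theta>_def by (subst pd_cutoff) (auto intro!: C1_mult C1_diff C1_const \<Phi>)
    qed
    have ttw: "test ?B (\<lambda>x. \<theta> j x *\<^sub>R w x)" for j by (rule test_scaleR[OF \<theta>C tw])
    have divtw: "divergence (\<lambda>x. \<theta> j x *\<^sub>R w x) x
        = cutoff' (real (Suc j) * (\<Phi> x - t)) * real (Suc j) * \<xi> x * (\<Sum>i\<in>UNIV. pd i \<Phi> x * (\<nu> x $ i - h x $ i))
          + \<theta> j x * divergence w x" for j x
      unfolding divergence_scaleR[OF \<theta>C wC] pd\<theta> by (simp add: w_def sum_distrib_left mult_ac)
    have divle: "divergence (\<lambda>x. \<theta> j x *\<^sub>R w x) x \<le> \<theta> j x * divergence w x" for j x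
    proof -
      have "cutoff' (real (Suc j) * (\<Phi> x - t)) * (real (Suc j) * \<xi> x * (\<Sum>i\<in>UNIV. pd i \<Phi> x * (\<nu> x $ i - h x $ i))) \<le> 0"
        using \<xi>r[of x] cal[OF hn[of x], of x] by (intro mult_nonpos_nonneg cutoff_simps mult_nonneg_nonneg) auto
      then show ?thesis by (simp add: divtw mult.assoc)
    qed
    have twi: "integrable lebesgue (\<lambda>x. indicator (- F) x *\<^sub>R (\<theta> j x * divergence w x))" for j
    proof -
      have "integrable lebesgue (\<lambda>x. \<theta> j x * divergence w x)"
      proof (rule integrable_lebesgue_compact_support)
        show "continuous_on UNIV (\<lambda>x. \<theta> j x * divergence w x)"
          by (intro continuous_intros C1_continuous[OF \<theta>C] continuous_divergence wC)
        show "compact (cball y \<rho>\<^sub>2)" by simp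
        fix x assume "x \<notin> cball y \<rho>\<^sub>2"
        then show "\<theta> j x * divergence w x = 0" using divergence_outside[OF closed_cball w0] by simp
      qed
      then show ?thesis by (rule integrable_mult_indicator[OF mFl])
    qed
    define r where "r = (\<lambda>j. \<integral>x. indicator (- F) x *\<^sub>R (\<theta> j x * divergence w x) \<partial>lebesgue)"
    have step: "flux F h + I - r j \<le> P" for j
    proof -
      define g where "g = (\<lambda>x. h x + \<theta> j x *\<^sub>R w x)"
      have tg: "test ?B g" unfolding g_def by (rule test_add[OF th ttw])
      have "norm (g x) \<le> 1" for x
      proof -
        have \<psi>: "0 \<le> \<theta> j x * \<xi> x" "\<theta> j x * \<xi> x \<le> 1"
          using \<theta>r[of j x] \<xi>r[of x] by (auto intro: mult_le_one)
        have "g x = (1 - \<theta> j x * \<xi> x) *\<^sub>R h x + (\<theta> j x * \<xi> x) *\<^sub>R \<nu> x"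
          by (simp add: g_def w_def algebra_simps)
        also have "norm \<dots> \<le> (1 - \<theta> j x * \<xi> x) * norm (h x) + (\<theta> j x * \<xi> x) * norm (\<nu> x)"
          by (rule norm_triangle_le) (use \<psi> in simp)
        also have "\<dots> \<le> (1 - \<theta> j x * \<xi> x) * 1 + (\<theta> j x * \<xi> x) * 1"
          using \<psi> hn[of x] \<nu>(2)[of x] by (intro add_mono mult_left_mono) auto
        finally show ?thesis by simp
      qed
      with tg have ag: "admissible ?B g" by (simp add: admissible_def)
      have "flux D g = (LINT x:D|lebesgue. divergence \<nu> x)"
        unfolding flux_def
      proof (rule set_lebesgue_integral_cong[OF Dl], intro allI impI)
        fix x assume x: "x \<in> D"
        then have xb: "x \<in> ball y \<rho>\<^sub>1" and xt: "\<Phi> x \<le> t" using K0 by (auto simp: D_def)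
        \<comment> \<open>The derivative of \<open>cutoff\<close> vanishes on s \<le> 0, the point 0
          included, so the gradient term is absent on all of \<open>D\<close>, also where \<Phi> =
          t.\<close>
        have nonpos: "real (Suc j) * (\<Phi> x - t) \<le> 0" using xt by (intro mult_nonneg_nonpos) auto
        have "divergence g x = divergence h x + \<theta> j x * divergence w x"
          unfolding g_def divergence_add[OF hC test_C1[OF ttw]] divtw cutoff_simps(3)[OF nonpos] by simp
        also have "\<theta> j x = 1" unfolding \<theta>_def by (rule cutoff_simps(1)[OF nonpos])
        also have "divergence w x = divergence \<nu> x - divergence h x"
          unfolding w_def divergence_scaleR[OF \<xi>C C1_diff[OF \<nu>(1) hC]] divergence_diff[OF \<nu>(1) hC]
          by (simp add: pd\<xi>[OF xb] \<xi>1[OF xb])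
        finally show "divergence g x = divergence \<nu> x" by simp
      qed
      then have fD: "flux D g = - I" by (simp add: I_def)
      have "flux F g = flux E g + flux D g"
        unfolding F_eq(1) by (rule flux_Un[OF El(1) Dl F_eq(2) tg])
      moreover have "flux F g = flux F h - flux (- F) (\<lambda>x. \<theta> j x *\<^sub>R w x)"
        unfolding g_def flux_add[OF Fl th ttw] flux_compl[OF Fl ttw] by simp
      moreover have "flux (- F) (\<lambda>x. \<theta> j x *\<^sub>R w x) \<le> r j"
        unfolding flux_def r_def set_lebesgue_integral_def
      proof (rule integral_mono[OF _ twi])
        show "integrable lebesgue (\<lambda>x. indicator (- F) x *\<^sub>R divergence (\<lambda>x. \<theta> j x *\<^sub>R w x) x)"
          using integrable_flux[OF mFl ttw] unfolding set_integrable_def .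
        show "indicator (- F) x *\<^sub>R divergence (\<lambda>x. \<theta> j x *\<^sub>R w x) x \<le> indicator (- F) x *\<^sub>R (\<theta> j x * divergence w x)" for x
          using divle[of j x] by (auto simp: indicator_def)
      qed
      moreover have "flux E g \<le> P" using flux_le_tv[OF ag, of E] P by simp
      ultimately show ?thesis using fD by linarith
    qed
    have "r \<longlonglongrightarrow> (\<integral>x. 0 \<partial>(lebesgue :: (real^'n) measure))"
      unfolding r_def
    proof (rule integral_dominated_convergence)
      show "integrable lebesgue (\<lambda>x. \<bar>divergence w x\<bar>)"
        using integrable_divergence[OF wC compact_cball w0] by (rule integrable_abs)
      show "(\<lambda>x. indicator (- F) x *\<^sub>R (\<theta> j x * divergence w x)) \<in> borel_measurable lebesgue" for j
        using twi by (rule borel_measurable_integrable)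
      show "AE x in lebesgue. norm (indicator (- F) x *\<^sub>R (\<theta> j x * divergence w x)) \<le> \<bar>divergence w x\<bar>" for j
        using \<theta>r[of j] by (intro AE_I2) (auto simp: indicator_def abs_mult intro!: mult_left_le_one_le)
      have "AE x in lebesgue. x \<notin> {x \<in> cball y \<rho>\<^sub>2. \<Phi> x \<le> t} - (E \<union> K0)"
        using null by (intro AE_not_in) (simp add: negligible_iff_null_sets)
      then show "AE x in lebesgue. (\<lambda>j. indicator (- F) x *\<^sub>R (\<theta> j x * divergence w x)) \<longlonglongrightarrow> 0"
      proof (rule AE_mp, intro AE_I2 impI)
        fix x assume x: "x \<notin> {x \<in> cball y \<rho>\<^sub>2. \<Phi> x \<le> t} - (E \<union> K0)"
        consider "x \<in> F" | "x \<notin> cball y \<rho>\<^sub>2" | "\<Phi> x > t" using x by (auto simp: F_def)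
        then show "(\<lambda>j. indicator (- F) x *\<^sub>R (\<theta> j x * divergence w x)) \<longlonglongrightarrow> 0"
        proof cases
          case 2
          then have "divergence w x = 0" using divergence_outside[OF closed_cball w0] by simp
          then show ?thesis by simp
        next
          case 3
          obtain N where N: "real N * (\<Phi> x - t) > 1" using reals_Archimedean3[of "\<Phi> x - t"] 3 by auto
          have "\<theta> j x = 0" if "j \<ge> N" for j
            unfolding \<theta>_def
          proof (rule cutoff_simps(2))
            have "real N * (\<Phi> x - t) \<le> real (Suc j) * (\<Phi> x - t)" using 3 that by (intro mult_right_mono) auto
            then show "1 \<le> real (Suc j) * (\<Phi> x - t)" using N by simp
          qed
          then show ?thesis by (intro tendsto_eventually) (auto simp: eventually_sequentially)
        qed simp
      qed
    qed auto
    then have "(\<lambda>j. flux F h + I - r j) \<longlonglongrightarrow> flux F h + I - 0" by (intro tendsto_intros) simp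
    then show ?thesis using step by (intro LIMSEQ_le_const2[of "\<lambda>j. flux F h + I - r j"]) auto
  qed
  have "tv F ?B \<le> ereal (P - I)"
    by (rule tv_least) (use key in \<open>simp add: le_diff_eq\<close>)
  moreover have "tv E ?B \<le> tv F ?B"
  proof -
    have "E - F \<union> (F - E) \<subseteq> K0" by (auto simp: F_def)
    then have "closure (E - F \<union> (F - E)) \<subseteq> K0" using K0(1) by (intro closure_minimal) (auto intro: compact_imp_closed)
    moreover have "K0 \<subseteq> ?B" using K0(2) b12 \<rho>(3) by blast
    moreover have "F \<subseteq> ?B" using El(2) \<open>K0 \<subseteq> ?B\<close> by (simp add: F_def)
    ultimately show ?thesis using E Fl unfolding minimal_set_tv by blast
  qed
  ultimately have "ereal P \<le> ereal (P - I)" unfolding P by (rule order.trans[rotated])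
  then show False using Ipos by simp
qed

section \<open>Mean curvature and unit normals of polynomial graphs\<close>

definition grad2 :: "(real^'n \<Rightarrow> real) \<Rightarrow> real^'n \<Rightarrow> real" where
  "grad2 f x = (\<Sum>i\<in>UNIV. pd i f x * pd i f x)"

definition hess_grad :: "(real^'n \<Rightarrow> real) \<Rightarrow> real^'n \<Rightarrow> real" where
  "hess_grad f x = (\<Sum>i\<in>UNIV. \<Sum>j\<in>UNIV. pd i f x * pd j f x * pd j (pd i f) x)"

text \<open>The mean curvature of the graph of \<open>f\<close>, times the positive factor \<open>(1 + |\<nabla>f|\<^sup>2) powr (3/2)\<close>.\<close>

definition mean_curv :: "(real^'n \<Rightarrow> real) \<Rightarrow> real^'n \<Rightarrow> real" where
  "mean_curv f x = (1 + grad2 f x) * lap f x - hess_grad f x"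

lemma continuous_mean_curv:
  assumes "hpoly k f"
  shows "continuous_on A (mean_curv f)"
  unfolding mean_curv_def[abs_def] grad2_def hess_grad_def
  by (intro continuous_intros hpoly_continuous[of k] hpoly_pd hpoly_lap assms)

text \<open>\<open>\<nu>\<close> is the normalized gradient of the function defining the graph,
  extended constantly in the vertical direction. Because \<open>\<phi>\<close> ignores the
  coordinate \<open>k\<close> and \<sigma> is 1 or -1, the gradient has squared length
  \<open>S x\<close>, at least 1. The divergence of \<open>\<nu>\<close> is the mean curvature
  expression divided by S^(3/2), hence has its sign. The two values of \<sigma> serve contact from
  above and from below.\<close>

lemma graph_normal:
  fixes k :: "'n::finite"
  assumes \<phi>: "hpoly k \<phi>" and \<sigma>: "\<sigma> * \<sigma> = 1"
  obtains \<nu> :: "real^'n \<Rightarrow> real^'n" where "C1 \<nu>" "\<And>x. norm (\<nu> x) \<le> 1"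
    "\<And>x h. norm h \<le> 1 \<Longrightarrow> (\<Sum>i\<in>UNIV. pd i (\<lambda>x. \<phi> x - \<sigma> * x $ k) x * (\<nu> x $ i - h $ i)) \<ge> 0"
    "\<And>x. mean_curv \<phi> x < 0 \<Longrightarrow> divergence \<nu> x < 0"
proof -
  define S where "S = (\<lambda>x. 1 + grad2 \<phi> x)"
  define h where "h = (\<lambda>s::real. 1 / sqrt s)"
  define h' where "h' = (\<lambda>s::real. - 1 / (2 * s * sqrt s))"
  define a where "a = (\<lambda>i. if i = k then \<sigma> else 0)"
  define G :: "real^'n \<Rightarrow> real^'n" where "G = (\<lambda>x. \<chi> i. pd i \<phi> x - a i)"
  define \<nu> where "\<nu> = (\<lambda>x. h (S x) *\<^sub>R G x)"
  have S: "S x \<ge> 1" for x by (simp add: S_def grad2_def sum_nonneg)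
  have hS: "hpoly k S"
    unfolding S_def grad2_def[abs_def] by (intro hpoly_intros hpoly_pd \<phi>) auto
  have SC: "C1 S" by (rule C1_hpoly[OF hS])
  have hd: "(h has_real_derivative h' s) (at s)" if "s > 0" for s
    unfolding h_def h'_def using that
    by (auto intro!: derivative_eq_intros simp: field_simps power2_eq_square)
  have Sp: "S x > 0" for x using S[of x] by simp
  have hC: "C1 (\<lambda>x. h (S x))"
  proof (rule C1_compose_real[OF SC])
    show "(h has_real_derivative h' (S x)) (at (S x))" for x by (rule hd[OF Sp])
    show "continuous_on {0<..} h'" unfolding h'_def by (intro continuous_intros) auto
  qed (use Sp in auto)
  have GC: "C1 G"
    unfolding G_def by (rule C1_vec) (auto intro!: C1_diff C1_const C1_hpoly[OF hpoly_pd[OF \<phi>]])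
  have \<nu>C: "C1 \<nu>" unfolding \<nu>_def by (rule C1_scaleR[OF hC GC])
  have G2: "(norm (G x))\<^sup>2 = S x" for x
  proof -
    have "(norm (G x))\<^sup>2 = (\<Sum>i\<in>UNIV. (pd i \<phi> x - a i)\<^sup>2)"
      by (simp add: norm_vec_def L2_set_def sum_nonneg G_def)
    also have "\<dots> = (\<Sum>i\<in>UNIV. pd i \<phi> x * pd i \<phi> x + (if i = k then 1 else 0))"
      using \<sigma> pd_missing[OF \<phi>] by (intro sum.cong refl) (auto simp: a_def power2_eq_square)
    finally show ?thesis by (simp add: sum.distrib S_def grad2_def)
  qed
  have nG: "norm (G x) = sqrt (S x)" for x using G2[of x] by (metis norm_ge_zero real_sqrt_unique)
  have n\<nu>: "norm (\<nu> x) = 1" for x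
    using Sp[of x] by (simp add: \<nu>_def h_def nG)
  have pd\<Phi>: "pd i (\<lambda>x. \<phi> x - \<sigma> * x $ k) x = G x $ i" for i x
  proof -
    have "((\<lambda>x. \<phi> x - \<sigma> * x $ k) has_derivative (\<lambda>v. (\<Sum>i\<in>UNIV. v $ i * pd i \<phi> x) - \<sigma> * v $ k)) (at x)"
      by (intro has_derivative_diff hpoly_has_derivative[OF \<phi>] has_derivative_mult_right
          bounded_linear_imp_has_derivative bounded_linear_vec_nth)
    from has_derivative_pd[OF this, of i] show ?thesis
      by (cases "i = k") (simp_all add: G_def a_def axis_def if_distrib if_distribR cong: if_cong)
  qed
  show thesis
  proof (rule that[OF \<nu>C])
    show "norm (\<nu> x) \<le> 1" for x by (simp add: n\<nu>)
  next
    fix x and v :: "real^'n" assume v: "norm v \<le> 1"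
    have "(\<Sum>i\<in>UNIV. pd i (\<lambda>x. \<phi> x - \<sigma> * x $ k) x * (\<nu> x $ i - v $ i)) = G x \<bullet> \<nu> x - G x \<bullet> v"
      by (simp add: pd\<Phi> inner_vec_def algebra_simps sum_subtractf)
    also have "G x \<bullet> \<nu> x = sqrt (S x)"
      using Sp[of x] G2[of x] by (simp add: \<nu>_def h_def dot_square_norm real_div_sqrt)
    also have "sqrt (S x) - G x \<bullet> v \<ge> 0"
    proof -
      have "G x \<bullet> v \<le> norm (G x) * norm v" by (rule norm_cauchy_schwarz)
      also have "\<dots> \<le> norm (G x) * 1" using v by (intro mult_left_mono) auto
      finally show ?thesis by (simp add: nG)
    qed
    finally show "(\<Sum>i\<in>UNIV. pd i (\<lambda>x. \<phi> x - \<sigma> * x $ k) x * (\<nu> x $ i - v $ i)) \<ge> 0" .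
  next
    fix x assume mc: "mean_curv \<phi> x < 0"
    have mceq: "mean_curv \<phi> x = S x * lap \<phi> x - hess_grad \<phi> x"
      by (simp add: mean_curv_def S_def)
    have divG: "divergence G x = lap \<phi> x"
    proof -
      have "pd i (\<lambda>x. G x $ i) x = pd i (pd i \<phi>) x" for i
        using pd_diff[OF hpoly_pd[OF \<phi>] hpoly.const, of i i "a i"] by (simp add: G_def)
      then show ?thesis unfolding divergence_eq_pd[OF GC] by (simp add: lap_def)
    qed
    have pdS: "pd i S x = 2 * (\<Sum>j\<in>UNIV. pd j \<phi> x * pd i (pd j \<phi>) x)" for i
    proof -
      have "pd i S = (\<lambda>x. \<Sum>j\<in>UNIV. pd i (\<lambda>x. pd j \<phi> x * pd j \<phi> x) x)"
        unfolding S_def grad2_def[abs_def]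
        by (subst pd_add[of k]; (subst pd_sum[of _ k])?) (auto intro!: hpoly_intros hpoly_pd \<phi>)
      then show ?thesis
        by (simp add: pd_mult[OF hpoly_pd[OF \<phi>] hpoly_pd[OF \<phi>]] sum_distrib_left mult_ac)
    qed
    have "(\<Sum>i\<in>UNIV. pd i S x * G x $ i) = (\<Sum>i\<in>UNIV. pd i S x * pd i \<phi> x)"
      using pd_missing[OF hS] by (intro sum.cong refl) (auto simp: G_def a_def)
    also have "\<dots> = 2 * hess_grad \<phi> x"
      by (simp add: pdS hess_grad_def sum_distrib_left sum_distrib_right pd_commute[OF \<phi>, of _] mult_ac)
    finally have SG: "(\<Sum>i\<in>UNIV. pd i S x * G x $ i) = 2 * hess_grad \<phi> x" .
    have "divergence \<nu> x = (\<Sum>i\<in>UNIV. (h' (S x) * pd i S x) * G x $ i) + h (S x) * lap \<phi> x"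
      unfolding \<nu>_def divergence_scaleR[OF hC GC] divG
      using pd_compose_real[OF SC hd[OF Sp]] by simp
    also have "(\<Sum>i\<in>UNIV. (h' (S x) * pd i S x) * G x $ i) = h' (S x) * (2 * hess_grad \<phi> x)"
      by (simp only: SG[symmetric] sum_distrib_left mult.assoc)
    also have "h' (S x) * (2 * hess_grad \<phi> x) + h (S x) * lap \<phi> x = mean_curv \<phi> x / (S x * sqrt (S x))"
      using Sp[of x] by (simp add: h'_def h_def mceq field_simps)
    also have "\<dots> < 0" using mc Sp[of x] by (intro divide_neg_pos mult_pos_pos) auto
    finally show "divergence \<nu> x < 0" .
  qed
qed

lemma norm_proj_split:
  "norm x \<le> norm (proj k x) + \<bar>x $ k\<bar>"
proof -
  have "x = proj k x + x $ k *\<^sub>R axis k 1"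
    by (auto simp: vec_eq_iff axis_def)
  then have "norm x \<le> norm (proj k x) + norm (x $ k *\<^sub>R axis k (1::real))"
    by (metis norm_triangle_ineq)
  then show ?thesis by simp
qed

lemma continuous_on_proj: "continuous_on A (proj k)"
  by (rule linear_continuous_on) (simp add: linear_proj linear_conv_bounded_linear[symmetric])

lemma proj_diff: "proj k (x - y) = proj k x - proj k y"
  by (auto simp: vec_eq_iff)

lemma proj_add: "proj k (x + y) = proj k x + proj k y"
  by (auto simp: vec_eq_iff)

lemma proj_proj [simp]: "proj k (proj k x) = proj k x"
  by (auto simp: vec_eq_iff)

lemma continuous_coord: "continuous_on A (\<lambda>x::real^'n. x $ i)"
  by (rule linear_continuous_on[OF bounded_linear_vec_nth])

text \<open>Vertical interpolation between the graph of \<open>m\<close> and the lid at height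
  \<open>M\<close> maps a convex cylinder onto the region.\<close>

lemma connected_over_graph:
  fixes k :: "'n::finite" and y0 :: "real^'n"
  assumes \<sigma>: "\<sigma> * \<sigma> = 1" and m: "continuous_on UNIV m" "\<And>x. m (proj k x) = m x"
    and M: "\<And>x. norm (proj k (x - y0)) < a \<Longrightarrow> m x < M"
  shows "connected {x. norm (proj k (x - y0)) < a \<and> m x < \<sigma> * x $ k \<and> \<sigma> * x $ k < M}"
proof -
  let ?U = "{x. norm (proj k (x - y0)) < a \<and> m x < \<sigma> * x $ k \<and> \<sigma> * x $ k < M}"
  let ?C = "{z::real^'n. norm (proj k z) < a \<and> 0 < z $ k \<and> z $ k < 1}"
  define \<Psi> where "\<Psi> = (\<lambda>z. proj k (y0 + z) + (\<sigma> * ((1 - z $ k) * m (y0 + z) + z $ k * M)) *\<^sub>R axis k 1)"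
  have "convex ?C"
  proof -
    have "?C = proj k -` ball 0 a \<inter> {z. axis k 1 \<bullet> z > 0} \<inter> {z. axis k 1 \<bullet> z < 1}"
      by (auto simp: inner_axis' dist_norm)
    then show ?thesis
      by (simp only:) (intro convex_Int convex_linear_vimage linear_proj convex_ball convex_halfspace_gt convex_halfspace_lt)
  qed
  then have "connected ?C" by (rule convex_connected)
  moreover have "continuous_on ?C \<Psi>"
    unfolding \<Psi>_def
    by (intro continuous_intros continuous_on_compose2[OF continuous_on_proj[of UNIV]]
        continuous_on_compose2[OF m(1)] continuous_coord) auto
  moreover have "\<Psi> ` ?C = ?U"
  proof (intro set_eqI iffI)
    fix x assume "x \<in> \<Psi> ` ?C"
    then obtain z where z: "norm (proj k z) < a" "0 < z $ k" "z $ k < 1" "x = \<Psi> z" by auto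
    have p: "proj k x = proj k (y0 + z)"
      unfolding z(4) \<Psi>_def by (auto simp: vec_eq_iff axis_def)
    have "m x = m (y0 + z)" using m(2)[of x] m(2)[of "y0 + z"] p by simp
    moreover have "proj k (x - y0) = proj k z" using p by (simp add: proj_diff proj_add)
    moreover have "\<sigma> * x $ k = \<sigma> * \<sigma> * ((1 - z $ k) * m (y0 + z) + z $ k * M)"
      unfolding z(4) \<Psi>_def by simp
    then have "\<sigma> * x $ k = (1 - z $ k) * m (y0 + z) + z $ k * M" by (simp only: \<sigma> mult_1)
    moreover have "m (y0 + z) < M" using M[of "y0 + z"] z(1) by simp
    then have "z $ k * (M - m (y0 + z)) > 0" "(1 - z $ k) * (M - m (y0 + z)) > 0" using z by auto
    ultimately show "x \<in> ?U" using z(1) by (simp add: algebra_simps)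
  next
    fix x assume x: "x \<in> ?U"
    define s where "s = (\<sigma> * x $ k - m x) / (M - m x)"
    define z where "z = proj k (x - y0) + s *\<^sub>R axis k 1"
    have d: "M - m x > 0" using x by auto
    have s: "0 < s" "s < 1" using x d by (auto simp: s_def)
    have z: "z $ k = s" "proj k z = proj k (x - y0)" by (auto simp: z_def vec_eq_iff axis_def)
    have pz: "proj k (y0 + z) = proj k x" by (simp add: proj_add z(2) proj_diff)
    have mz: "m (y0 + z) = m x" using m(2)[of "y0 + z"] m(2)[of x] by (simp add: pz)
    have "(1 - s) * m x + s * M = m x + s * (M - m x)" by (simp add: algebra_simps)
    also have "\<dots> = \<sigma> * x $ k" using d by (simp add: s_def)
    finally have "\<Psi> z = proj k x + (\<sigma> * \<sigma> * x $ k) *\<^sub>R axis k 1" by (simp add: \<Psi>_def pz mz z(1) mult.assoc)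
    also have "\<dots> = x" unfolding \<sigma> by (auto simp: vec_eq_iff axis_def)
    finally show "x \<in> \<Psi> ` ?C" using s x z by (intro image_eqI[of _ _ z]) auto
  qed
  ultimately show ?thesis using connected_continuous_image[of ?C \<Psi>] by simp
qed

text \<open>Suppose the mean curvature of the touching graph were negative at \<open>y0\<close>,
  hence nearby. The region \<open>U\<close> just beyond the barrier \<open>m\<close> misses the
  boundary, so up to a null set it belongs to \<open>E\<close> or to the complement. To that set one
  adds the lens \<open>K0\<close> between \<open>m\<close> and the graph of \<open>\<phi>\<close>
  shifted by \<open>t\<close>; \<open>calibrated_addition\<close> shows that the lens was already
  contained in it. Then a whole ball around \<open>y0\<close> is, up to a null set, contained in it,
  and \<open>y0\<close> is no boundary point. The strictness \<open>c > 0\<close> makes the lens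
  compact and small.\<close>

lemma touching:
  fixes k :: "'n::finite" and E :: "(real^'n) set"
  assumes E: "minimal_set E" and \<phi>: "hpoly k \<phi>" and \<sigma>: "\<sigma> * \<sigma> = 1"
    and y0: "y0 \<in> measure_boundary E" "norm y0 < 1" "\<phi> y0 = \<sigma> * y0 $ k"
    and c: "c > 0" and \<delta>: "\<delta> > 0"
    and touch: "\<And>x. x \<in> measure_boundary E \<Longrightarrow> norm (x - y0) < \<delta> \<Longrightarrow>
      \<sigma> * x $ k \<le> \<phi> x - c * (norm (proj k (x - y0)))\<^sup>2"
  shows "mean_curv \<phi> y0 \<ge> 0"
proof (rule ccontr)
  assume "\<not> mean_curv \<phi> y0 \<ge> 0"
  then have mc: "mean_curv \<phi> y0 < 0" by simp
  let ?B = "ball 0 1 :: (real^'n) set"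
  have a\<sigma>: "\<bar>\<sigma>\<bar> = 1" using \<sigma> abs_square_eq_1[of \<sigma>] by (simp add: power2_eq_square)
  have \<sigma>d: "\<bar>x $ k - z $ k\<bar> = \<bar>\<sigma> * x $ k - \<sigma> * z $ k\<bar>" for x z :: "real^'n"
    by (simp only: right_diff_distrib[symmetric] abs_mult a\<sigma> mult_1)
  have ec: "\<exists>d>0. \<forall>z. dist z y0 < d \<longrightarrow> dist (f z) (f y0) < e"
    if "continuous_on UNIV f" "e > 0" for f :: "real^'n \<Rightarrow> real" and e
    using that unfolding continuous_on_iff by simp
  have \<phi>P: "\<phi> x = \<phi> (y0 + proj k (x - y0))" for x
  proof -
    have "proj k (y0 + proj k (x - y0)) = proj k x" by (simp add: proj_add proj_diff)
    then show ?thesis using hpoly_proj[OF \<phi>] by metis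
  qed
  have small: "\<exists>a>0. a \<le> e \<and> (\<forall>x. norm (proj k (x - y0)) < a \<longrightarrow> \<bar>\<phi> x - \<phi> y0\<bar> < e)" if "e > 0" for e
  proof -
    obtain d where d: "d > 0" "\<And>z. dist z y0 < d \<Longrightarrow> dist (\<phi> z) (\<phi> y0) < e"
      using ec[OF hpoly_continuous[OF \<phi>] \<open>e > 0\<close>] by blast
    have "\<bar>\<phi> x - \<phi> y0\<bar> < e" if "norm (proj k (x - y0)) < min d e" for x
      using d(2)[of "y0 + proj k (x - y0)"] that \<phi>P[of x] by (simp add: dist_norm)
    then show ?thesis using d(1) \<open>e > 0\<close> by (intro exI[of _ "min d e"]) auto
  qed
  obtain \<rho>0 where \<rho>0: "\<rho>0 > 0" "\<And>x. dist x y0 < \<rho>0 \<Longrightarrow> mean_curv \<phi> x < 0"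
  proof -
    obtain d where "d > 0" "\<And>x. dist x y0 < d \<Longrightarrow> dist (mean_curv \<phi> x) (mean_curv \<phi> y0) < - mean_curv \<phi> y0"
      using ec[OF continuous_mean_curv[OF \<phi>], of "- mean_curv \<phi> y0"] mc by auto
    moreover have "mean_curv \<phi> x < 0" if "dist (mean_curv \<phi> x) (mean_curv \<phi> y0) < - mean_curv \<phi> y0" for x
      using that by (simp add: dist_real_def)
    ultimately show thesis using that by blast
  qed
  define \<rho> where "\<rho> = min \<delta> (min (1 - norm y0) \<rho>0)"
  have \<rho>: "\<rho> > 0" "\<rho> \<le> \<delta>" "\<rho> \<le> \<rho>0" "\<rho> \<le> 1 - norm y0" using \<delta> y0 \<rho>0 by (auto simp: \<rho>_def)
  have ballB: "ball y0 \<rho> \<subseteq> ?B"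
  proof
    fix x assume "x \<in> ball y0 \<rho>"
    then show "x \<in> ?B" using \<rho>(4) norm_triangle_ineq2[of x y0] by (simp add: dist_norm norm_minus_commute)
  qed
  define H where "H = \<rho> / 4"
  have H: "H > 0" using \<rho> by (simp add: H_def)
  obtain a1 where a1: "a1 > 0" "a1 \<le> H/2" "\<And>x. norm (proj k (x - y0)) < a1 \<Longrightarrow> \<bar>\<phi> x - \<phi> y0\<bar> < H / 2"
    using small[of "H/2"] H by auto
  \<comment> \<open>Over the disc of radius \<open>a\<close> neither \<open>\<phi>\<close> nor the
    quadratic term moves by more than \<open>H / 2\<close>; as \<open>H\<close> is a quarter of
    \<open>\<rho>\<close>, the region \<open>U\<close> stays within distance \<open>\<rho>\<close>
    of \<open>y0\<close>.\<close>
  define a where "a = min a1 (sqrt (H / (2 * c)))"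
  have a: "a > 0" "a \<le> H / 2" using a1 H c by (auto simp: a_def)
  have a\<phi>: "\<bar>\<phi> x - \<phi> y0\<bar> < H / 2" if "norm (proj k (x - y0)) < a" for x
    using a1(3)[of x] that by (simp add: a_def)
  have ac: "c * (norm (proj k (x - y0)))\<^sup>2 \<le> H / 2" if "norm (proj k (x - y0)) < a" for x
  proof -
    have "norm (proj k (x - y0)) \<le> sqrt (H / (2 * c))" using that by (simp add: a_def)
    then have "(norm (proj k (x - y0)))\<^sup>2 \<le> H / (2 * c)"
      using H c by (metis norm_ge_zero power_mono real_sqrt_pow2 less_imp_le divide_pos_pos mult_pos_pos zero_less_numeral)
    then show ?thesis using c by (simp add: field_simps)
  qed
  define m where "m = (\<lambda>x. \<phi> x - c * (norm (proj k (x - y0)))\<^sup>2)"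
  define U where "U = {x. norm (proj k (x - y0)) < a \<and> m x < \<sigma> * x $ k \<and> \<sigma> * x $ k < \<phi> y0 + H}"
  have mc': "continuous_on UNIV m"
    unfolding m_def
    by (intro continuous_intros hpoly_continuous[OF \<phi>] continuous_on_compose2[OF continuous_on_proj[of UNIV]]) auto
  have mlt: "m x < \<phi> y0 + H / 2" if "norm (proj k (x - y0)) < a" for x
  proof -
    have "m x \<le> \<phi> x" using c by (simp add: m_def)
    then show ?thesis using a\<phi>[OF that] by linarith
  qed
  have U: "connected U"
    unfolding U_def
  proof (rule connected_over_graph[OF \<sigma> mc'])
    fix x show "m (proj k x) = m x" using hpoly_proj[OF \<phi>] by (simp add: m_def proj_diff)
    show "m x < \<phi> y0 + H" if "norm (proj k (x - y0)) < a"
      using mlt[OF that] H by simp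
  qed
  have "open U"
    unfolding U_def
    by (intro open_Collect_conj open_Collect_less continuous_intros mc' continuous_coord
        continuous_on_compose2[OF continuous_on_proj[of UNIV]]) auto
  have Uball: "U \<subseteq> ball y0 \<rho>"
  proof
    fix x assume x: "x \<in> U"
    then have xa: "norm (proj k (x - y0)) < a" by (simp add: U_def)
    have "\<phi> x - c * (norm (proj k (x - y0)))\<^sup>2 < \<sigma> * x $ k" "\<sigma> * x $ k < \<phi> y0 + H"
      using x by (auto simp: U_def m_def)
    then have "\<bar>\<sigma> * x $ k - \<sigma> * y0 $ k\<bar> \<le> H"
      using a\<phi>[OF xa] ac[OF xa] unfolding y0(3)[symmetric] abs_le_iff abs_less_iff by linarith
    then have "norm (x - y0) < \<rho>"
      using norm_proj_split[of "x - y0" k] \<sigma>d[of x y0] xa a H by (simp add: H_def)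
    then show "x \<in> ball y0 \<rho>" by (simp add: dist_norm norm_minus_commute)
  qed
  have Umb: "U \<inter> measure_boundary E = {}"
  proof (rule ccontr)
    assume "U \<inter> measure_boundary E \<noteq> {}"
    then obtain x where x: "x \<in> U" "x \<in> measure_boundary E" by blast
    have "norm (x - y0) < \<delta>" using Uball x(1) \<rho>(2) by (auto simp: dist_norm norm_minus_commute)
    then show False using touch[OF x(2)] x(1) by (auto simp: U_def m_def)
  qed
  obtain \<nu> :: "real^'n \<Rightarrow> real^'n" where \<nu>: "C1 \<nu>" "\<And>x. norm (\<nu> x) \<le> 1"
    "\<And>x h. norm h \<le> 1 \<Longrightarrow> (\<Sum>i\<in>UNIV. pd i (\<lambda>x. \<phi> x - \<sigma> * x $ k) x * (\<nu> x $ i - h $ i)) \<ge> 0"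
    "\<And>x. mean_curv \<phi> x < 0 \<Longrightarrow> divergence \<nu> x < 0"
    using graph_normal[OF \<phi> \<sigma>] by blast
  define \<Phi> where "\<Phi> = (\<lambda>x. \<phi> x - \<sigma> * x $ k)"
  have \<Phi>C: "C1 \<Phi>" unfolding \<Phi>_def by (intro C1_diff C1_hpoly[OF \<phi>] C1_mult C1_const C1_coord)
  define \<rho>2 where "\<rho>2 = a / 2"
  define \<rho>1 where "\<rho>1 = a / 4"
  have \<rho>12: "0 < \<rho>1" "\<rho>1 < \<rho>2" using a by (auto simp: \<rho>1_def \<rho>2_def)
  obtain b where b: "b > 0" "b \<le> \<rho>1 / 4" "\<And>x. norm (proj k (x - y0)) < b \<Longrightarrow> \<bar>\<phi> x - \<phi> y0\<bar> < \<rho>1 / 4"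
    using small[of "\<rho>1/4"] \<rho>12 by auto
  \<comment> \<open>\<open>t < c * b\<^sup>2\<close> confines the lens to horizontal distance less
    than \<open>b\<close>, where \<open>\<phi>\<close> is nearly constant, and
    \<open>t \<le> \<rho>1 / 4\<close> limits its height.\<close>
  define t where "t = min (c * b\<^sup>2 / 2) (\<rho>1 / 4)"
  have t: "t > 0" "t < c * b\<^sup>2" "t \<le> \<rho>1 / 4" using b c \<rho>12 by (auto simp: t_def min_def)
  define K0 where "K0 = {x. c * (norm (proj k (x - y0)))\<^sup>2 \<le> t \<and> \<phi> x - t \<le> \<sigma> * x $ k \<and> \<sigma> * x $ k \<le> m x}"
  have K0ball: "K0 \<subseteq> ball y0 \<rho>1"
  proof
    fix x assume x: "x \<in> K0"
    have "c * (norm (proj k (x - y0)))\<^sup>2 < c * b\<^sup>2" using x t(2) by (simp add: K0_def)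
    then have xb: "norm (proj k (x - y0)) < b" using b(1) c by (simp add: power_less_imp_less_base)
    have "m x \<le> \<phi> x" using c by (simp add: m_def)
    moreover have "\<phi> x - t \<le> \<sigma> * x $ k" "\<sigma> * x $ k \<le> m x" using x by (auto simp: K0_def)
    ultimately have "\<bar>\<sigma> * x $ k - \<sigma> * y0 $ k\<bar> \<le> \<rho>1 / 4 + \<rho>1 / 4"
      using b(3)[OF xb] t(3) unfolding y0(3)[symmetric] abs_le_iff abs_less_iff by linarith
    then have "norm (x - y0) < \<rho>1"
      using norm_proj_split[of "x - y0" k] \<sigma>d[of x y0] xb b by simp
    then show "x \<in> ball y0 \<rho>1" by (simp add: dist_norm norm_minus_commute)
  qed
  have "closed K0"
    unfolding K0_def
    by (intro closed_Collect_conj closed_Collect_le continuous_intros mc' continuous_coord hpoly_continuous[OF \<phi>]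
        continuous_on_compose2[OF continuous_on_proj[of UNIV]]) auto
  moreover have "bounded K0" using K0ball bounded_ball bounded_subset by blast
  ultimately have K0c: "compact K0" by (simp add: compact_eq_bounded_closed)
  have ball2: "cball y0 \<rho>2 \<subseteq> {x. norm (proj k (x - y0)) < a \<and> \<sigma> * x $ k < \<phi> y0 + H}"
  proof
    fix x assume "x \<in> cball y0 \<rho>2"
    then have n: "norm (x - y0) \<le> a / 2" by (simp add: \<rho>2_def dist_norm norm_minus_commute)
    have "norm (proj k (x - y0)) < a" using norm_proj_le[of k "x - y0"] n a by linarith
    moreover have "\<bar>\<sigma> * x $ k - \<sigma> * y0 $ k\<bar> \<le> a / 2"
      using component_le_norm_cart[of "x - y0" k] n \<sigma>d[of x y0] by simp
    moreover from this have "\<sigma> * x $ k < \<phi> y0 + H"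
      using a H unfolding y0(3)[symmetric] abs_le_iff by linarith
    ultimately show "x \<in> {x. norm (proj k (x - y0)) < a \<and> \<sigma> * x $ k < \<phi> y0 + H}"
      by simp
  qed
  have cover: "x \<in> K0 \<union> U" if "x \<in> cball y0 \<rho>2" "\<Phi> x \<le> t" for x
    using ball2 that unfolding K0_def U_def \<Phi>_def m_def by auto
  have cball2: "cball y0 \<rho>2 \<subseteq> ball y0 \<rho>" using a H by (auto simp: \<rho>2_def H_def)
  \<comment> \<open>Stated for a general set because it is applied to \<open>E\<close> or to its
    complement, whichever contains \<open>U\<close> up to a null set; the graph and \<sigma> are the
    same in both cases.\<close>
  have main: False if E': "minimal_set E'" "y0 \<in> measure_boundary E'" "negligible (U - E')" for E'
  proof -
    have El: "E' \<in> sets lebesgue" using E' by (simp add: minimal_set_def)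
    have "negligible (K0 - E')"
    proof (rule calibrated_addition[OF E'(1) \<Phi>C \<nu>(1,2) _ K0c K0ball _ \<rho>12])
      show "\<And>x h. norm h \<le> 1 \<Longrightarrow> 0 \<le> (\<Sum>i\<in>UNIV. pd i \<Phi> x * (\<nu> x $ i - h $ i))"
        using \<nu>(3) unfolding \<Phi>_def .
      show "K0 \<subseteq> {x. \<Phi> x \<le> t}" by (auto simp: K0_def \<Phi>_def)
      show "cball y0 \<rho>2 \<subseteq> ?B" using cball2 ballB by blast
      show "negligible ({x \<in> cball y0 \<rho>2. \<Phi> x \<le> t} - (E' \<union> K0))"
        by (rule negligible_subset[OF E'(3)]) (use cover in blast)
      fix x assume "x \<in> K0"
      then have "x \<in> cball y0 \<rho>2" using K0ball \<rho>12 by fastforce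
      then have "x \<in> ball y0 \<rho>" using cball2 by blast
      then have "dist x y0 < \<rho>" by (simp add: dist_commute)
      then have "dist x y0 < \<rho>0" using \<rho>(3) by linarith
      then show "divergence \<nu> x < 0" using \<rho>0(2) \<nu>(4) by blast
    qed
    have "open {x. \<Phi> x < t}"
      by (intro open_Collect_less C1_continuous[OF \<Phi>C] continuous_intros)
    moreover have "y0 \<in> {x. \<Phi> x < t}" using y0(3) t by (simp add: \<Phi>_def)
    ultimately obtain s where s: "s > 0" "ball y0 s \<subseteq> {x. \<Phi> x < t}" using open_contains_ball by blast
    have "ball y0 (min s \<rho>2) - E' \<subseteq> (K0 - E') \<union> (U - E')"
      using s(2) cover by (auto simp: subset_iff less_imp_le)
    then have "negligible (ball y0 (min s \<rho>2) - E')"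
      by (rule negligible_subset[OF negligible_Un[OF \<open>negligible (K0 - E')\<close> E'(3)]])
    moreover have "min s \<rho>2 > 0" using s \<rho>12 by simp
    ultimately show False using E'(2) measure_boundary_iff[OF El] by blast
  qed
  have El: "E \<in> sets lebesgue" using E by (simp add: minimal_set_def)
  have y0B: "y0 \<in> ?B" using y0 by simp
  from connected_avoiding_boundary[OF El \<open>open U\<close> U Umb] show False
  proof
    assume "negligible (U - E)"
    then show False using main[OF E y0(1)] by blast
  next
    assume "negligible (U \<inter> E)"
    moreover have "U - (?B - E) = U \<inter> E" using Uball ballB by blast
    ultimately show False
      using main[OF minimal_complement[OF E]] measure_boundary_complement[OF El y0B] y0(1) by simp
  qed
qed

section \<open>Approximation of the boundary by a harmonic graph\<close>

lemma hpoly_gradient_local_max: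
  assumes f: "hpoly k f" and "\<delta> > 0" and max: "\<And>s. \<bar>s\<bar> < \<delta> \<Longrightarrow> f (x + s *\<^sub>R axis i 1) \<le> f x"
  shows "pd i f x = 0"
proof -
  have "(\<Sum>j\<in>UNIV. axis i (1::real) $ j * pd j f (x + 0 *\<^sub>R axis i 1)) = 0"
    by (rule DERIV_local_max[OF has_derivative_line[OF f] \<open>\<delta> > 0\<close>]) (use max in auto)
  then show ?thesis by (simp add: axis_def if_distrib if_distribR cong: if_cong)
qed

lemma pd_pd_projsq: "pd j (pd i (projsq k)) x = (if i = j \<and> i \<noteq> k then 2 else 0)"
proof (cases "i = k")
  case False
  then have "pd i (projsq k) = (\<lambda>x. 2 * x $ i)" by (simp add: pd_projsq)
  then show ?thesis using pd_scale[OF hpoly.coord[OF False], of j 2] False by auto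
qed (simp add: pd_projsq)

text \<open>At a first contact of the sup-convolution of the boundary with the graph of a supersolution \<open>V\<close>, the
  paraboloids of opening \<open>\<epsilon> A\<close> used in the sup-convolution bound \<open>V\<close>'s gradient and its
  Hessian from below, so that the nonlinear terms of the mean curvature operator are negligible
  without any a priori derivative estimate for \<open>v\<close>.\<close>

lemma sup_convolution_comparison:
  fixes k :: "'n::finite" and E :: "(real^'n) set"
  assumes n: "CARD('n) \<ge> 2" and E: "minimal_set E" and \<epsilon>: "0 < \<epsilon>" "\<epsilon> \<le> 1/32"
    and flat: "measure_boundary E \<inter> ball 0 1 \<subseteq> {x. \<bar>x $ k\<bar> \<le> \<epsilon>}"
    and v: "hpoly k v" "lap v = (\<lambda>x. 0)" and \<sigma>: "\<sigma> * \<sigma> = 1"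
    and A: "768 \<le> A" and b: "0 \<le> b" and \<kappa>: "24 * \<epsilon> ^ 3 * A\<^sup>2 < \<kappa>"
    and K: "K = measure_boundary E \<inter> cball 0 (3/8)"
    and lower: "\<And>x. x \<in> disc k (1/4) \<Longrightarrow> - 2 * \<epsilon> \<le> \<sigma> * v x"
    and bd: "\<And>x y. x $ k = 0 \<Longrightarrow> norm x = 1/4 \<Longrightarrow> y \<in> K \<Longrightarrow>
      \<sigma> * y $ k - \<epsilon> * A * (norm (x - proj k y))\<^sup>2 \<le> \<sigma> * v x + b"
    and x: "x \<in> disc k (1/4)" and y: "y \<in> K"
  shows "\<sigma> * y $ k - \<epsilon> * A * (norm (x - proj k y))\<^sup>2 \<le> \<sigma> * v x + b + \<kappa> / 16"
proof -
  define R where "R = (1/4::real)"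
  define d where "d = real (CARD('n) - 1)"
  have d: "d \<ge> 1" using n by (simp add: d_def)
  have a\<sigma>: "\<bar>\<sigma>\<bar> = 1" using \<sigma> abs_square_eq_1[of \<sigma>] by (simp add: power2_eq_square)
  have El: "E \<in> sets lebesgue" using E by (simp add: minimal_set_def)
  have \<kappa>0: "\<kappa> > 0" using \<kappa> \<epsilon> A by (smt (verit) mult_nonneg_nonneg zero_le_power zero_le_power2)
  \<comment> \<open>The added term makes \<open>V\<close> strictly superharmonic without changing
    its values on the sphere of radius \<open>R\<close>; it costs at most \<kappa> R^2 = \<kappa> /
    16 in the final bound.\<close>
  define V where "V = (\<lambda>x. \<sigma> * v x + \<kappa> * (R\<^sup>2 - projsq k x))"
  have hV: "hpoly k V" unfolding V_def by (intro hpoly_intros v hpoly_projsq)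
  have pdV: "pd j (pd i V) x = \<sigma> * pd j (pd i v) x - \<kappa> * (if i = j \<and> i \<noteq> k then 2 else 0)" for i j x
  proof -
    have "pd i V = (\<lambda>x. \<sigma> * pd i v x + \<kappa> * (0 - pd i (projsq k) x))" for i
      unfolding V_def
      by (simp add: pd_add[of k] pd_scale[of k] pd_diff[of k] hpoly_intros v hpoly_projsq)
    then show ?thesis
      by (simp add: pd_add[of k] pd_diff[of k] pd_uminus[of k] pd_scale[of k] hpoly_intros v hpoly_projsq hpoly_pd pd_pd_projsq)
  qed
  have lapV: "lap V x = - 2 * d * \<kappa>" for x
  proof -
    have "lap V x = \<sigma> * lap v x - \<kappa> * lap (projsq k) x"
      unfolding lap_def pdV pd_pd_projsq by (simp add: sum_subtractf sum_distrib_left)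
    then show ?thesis by (simp only: v lap_projsq d_def) (simp add: algebra_simps)
  qed
  have Kb: "\<bar>y $ k\<bar> \<le> \<epsilon>" "norm y \<le> 3/8" "y \<in> measure_boundary E" if "y \<in> K" for y
    using that flat unfolding K by auto
  have Kc: "compact K"
    unfolding K using closed_measure_boundary[OF El] by (simp add: closed_Int_compact)
  \<comment> \<open>Doubling of variables: a joint maximum yields derivative information on
    \<open>V\<close> at \<open>x0\<close> and a one-sided contact with the boundary at
    \<open>y0\<close> at the same time.\<close>
  define f where "f = (\<lambda>(x, y). \<sigma> * y $ k - \<epsilon> * A * (norm (x - proj k y))\<^sup>2 - V x)"
  have "continuous_on (disc k R \<times> K) f"
    unfolding f_def case_prod_unfold
    by (intro continuous_intros continuous_on_compose2[OF continuous_on_proj[of UNIV]]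
        continuous_on_compose2[OF hpoly_continuous[OF hV, of UNIV]] continuous_on_compose2[OF continuous_coord[of UNIV]]) auto
  moreover have "compact (disc k R \<times> K)" by (intro compact_Times compact_disc Kc)
  moreover have "disc k R \<times> K \<noteq> {}" using x y by (auto simp: R_def)
  ultimately obtain z where z: "z \<in> disc k R \<times> K" "\<And>z'. z' \<in> disc k R \<times> K \<Longrightarrow> f z' \<le> f z"
    using continuous_attains_sup[of "disc k R \<times> K" f] by blast
  obtain x0 y0 where z_eq: "z = (x0, y0)" by (cases z)
  have x0: "x0 $ k = 0" "norm x0 \<le> R" and y0: "y0 \<in> K" using z(1) by (auto simp: z_eq)
  have max: "f (x, y) \<le> f (x0, y0)" if "x \<in> disc k R" "y \<in> K" for x y
    using z(2)[of "(x, y)"] that by (simp add: z_eq)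
  have "f (x0, y0) \<le> b"
  proof (rule ccontr)
    assume "\<not> f (x0, y0) \<le> b"
    then have big: "f (x0, y0) > b" by simp
    have "norm x0 \<noteq> R"
    proof
      assume "norm x0 = R"
      then have "V x0 = \<sigma> * v x0" by (simp add: V_def projsq_eq proj_disc[OF x0(1)])
      then have "f (x0, y0) \<le> b"
        using bd[OF x0(1) _ y0] \<open>norm x0 = R\<close> by (simp add: f_def R_def)
      then show False using big by simp
    qed
    then have x0R: "norm x0 < R" using x0 by simp
    define D where "D = norm (x0 - proj k y0)"
    have "(norm x0)\<^sup>2 \<le> R\<^sup>2" using x0(2) by (intro power_mono) auto
    then have "0 \<le> \<kappa> * (R\<^sup>2 - (norm x0)\<^sup>2)" using \<kappa>0 by simp
    moreover have "- 2 * \<epsilon> \<le> \<sigma> * v x0" using lower[of x0] x0 by (simp add: R_def)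
    ultimately have "V x0 \<ge> - 2 * \<epsilon>"
      unfolding V_def projsq_eq proj_disc[OF x0(1)] by linarith
    then have "\<epsilon> * A * D\<^sup>2 < \<sigma> * y0 $ k + 2 * \<epsilon>" using big b by (simp add: f_def D_def)
    also have "\<sigma> * y0 $ k \<le> \<epsilon>"
      using abs_le_D1[of "\<sigma> * y0 $ k" \<epsilon>] Kb(1)[OF y0] a\<sigma> by (simp add: abs_mult)
    finally have "\<epsilon> * (A * D\<^sup>2) < \<epsilon> * 3" by (simp add: mult.assoc)
    then have AD: "A * D\<^sup>2 < 3" using \<epsilon>(1) by simp
    \<comment> \<open>768 = 3 * 16^2, so A D^2 < 3 gives D < 1/16. Then the norm of
      \<open>y0\<close> is below 1/4 + 1/16 + 1/32 < 3/8, and boundary points close to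
      \<open>y0\<close> belong to \<open>K\<close> too.\<close>
    have "768 * D\<^sup>2 \<le> A * D\<^sup>2" using A by (intro mult_right_mono) auto
    then have "D\<^sup>2 < (1/16)\<^sup>2" using AD by (simp add: power2_eq_square)
    then have D16: "D < 1/16" by (rule power_less_imp_less_base) simp
    have "norm (proj k y0) \<le> norm x0 + D"
      unfolding D_def by (metis add.commute diff_add_cancel norm_minus_commute norm_triangle_ineq)
    then have y0n: "norm y0 < 3/8"
      using norm_proj_split[of y0 k] Kb(1)[OF y0] \<epsilon> D16 x0R by (simp add: R_def)
    \<comment> \<open>The shift has a vertical component, which is harmless because \<open>V\<close>
      ignores the coordinate \<open>k\<close>.\<close>
    define w where "w = x0 - y0"
    define p where "p = (\<chi> i. pd i V x0)"
    \<comment> \<open>Up to a constant this is \<open>f\<close> with \<open>y0\<close> fixed.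
      Maximality at \<open>x0\<close> in horizontal directions determines the gradient
      \<open>p\<close> of \<open>V\<close> and bounds its Hessian from below in the direction
      \<open>p\<close>, the only direction that \<open>hess_grad\<close> sees.\<close>
    define W where "W = (\<lambda>x. - V x - \<epsilon> * A * projsq k (x + (- y0)))"
    have hW: "hpoly k W" unfolding W_def by (intro hpoly_intros hV hpoly_shift hpoly_projsq)
    have pdW1: "pd i W = (\<lambda>x. - pd i V x - \<epsilon> * A * pd i (projsq k) (x + (- y0)))" for i
      unfolding W_def
      by (simp add: pd_diff[of k] pd_uminus[of k] pd_scale[of k] hpoly_intros hV hpoly_shift hpoly_projsq
          pd_shift[of k "projsq k"] del: add_uminus_conv_diff)
    have pdW2: "pd j (pd i W) x = - pd j (pd i V) x - \<epsilon> * A * (if i = j \<and> i \<noteq> k then 2 else 0)" for i j x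
      unfolding pdW1
      by (simp add: pd_diff[of k] pd_uminus[of k] pd_scale[of k] hpoly_intros hV hpoly_shift hpoly_projsq hpoly_pd
          pd_shift[of k] pd_pd_projsq del: add_uminus_conv_diff)
    have Wmax: "W (x0 + s *\<^sub>R u) \<le> W x0" if "u $ k = 0" "\<bar>s\<bar> < (R - norm x0) / (norm u + 1)" for s u
    proof -
      have "\<bar>s\<bar> * norm u \<le> \<bar>s\<bar> * (norm u + 1)" by (intro mult_left_mono) auto
      also have "\<dots> < R - norm x0" using that(2) by (simp add: pos_less_divide_eq add_nonneg_pos)
      finally have "norm (x0 + s *\<^sub>R u) \<le> R"
        using norm_triangle_ineq[of x0 "s *\<^sub>R u"] by simp
      then have xs: "x0 + s *\<^sub>R u \<in> disc k R" using x0 that by simp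
      have pr: "norm (proj k (x + (- y0))) = norm (x - proj k y0)" if "x $ k = 0" for x
        using that by (simp add: proj_diff proj_disc)
      show ?thesis
        using max[OF xs y0] pr[of "x0 + s *\<^sub>R u"] pr[OF x0(1)] xs
        by (simp add: W_def f_def projsq_eq del: add_uminus_conv_diff)
    qed
    have dpos: "(R - norm x0) / (norm u + 1) > 0" for u :: "real^'n" using x0R by (simp add: add_nonneg_pos)
    have pk: "p $ k = 0" using pd_missing[OF hV] by (simp add: p_def)
    have grad: "p $ i = - 2 * \<epsilon> * A * (x0 - proj k y0) $ i" for i
    proof (cases "i = k")
      case True
      then show ?thesis using pk x0 by simp
    next
      case False
      have "pd i W x0 = 0"
        by (rule hpoly_gradient_local_max[OF hW dpos Wmax]) (use False in \<open>auto simp: axis_def\<close>)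
      then show ?thesis using False by (simp add: pdW1 pd_projsq p_def algebra_simps)
    qed
    have "p = (- 2 * \<epsilon> * A) *\<^sub>R (x0 - proj k y0)"
      unfolding vec_eq_iff using grad by (simp only: vector_scaleR_component) simp
    then have "norm p = 2 * \<epsilon> * A * D" using \<epsilon> A by (simp add: D_def)
    then have "(norm p)\<^sup>2 = 4 * \<epsilon>\<^sup>2 * A * (A * D\<^sup>2)" by (simp add: power2_eq_square)
    also have "\<dots> \<le> 4 * \<epsilon>\<^sup>2 * A * 3" using AD A by (intro mult_left_mono) auto
    finally have p2: "(norm p)\<^sup>2 \<le> 12 * \<epsilon>\<^sup>2 * A" by simp
    have psum: "(\<Sum>i\<in>UNIV. p $ i * p $ i) = (norm p)\<^sup>2"
      by (simp add: power2_norm_eq_inner inner_vec_def)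
    have psum2: "(\<Sum>i\<in>UNIV. \<Sum>j\<in>UNIV. p $ i * p $ j * (if i = j \<and> i \<noteq> k then 2 else 0)) = 2 * (norm p)\<^sup>2"
    proof -
      have "(\<Sum>j\<in>UNIV. p $ i * p $ j * (if i = j \<and> i \<noteq> k then 2 else 0)) = 2 * (p $ i * p $ i)" for i
        using pk by (cases "i = k") (simp_all add: if_distrib cong: if_cong)
      then show ?thesis by (simp add: sum_distrib_left[symmetric] psum)
    qed
    have "(\<Sum>i\<in>UNIV. \<Sum>j\<in>UNIV. p $ i * p $ j * pd j (pd i W) x0) \<le> 0"
      by (rule hpoly_second_derivative_local_max[OF hW dpos Wmax]) (use pk in auto)
    then have hessV: "(\<Sum>i\<in>UNIV. \<Sum>j\<in>UNIV. p $ i * p $ j * pd j (pd i V) x0) \<ge> - (2 * \<epsilon> * A * (norm p)\<^sup>2)"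
    proof -
      assume le: "(\<Sum>i\<in>UNIV. \<Sum>j\<in>UNIV. p $ i * p $ j * pd j (pd i W) x0) \<le> 0"
      have "(\<Sum>i\<in>UNIV. \<Sum>j\<in>UNIV. p $ i * p $ j * pd j (pd i W) x0)
         = - (\<Sum>i\<in>UNIV. \<Sum>j\<in>UNIV. p $ i * p $ j * pd j (pd i V) x0)
           - \<epsilon> * A * (\<Sum>i\<in>UNIV. \<Sum>j\<in>UNIV. p $ i * p $ j * (if i = j \<and> i \<noteq> k then 2 else 0))"
        unfolding pdW2 by (simp add: right_diff_distrib sum_subtractf sum_negf sum_distrib_left mult_ac)
      then show ?thesis using le unfolding psum2 by simp
    qed
    \<comment> \<open>Half of \<kappa> pays for the strict contact that \<open>touching\<close>
      demands; the other half keeps the Laplacian negative. In \<open>\<phi>\<close> the points x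
      and y move together, so the parabola in \<open>f\<close> stays fixed and maximality becomes
      contact of a translate of \<open>V\<close> with the boundary.\<close>
    define \<kappa>' where "\<kappa>' = \<kappa> / 2"
    define \<phi> where "\<phi> = (\<lambda>y. V (y + w) + (\<sigma> * y0 $ k - V x0) + \<kappa>' * projsq k (y + (- y0)))"
    have h\<phi>: "hpoly k \<phi>" unfolding \<phi>_def by (intro hpoly_intros hpoly_shift hV hpoly_projsq)
    have pd\<phi>1: "pd i \<phi> = (\<lambda>y. pd i V (y + w) + \<kappa>' * pd i (projsq k) (y + (- y0)))" for i
      unfolding \<phi>_def
      by (simp add: pd_add[of k] pd_scale[of k] hpoly_intros hV hpoly_shift hpoly_projsq pd_shift[of k]
          del: add_uminus_conv_diff)
    have pd\<phi>2: "pd j (pd i \<phi>) y = pd j (pd i V) (y + w) + \<kappa>' * (if i = j \<and> i \<noteq> k then 2 else 0)" for i j y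
      unfolding pd\<phi>1
      by (simp add: pd_add[of k] pd_scale[of k] hpoly_intros hV hpoly_shift hpoly_projsq hpoly_pd pd_shift[of k] pd_pd_projsq
          del: add_uminus_conv_diff)
    have yw: "y0 + w = x0" by (simp add: w_def)
    have g\<phi>: "pd i \<phi> y0 = p $ i" for i by (simp add: pd\<phi>1 yw pd_projsq p_def)
    have lap\<phi>: "lap \<phi> y0 = - d * \<kappa>"
    proof -
      have "lap \<phi> y0 = lap V x0 + \<kappa>' * lap (projsq k) y0"
        unfolding lap_def pd\<phi>2 yw pd_pd_projsq by (simp add: sum.distrib sum_distrib_left)
      then show ?thesis by (simp only: lapV lap_projsq d_def \<kappa>'_def) (simp add: field_simps)
    qed
    have "hess_grad \<phi> y0 = (\<Sum>i\<in>UNIV. \<Sum>j\<in>UNIV. p $ i * p $ j * pd j (pd i V) x0)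
        + \<kappa>' * (\<Sum>i\<in>UNIV. \<Sum>j\<in>UNIV. p $ i * p $ j * (if i = j \<and> i \<noteq> k then 2 else 0))"
      unfolding hess_grad_def g\<phi> pd\<phi>2 yw by (simp add: distrib_left sum.distrib sum_distrib_left mult_ac)
    then have hess: "hess_grad \<phi> y0 \<ge> - (2 * \<epsilon> * A * (norm p)\<^sup>2)"
      using hessV \<kappa>0 unfolding psum2 by (simp add: add_increasing2 \<kappa>'_def)
    have "2 * \<epsilon> * A * (norm p)\<^sup>2 \<le> 2 * \<epsilon> * A * (12 * \<epsilon>\<^sup>2 * A)" using p2 \<epsilon> A by (intro mult_left_mono) auto
    also have "\<dots> = 24 * \<epsilon> ^ 3 * A\<^sup>2" by (simp add: power2_eq_square power3_eq_cube)
    also have "\<dots> < \<kappa>" by (rule \<kappa>)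
    finally have small: "2 * \<epsilon> * A * (norm p)\<^sup>2 < \<kappa>" .
    have "(1 + grad2 \<phi> y0) * (d * \<kappa>) \<ge> 1 * (1 * \<kappa>)"
      using \<kappa>0 d by (intro mult_mono) (auto simp: grad2_def sum_nonneg)
    then have "mean_curv \<phi> y0 < 0"
      using hess small by (simp add: mean_curv_def lap\<phi>)
    moreover have "mean_curv \<phi> y0 \<ge> 0"
    proof (rule touching[OF E h\<phi> \<sigma> Kb(3)[OF y0], where c = "\<kappa>'" and \<delta> = "min (R - norm x0) (3/8 - norm y0)"])
      show "norm y0 < 1" using y0n by simp
      show "\<phi> y0 = \<sigma> * y0 $ k" by (simp add: \<phi>_def yw projsq_def)
      show "\<kappa>' > 0" "min (R - norm x0) (3/8 - norm y0) > 0" using \<kappa>0 x0R y0n by (auto simp: \<kappa>'_def)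
      fix y assume y: "y \<in> measure_boundary E" "norm (y - y0) < min (R - norm x0) (3/8 - norm y0)"
      then have yK: "y \<in> K" using norm_triangle_ineq2[of y y0] by (simp add: K)
      let ?x = "proj k (y + w)"
      have x_eq: "?x = x0 + proj k (y - y0)"
        using proj_disc[OF x0(1)] by (simp add: w_def proj_add proj_diff)
      have "norm ?x \<le> norm x0 + norm (y - y0)"
        unfolding x_eq using norm_triangle_ineq[of x0 "proj k (y - y0)"] norm_proj_le[of k "y - y0"] by linarith
      then have xd: "?x \<in> disc k R" using y(2) by simp
      have "?x - proj k y = x0 - proj k y0" by (simp add: x_eq proj_diff)
      then have "\<sigma> * y $ k - V ?x \<le> \<sigma> * y0 $ k - V x0"
        using max[OF xd yK] by (simp add: f_def)
      moreover have "V ?x = V (y + w)" by (rule hpoly_proj[OF hV])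
      ultimately show "\<sigma> * y $ k \<le> \<phi> y - \<kappa>' * (norm (proj k (y - y0)))\<^sup>2"
        by (simp add: \<phi>_def projsq_eq)
    qed
    ultimately show False by simp
  qed
  then have "f (x, y) \<le> b" using max[of x y] x y by (simp add: R_def)
  moreover have "V x \<le> \<sigma> * v x + \<kappa> * R\<^sup>2" using \<kappa>0 by (simp add: V_def projsq_eq)
  ultimately show ?thesis by (simp add: f_def R_def power2_eq_square)
qed

text \<open>The witness is the sup-convolution of \<open>K\<close> truncated at \<open>- \<epsilon>\<close>: the set \<open>K\<close> need not project
  onto a neighbourhood of the disc, so the sup-convolution alone can be too small.\<close>

lemma sup_inf_convolution_separation:
  fixes k :: "'n::finite" and K :: "(real^'n) set"
  assumes K: "K \<noteq> {}" and Kb: "\<And>y. y \<in> K \<Longrightarrow> \<bar>y $ k\<bar> \<le> \<epsilon>" "\<And>y. y \<in> K \<Longrightarrow> norm y \<le> 1"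
    and \<epsilon>: "\<epsilon> > 0" and o: "0 \<le> o'" and l: "6 * \<epsilon> < l" and A: "A * l\<^sup>2 \<ge> 18" "A > 0"
    and osc: "\<And>y z. y \<in> K \<Longrightarrow> z \<in> K \<Longrightarrow> norm (y - z) < l \<Longrightarrow> y $ k - z $ k \<le> o'"
  obtains f where "continuous_on (disc k (1/4)) f" "\<And>x. \<bar>f x\<bar> \<le> \<epsilon>"
    "\<And>x y. y \<in> K \<Longrightarrow> y $ k - \<epsilon> * A * (norm (x - proj k y))\<^sup>2 \<le> f x"
    "\<And>x y. y \<in> K \<Longrightarrow> f x \<le> y $ k + \<epsilon> * A * (norm (x - proj k y))\<^sup>2 + o'"
proof -
  define q where "q = (\<lambda>x y. y $ k - \<epsilon> * A * (norm (x - proj k y))\<^sup>2)"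
  define W where "W = (\<lambda>x. SUP y\<in>K. q x y)"
  define f where "f = (\<lambda>x. max (W x) (- \<epsilon>))"
  have q\<epsilon>: "q x y \<le> \<epsilon>" if "y \<in> K" for x y
  proof -
    have "0 \<le> \<epsilon> * A * (norm (x - proj k y))\<^sup>2" using \<epsilon> A by simp
    then show ?thesis using abs_le_D1[OF Kb(1)[OF that]] by (simp add: q_def)
  qed
  have bdd: "bdd_above (q x ` K)" for x using q\<epsilon> by (auto simp: bdd_above_def)
  have up: "q x y \<le> W x" if "y \<in> K" for x y
    unfolding W_def by (rule cSUP_upper[OF that bdd])
  have least: "W x \<le> c" if "\<And>y. y \<in> K \<Longrightarrow> q x y \<le> c" for x c
    unfolding W_def by (rule cSUP_least[OF K that])
  \<comment> \<open>If both points lie within l / 3 of \<open>x\<close> horizontally, their distance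
    is below \<open>l\<close>, because 6 \<epsilon> < l absorbs the vertical gap, and
    \<open>osc\<close> applies. Otherwise one parabola alone reaches 2 \<epsilon>, by
    \<open>A * l\<^sup>2 \<ge> 18\<close>, and the slab bound suffices.\<close>
  have sep: "q x y \<le> z $ k + \<epsilon> * A * (norm (x - proj k z))\<^sup>2 + o'" if yz: "y \<in> K" "z \<in> K" for x y z
  proof (cases "norm (x - proj k y) < l / 3 \<and> norm (x - proj k z) < l / 3")
    case True
    have "y - z = (x - proj k z) - (x - proj k y) + (y $ k - z $ k) *\<^sub>R axis k 1"
      by (auto simp: vec_eq_iff axis_def)
    then have "norm (y - z) \<le> norm ((x - proj k z) - (x - proj k y)) + \<bar>y $ k - z $ k\<bar>"
      by (metis norm_triangle_ineq norm_scaleR norm_axis_1 mult.right_neutral)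
    also have "norm ((x - proj k z) - (x - proj k y)) \<le> norm (x - proj k z) + norm (x - proj k y)"
      by (rule norm_triangle_ineq4)
    also have "\<bar>y $ k - z $ k\<bar> \<le> 2 * \<epsilon>" using Kb(1)[OF yz(1)] Kb(1)[OF yz(2)] by linarith
    finally have "norm (y - z) < l" using True l by simp
    then have "y $ k - z $ k \<le> o'" using osc yz by blast
    moreover have "0 \<le> \<epsilon> * A * (norm (x - proj k z))\<^sup>2" "0 \<le> \<epsilon> * A * (norm (x - proj k y))\<^sup>2" using \<epsilon> A by simp_all
    ultimately show ?thesis unfolding q_def by linarith
  next
    case False
    have big: "2 * \<epsilon> \<le> \<epsilon> * A * (norm u)\<^sup>2" if "\<not> norm u < l / 3" for u :: "real^'n"
    proof -
      have "(l / 3)\<^sup>2 \<le> (norm u)\<^sup>2" using that l \<epsilon> by (intro power_mono) auto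
      then have "\<epsilon> * A * (l / 3)\<^sup>2 \<le> \<epsilon> * A * (norm u)\<^sup>2" using \<epsilon> A by (intro mult_left_mono) auto
      moreover have "\<epsilon> * 18 \<le> \<epsilon> * (A * l\<^sup>2)" using \<epsilon> A by (intro mult_left_mono) auto
      ultimately show ?thesis by (simp add: power_divide mult.assoc)
    qed
    have "0 \<le> \<epsilon> * A * (norm (x - proj k z))\<^sup>2" "0 \<le> \<epsilon> * A * (norm (x - proj k y))\<^sup>2" using \<epsilon> A by simp_all
    then have "2 * \<epsilon> \<le> \<epsilon> * A * (norm (x - proj k y))\<^sup>2 + \<epsilon> * A * (norm (x - proj k z))\<^sup>2"
      using False big[of "x - proj k y"] big[of "x - proj k z"] by linarith
    then show ?thesis using Kb(1)[OF yz(1)] Kb(1)[OF yz(2)] o unfolding q_def by linarith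
  qed
  \<comment> \<open>Differences of squares: both distances to the projected point are at most 5/4,
    so the factor 3 covers their sum.\<close>
  have lip: "W x \<le> W x' + 3 * \<epsilon> * A * norm (x - x')" if x: "norm x \<le> 1/4" "norm x' \<le> 1/4" for x x'
  proof (rule least)
    fix y assume y: "y \<in> K"
    have n: "norm (proj k y) \<le> 1" using norm_proj_le[of k y] Kb(2)[OF y] by linarith
    have "norm (x - proj k y) \<le> 5/4" "norm (x' - proj k y) \<le> 5/4"
      using norm_triangle_ineq4[of x "proj k y"] norm_triangle_ineq4[of x' "proj k y"] x n by linarith+
    then have s: "norm (x' - proj k y) + norm (x - proj k y) \<le> 3" by linarith
    have "norm (x' - proj k y) - norm (x - proj k y) \<le> norm (x - x')"
      using norm_triangle_ineq2[of "x' - proj k y" "x - proj k y"] by (simp add: norm_minus_commute)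
    then have "(norm (x' - proj k y) - norm (x - proj k y)) * (norm (x' - proj k y) + norm (x - proj k y))
        \<le> norm (x - x') * (norm (x' - proj k y) + norm (x - proj k y))"
      by (intro mult_right_mono) auto
    also have "\<dots> \<le> norm (x - x') * 3" by (intro mult_left_mono s) auto
    finally have "(norm (x' - proj k y))\<^sup>2 - (norm (x - proj k y))\<^sup>2 \<le> 3 * norm (x - x')"
      by (simp add: power2_eq_square algebra_simps)
    then have "\<epsilon> * A * ((norm (x' - proj k y))\<^sup>2 - (norm (x - proj k y))\<^sup>2) \<le> \<epsilon> * A * (3 * norm (x - x'))"
      using \<epsilon> A by (intro mult_left_mono) auto
    then have "q x y \<le> q x' y + 3 * \<epsilon> * A * norm (x - x')" by (simp add: q_def algebra_simps)
    then show "q x y \<le> W x' + 3 * \<epsilon> * A * norm (x - x')" using up[OF y, of x'] by linarith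
  qed
  have "(3 * \<epsilon> * A)-lipschitz_on (disc k (1/4)) W"
  proof (rule lipschitz_onI)
    fix x x' assume x: "x \<in> disc k (1/4)" "x' \<in> disc k (1/4)"
    then show "dist (W x) (W x') \<le> 3 * \<epsilon> * A * dist x x'"
      using lip[of x x'] lip[of x' x] by (simp add: dist_norm norm_minus_commute abs_le_iff)
  qed (use \<epsilon> A in simp)
  then have "continuous_on (disc k (1/4)) W" by (rule lipschitz_on_continuous_on)
  then have fc: "continuous_on (disc k (1/4)) f" unfolding f_def by (intro continuous_intros)
  show thesis
  proof (rule that[OF fc])
    show "\<bar>f x\<bar> \<le> \<epsilon>" for x using least[OF q\<epsilon>, of x] \<epsilon> by (auto simp: f_def)
    fix x and y :: "real^'n" assume y: "y \<in> K"
    show "y $ k - \<epsilon> * A * (norm (x - proj k y))\<^sup>2 \<le> f x" using up[OF y, of x] by (simp add: f_def q_def)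
    have "0 \<le> \<epsilon> * A * (norm (x - proj k y))\<^sup>2" using \<epsilon> A by simp
    then have "- \<epsilon> \<le> y $ k + \<epsilon> * A * (norm (x - proj k y))\<^sup>2 + o'"
      using Kb(1)[OF y] o by linarith
    then show "f x \<le> y $ k + \<epsilon> * A * (norm (x - proj k y))\<^sup>2 + o'"
      using least[of x] sep[OF _ y, of _ x] by (simp add: f_def)
  qed
qed

text \<open>The function \<open>f\<close> lies between the sup- and the inf-convolution up to the
  oscillation 2 q \<epsilon>. Its harmonic approximation \<open>v\<close> is therefore a barrier on
  the sphere from both sides, with errors q \<epsilon> and 3 q \<epsilon>. The comparison carries
  these inwards at the extra cost q \<epsilon> / 16, and at the projection of \<open>y\<close> the
  parabola vanishes.\<close>

lemma boundary_near_harmonic: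
  fixes k :: "'n::finite" and E :: "(real^'n) set"
  assumes n: "CARD('n) \<ge> 2" and E: "minimal_set E" and S0: "0 \<in> measure_boundary E"
    and flat: "measure_boundary E \<inter> ball 0 1 \<subseteq> {x. \<bar>x $ k\<bar> \<le> \<epsilon>}" and \<epsilon>: "0 < \<epsilon>" "\<epsilon> \<le> s ^ 20"
    and s: "0 < s" "s \<le> q" "q \<le> 1 / 2^33"
    and osc: "\<And>y z. y \<in> measure_boundary E \<Longrightarrow> z \<in> measure_boundary E \<Longrightarrow> norm y < 1/2 \<Longrightarrow>
      norm (y - z) < s / 2 \<Longrightarrow> y $ k - z $ k \<le> 2 * \<epsilon> * q"
  obtains v where "hpoly k v" "lap v = (\<lambda>x. 0)" "\<And>x. x \<in> disc k (1/4) \<Longrightarrow> \<bar>v x\<bar> \<le> 2 * \<epsilon>"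
    "\<And>y. y \<in> measure_boundary E \<Longrightarrow> norm y \<le> 1/4 \<Longrightarrow> \<bar>y $ k - v y\<bar> \<le> 4 * q * \<epsilon>"
proof -
  \<comment> \<open>With l = s / 2, the length on which the oscillation is controlled, this gives A
    l^2 = 32, above the 18 required for the separation.\<close>
  define A where "A = 128 / s\<^sup>2"
  define K where "K = measure_boundary E \<inter> cball 0 (3/8)"
  have s33: "s \<le> 1 / 2^33" and s1: "s \<le> 1" using s by simp_all
  have A0: "A > 0" using s by (simp add: A_def)
  have s2: "s\<^sup>2 \<le> 1/2^33 * s" using s s33 by (simp add: power2_eq_square mult_right_mono)
  have \<epsilon>s2: "\<epsilon> \<le> s\<^sup>2" 
  proof -
    have "s ^ 20 \<le> s\<^sup>2" using s(1) s1 by (intro power_decreasing) auto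
    then show ?thesis using \<epsilon>(2) by linarith
  qed
  have \<epsilon>s: "\<epsilon> \<le> 1/2^33 * s" using \<epsilon>s2 s2 by simp
  have Kb: "\<bar>y $ k\<bar> \<le> \<epsilon>" "norm y \<le> 1" "norm y < 1/2" "y \<in> measure_boundary E" if "y \<in> K" for y
    using that flat unfolding K_def by auto
  have A768: "768 \<le> A"
  proof -
    have "s\<^sup>2 \<le> 1/768" using s2 s1 s(1) s33 by simp
    then show ?thesis using s by (simp add: A_def field_simps)
  qed
  have q: "0 < q" "q \<le> 1" using s by auto
  \<comment> \<open>The nonlinear error has to stay below the strictness \<kappa> = q \<epsilon>.
    After division by \<epsilon>, the product of \<open>\<epsilon>\<^sup>2\<close> and
    \<open>A\<^sup>2\<close> is at most s^40 times 16384 s^(-4), which is small compared with s,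
    hence with q.\<close>
  have \<kappa>: "24 * \<epsilon> ^ 3 * A\<^sup>2 < q * \<epsilon>"
  proof -
    have "\<epsilon>\<^sup>2 \<le> (s ^ 20)\<^sup>2" using \<epsilon> by (intro power_mono) auto
    also have "\<dots> = s ^ 36 * s ^ 4" by (simp flip: power_mult power_add)
    also have "s ^ 36 * s ^ 4 \<le> s\<^sup>2 * s ^ 4" using s s1 by (intro mult_right_mono power_decreasing) auto
    finally have "\<epsilon>\<^sup>2 * A\<^sup>2 \<le> s\<^sup>2 * s ^ 4 * A\<^sup>2" by (intro mult_right_mono) auto
    also have "\<dots> = 16384 * s\<^sup>2"
    proof -
      have "A\<^sup>2 = 16384 / s ^ 4" by (simp add: A_def power_divide flip: power_mult)
      then have *: "s ^ 4 * A\<^sup>2 = 16384" using s by simp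
      show ?thesis by (simp only: mult.assoc *)
    qed
    also have "\<dots> \<le> 16384 * (1/2^33 * s)" using s2 by simp
    finally have "24 * (\<epsilon>\<^sup>2 * A\<^sup>2) \<le> 24 * (16384 * (1/2^33 * s))"
      by (rule mult_left_mono) simp
    also have "\<dots> < s" using s(1) by simp
    finally have "24 * (\<epsilon>\<^sup>2 * A\<^sup>2) < q" using s(2) by simp
    then have "\<epsilon> * (24 * (\<epsilon>\<^sup>2 * A\<^sup>2)) < \<epsilon> * q" using \<epsilon> by simp
    then show ?thesis by (simp add: power2_eq_square power3_eq_cube mult_ac)
  qed
  obtain f where f: "continuous_on (disc k (1/4)) f" "\<And>x. \<bar>f x\<bar> \<le> \<epsilon>"
    "\<And>x y. y \<in> K \<Longrightarrow> y $ k - \<epsilon> * A * (norm (x - proj k y))\<^sup>2 \<le> f x"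
    "\<And>x y. y \<in> K \<Longrightarrow> f x \<le> y $ k + \<epsilon> * A * (norm (x - proj k y))\<^sup>2 + 2 * \<epsilon> * q"
  proof (rule sup_inf_convolution_separation[of K k \<epsilon> "2 * \<epsilon> * q" "s / 2" A])
    show "K \<noteq> {}" using S0 by (auto simp: K_def)
    show "6 * \<epsilon> < s / 2" using \<epsilon>s s by simp
    show "A * (s / 2)\<^sup>2 \<ge> 18" using s by (simp add: A_def power_divide)
    show "y $ k - z $ k \<le> 2 * \<epsilon> * q" if "y \<in> K" "z \<in> K" "norm (y - z) < s / 2" for y z
      using osc Kb that by blast
  qed (use \<epsilon> q Kb A0 in auto)
  have "q * \<epsilon> > 0" using q \<epsilon> by simp
  then obtain v where v: "hpoly k v" "lap v = (\<lambda>x. 0)"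
    "\<And>x. x $ k = 0 \<Longrightarrow> norm x = 1/4 \<Longrightarrow> \<bar>f x - v x\<bar> < q * \<epsilon>"
    using harmonic_approximation[OF n f(1), of "q * \<epsilon>"] by auto
  have q\<epsilon>: "q * \<epsilon> \<le> \<epsilon>" using q \<epsilon> by simp
  have vbd: "\<bar>v x\<bar> \<le> 2 * \<epsilon>" if x: "x $ k = 0" "norm x = 1/4" for x
    using f(2)[of x] v(3)[OF x] q\<epsilon> by linarith
  have lapm: "lap (\<lambda>x. - v x) = (\<lambda>x. 0)" using lap_scale[OF v(1), of "-1"] v(2) by simp
  have vb: "\<bar>v x\<bar> \<le> 2 * \<epsilon>" if x: "x \<in> disc k (1/4)" for x
  proof -
    have "v x \<le> 2 * \<epsilon>"
      by (rule subharmonic_max[OF n v(1) _ _ x]) (use v(2) vbd in \<open>auto simp: abs_le_iff\<close>)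
    moreover have "- v x \<le> 2 * \<epsilon>"
      by (rule subharmonic_max[OF n hpoly_uminus[OF v(1)] _ _ x]) (use lapm vbd in \<open>auto simp: abs_le_iff\<close>)
    ultimately show ?thesis by simp
  qed
  have \<epsilon>32: "\<epsilon> \<le> 1/32" using \<epsilon>s s1 by simp
  have upper: "1 * y $ k - \<epsilon> * A * (norm (x - proj k y))\<^sup>2 \<le> 1 * v x + q * \<epsilon> + q * \<epsilon> / 16"
    if "x \<in> disc k (1/4)" "y \<in> K" for x y
  proof (rule sup_convolution_comparison[OF n E \<epsilon>(1) \<epsilon>32 flat v(1,2) _ A768 _ \<kappa> K_def _ _ that])
    show "- 2 * \<epsilon> \<le> 1 * v x" if "x \<in> disc k (1/4)" for x using vb[OF that] by linarith
    show "1 * y $ k - \<epsilon> * A * (norm (x - proj k y))\<^sup>2 \<le> 1 * v x + q * \<epsilon>"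
      if "x $ k = 0" "norm x = 1/4" "y \<in> K" for x y
      using f(3)[OF that(3), of x] v(3)[OF that(1,2)] by linarith
  qed (use q \<epsilon> in auto)
  have lower: "- 1 * y $ k - \<epsilon> * A * (norm (x - proj k y))\<^sup>2 \<le> - 1 * v x + 3 * q * \<epsilon> + q * \<epsilon> / 16"
    if "x \<in> disc k (1/4)" "y \<in> K" for x y
  proof (rule sup_convolution_comparison[OF n E \<epsilon>(1) \<epsilon>32 flat v(1,2) _ A768 _ \<kappa> K_def _ _ that])
    show "- 2 * \<epsilon> \<le> - 1 * v x" if "x \<in> disc k (1/4)" for x using vb[OF that] by linarith
    show "- 1 * y $ k - \<epsilon> * A * (norm (x - proj k y))\<^sup>2 \<le> - 1 * v x + 3 * q * \<epsilon>"
      \<comment> \<open>The lower barrier loses q \<epsilon> from the approximation and 2 q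
        \<epsilon> from the gap between \<open>f\<close> and the inf-convolution.\<close>
      if "x $ k = 0" "norm x = 1/4" "y \<in> K" for x y
      using f(4)[OF that(3), of x] v(3)[OF that(1,2)] by (simp add: algebra_simps abs_less_iff)
  qed (use q \<epsilon> in auto)
  show thesis
  proof (rule that[OF v(1,2) vb])
    fix y assume y: "y \<in> measure_boundary E" "norm y \<le> 1/4"
    then have yK: "y \<in> K" by (simp add: K_def)
    have d: "proj k y \<in> disc k (1/4)" using norm_proj_le[of k y] y by simp
    have "v (proj k y) = v y" by (rule hpoly_proj[OF v(1)])
    then have "y $ k \<le> v y + q * \<epsilon> + q * \<epsilon> / 16" "- y $ k \<le> - v y + 3 * q * \<epsilon> + q * \<epsilon> / 16"
      using upper[OF d yK] lower[OF d yK] by simp_all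
    then show "\<bar>y $ k - v y\<bar> \<le> 4 * q * \<epsilon>"
      using \<open>q * \<epsilon> > 0\<close> unfolding abs_le_iff mult.assoc by linarith
  qed
qed

section \<open>Choice of the scale and the conclusion\<close>

text \<open>Since 1 - \<eta> = 2^(-\<alpha>), reaching the factor 2^(-L) takes L / \<alpha> steps,
  rounded up. The exponent in the threshold equals 8 (1 - \<alpha>) / \<alpha>^2, which is at least
  24 / \<alpha>, so that the base, being at most 2^(-L) apart from the power of
  \<open>\<epsilon>\<^sub>1\<close>, contributes 2^(-24 L / \<alpha>). This is below 2^(-20 N), the
  surplus 4 L / \<alpha> paying for the rounding. The power of \<open>\<epsilon>\<^sub>1\<close>
  becomes 8 / \<alpha>, more than 1, and supplies the factor needed for the Harnack
  hypothesis.\<close>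

lemma scale_choice:
  fixes n \<epsilon>\<^sub>1 \<eta> \<alpha> \<gamma> :: real
  assumes n: "n \<ge> 1" and \<epsilon>1: "0 < \<epsilon>\<^sub>1" "\<epsilon>\<^sub>1 \<le> 1/4" and \<eta>: "0 < \<eta>" "\<eta> \<le> 1/5"
    and \<alpha>: "\<alpha> = - log 2 (1 - \<eta>)" "\<alpha> \<le> 1/4" and \<gamma>: "\<gamma> = 1 / (1 - \<alpha>)"
  obtains N :: nat where "(1 - \<eta>) ^ N \<le> 1 / (2^33 * n^3)" "(1/2) ^ N \<le> 1 / (2^33 * n^3)"
    "(\<epsilon>\<^sub>1 powr (\<gamma> * \<alpha>) / (2 powr (33 + 5 * \<alpha>) * n^3)) powr (8 / (\<gamma> * \<alpha>^2)) \<le> \<epsilon>\<^sub>1 * (1/2) ^ (20 * N)"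
proof -
  have \<alpha>0: "\<alpha> > 0" using \<eta> by (simp add: \<alpha>(1))
  have \<gamma>0: "\<gamma> > 0" using \<alpha>(2) by (simp add: \<gamma>)
  define L where "L = 33 + 3 * log 2 n"
  have L: "L \<ge> 33" using n by (simp add: L_def)
  have qL: "1 / (2^33 * n^3) = 2 powr (- L)"
  proof -
    have "2 powr L = 2 powr 33 * (2 powr log 2 n) powr 3"
      by (simp add: L_def powr_add powr_powr mult.commute)
    also have "\<dots> = 2^33 * n^3" using n by (simp add: powr_numeral)
    finally show ?thesis by (simp only: powr_minus_divide)
  qed
  have \<eta>p: "1 - \<eta> = 2 powr (- \<alpha>)" using \<eta> by (simp add: \<alpha>(1))
  define N where "N = nat \<lceil>L / \<alpha>\<rceil>"
  have La: "L / \<alpha> > 0" using L \<alpha>0 by simp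
  have N: "L / \<alpha> \<le> real N" "real N \<le> L / \<alpha> + 1"
    using La by (simp_all add: N_def)
  have a4: "4 * L \<le> L / \<alpha>"
  proof -
    have "4 * L * \<alpha> \<le> L" using mult_left_mono[OF \<alpha>(2), of "4 * L"] L by simp
    then show ?thesis using \<alpha>0 by (simp add: field_simps)
  qed
  show thesis
  proof
    have "(1 - \<eta>) ^ N = 2 powr (- (\<alpha> * real N))"
      unfolding \<eta>p by (simp add: powr_realpow[symmetric] powr_powr)
    also have "\<dots> \<le> 2 powr (- L)"
    proof -
      have "L \<le> \<alpha> * real N" using N(1) \<alpha>0 by (simp add: divide_le_eq mult.commute)
      then show ?thesis by simp
    qed
    finally show "(1 - \<eta>) ^ N \<le> 1 / (2^33 * n^3)" by (simp only: qL)
    have half: "(1/2::real) ^ m = 2 powr (- real m)" for m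
      by (simp only: powr_minus_divide powr_realpow[of 2] power_one_over zero_less_numeral)
    have "(1/2::real) ^ N = 2 powr (- real N)" by (rule half)
    also have "\<dots> \<le> 2 powr (- L)" using N(1) a4 L by simp
    finally show "(1/2) ^ N \<le> 1 / (2^33 * n^3)" by (simp only: qL)
    let ?e = "8 / (\<gamma> * \<alpha>^2)"
    have e0: "?e > 0" using \<gamma>0 \<alpha>0 by simp
    have num: "(\<epsilon>\<^sub>1 powr (\<gamma> * \<alpha>)) powr ?e \<le> \<epsilon>\<^sub>1"
    proof -
      have "\<gamma> * \<alpha> * ?e = 8 / \<alpha>" using \<gamma>0 \<alpha>0 by (simp add: power2_eq_square)
      then have "(\<epsilon>\<^sub>1 powr (\<gamma> * \<alpha>)) powr ?e = \<epsilon>\<^sub>1 powr (8 / \<alpha>)" by (simp add: powr_powr)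
      also have "\<dots> \<le> \<epsilon>\<^sub>1 powr 1"
        using \<epsilon>1 \<alpha>0 \<alpha>(2) by (intro powr_mono') (auto simp: field_simps)
      finally show ?thesis using \<epsilon>1 by simp
    qed
    have den: "1 / (2 powr (33 + 5 * \<alpha>) * n^3) \<le> 2 powr (- L)"
    proof -
      have "(2::real)^33 \<le> 2 powr (33 + 5 * \<alpha>)"
        using powr_mono[of 33 "33 + 5 * \<alpha>" 2] \<alpha>0 by (simp add: powr_numeral)
      then have "1 / (2 powr (33 + 5 * \<alpha>) * n^3) \<le> 1 / (2^33 * n^3)"
        using n by (intro divide_left_mono mult_right_mono mult_pos_pos) auto
      then show ?thesis by (simp only: qL)
    qed
    have "(1 / (2 powr (33 + 5 * \<alpha>) * n^3)) powr ?e \<le> (2 powr (- L)) powr ?e"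
      using den e0 n by (intro powr_mono2) auto
    also have "\<dots> = 2 powr (- (L * ?e))" by (simp add: powr_powr)
    also have "\<dots> \<le> 2 powr (- (20 * real N))"
    proof -
      have "?e = 8 * (1 - \<alpha>) / \<alpha>\<^sup>2" using \<alpha>(2) by (simp add: \<gamma>)
      also have "\<dots> \<ge> 6 / \<alpha>\<^sup>2" using \<alpha>(2) by (intro divide_right_mono) auto
      finally have "?e \<ge> 6 / \<alpha>\<^sup>2" .
      moreover have "6 / \<alpha>\<^sup>2 \<ge> 24 / \<alpha>"
        using \<alpha>0 \<alpha>(2) by (simp add: field_simps power2_eq_square)
      ultimately have "L * ?e \<ge> L * (24 / \<alpha>)" using L by (intro mult_left_mono) auto
      then have "L * ?e \<ge> 20 * (L / \<alpha>) + 4 * (L / \<alpha>)" by (simp add: field_simps)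
      then have "L * ?e \<ge> 20 * real N" using N(2) a4 L by linarith
      then show ?thesis by simp
    qed
    also have "2 powr (- (20 * real N)) = (1/2::real) ^ (20 * N)"
      by (simp add: half)
    finally have den2: "(1 / (2 powr (33 + 5 * \<alpha>) * n^3)) powr ?e \<le> (1/2) ^ (20 * N)" .
    have "(\<epsilon>\<^sub>1 powr (\<gamma> * \<alpha>) / (2 powr (33 + 5 * \<alpha>) * n^3)) powr ?e
       = (\<epsilon>\<^sub>1 powr (\<gamma> * \<alpha>)) powr ?e * (1 / (2 powr (33 + 5 * \<alpha>) * n^3)) powr ?e"
      using n by (subst powr_mult[symmetric]) auto
    also have "\<dots> \<le> \<epsilon>\<^sub>1 * (1/2) ^ (20 * N)"
      using num den2 \<epsilon>1 by (intro mult_mono) auto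
    finally show "(\<epsilon>\<^sub>1 powr (\<gamma> * \<alpha>) / (2 powr (33 + 5 * \<alpha>) * n^3)) powr ?e \<le> \<epsilon>\<^sub>1 * (1/2) ^ (20 * N)" .
  qed
qed

text \<open>The normal is \<open>axis k 1 - a\<close>, normalized. Its component \<open>k\<close> is
  1, so its norm is at least 1 and normalization can only shrink the bound.\<close>

lemma flat_in_tilted_slab:
  fixes k :: "'n::finite" and S :: "(real^'n) set" and a :: "real^'n"
  assumes a: "a $ k = 0" and S: "\<And>y. y \<in> S \<Longrightarrow> \<bar>y $ k - a \<bullet> y\<bar> \<le> c"
  shows "\<exists>\<nu>\<in>sphere 0 1. S \<subseteq> {x. \<bar>x \<bullet> \<nu>\<bar> \<le> c}"
proof -
  define w where "w = axis k 1 - a"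
  have "\<bar>w $ k\<bar> \<le> norm w" by (rule component_le_norm_cart)
  then have w: "norm w \<ge> 1" using a by (simp add: w_def axis_def)
  have "\<bar>y \<bullet> ((1 / norm w) *\<^sub>R w)\<bar> \<le> c" if "y \<in> S" for y
  proof -
    have "y \<bullet> w = y $ k - a \<bullet> y"
      by (simp add: w_def inner_diff_right inner_axis inner_commute)
    then have "\<bar>y \<bullet> w\<bar> \<le> c" using S[OF that] by simp
    moreover have "\<bar>y \<bullet> ((1 / norm w) *\<^sub>R w)\<bar> = \<bar>y \<bullet> w\<bar> / norm w" by (simp add: abs_mult)
    moreover have "\<bar>y \<bullet> w\<bar> / norm w \<le> \<bar>y \<bullet> w\<bar> / 1" using w by (intro divide_left_mono) auto
    ultimately show ?thesis by simp
  qed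
  moreover have "w \<noteq> 0" using w by auto
  then have "norm ((1 / norm w) *\<^sub>R w) = 1" by simp
  ultimately show ?thesis by (intro bexI[of _ "(1 / norm w) *\<^sub>R w"]) auto
qed

theorem theorem1p2:
  fixes k :: "'n::finite"
    and \<epsilon>\<^sub>1 \<eta> \<alpha> \<gamma> r\<^sub>0 \<epsilon>\<^sub>0 \<epsilon> :: real
    and E :: "(real^'n) set"
  assumes "CARD('n) \<ge> 2"
    and "harnack_constants k \<epsilon>\<^sub>1 \<eta>"
    and "\<epsilon>\<^sub>1 \<le> 1/4" and "\<eta> \<le> 1/5" and "- log 2 (1 - \<eta>) \<le> 1/4"
    and "\<alpha> = - log 2 (1 - \<eta>)"
    and "\<gamma> = 1 / (1 - \<alpha>)"
    and "r\<^sub>0 = 1 / (2^16 * (real CARD('n))^2)"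
    and "\<epsilon>\<^sub>0 = (\<epsilon>\<^sub>1 powr (\<gamma> * \<alpha>) / (2 powr (33 + 5 * \<alpha>) * (real CARD('n))^3))
                 powr (8 / (\<gamma> * \<alpha>^2))"
    and "minimal_set E"
    and "0 \<in> measure_boundary E"
    and "\<epsilon> \<le> \<epsilon>\<^sub>0"
    and "measure_boundary E \<inter> ball 0 1 \<subseteq> {x. \<bar>x $ k\<bar> \<le> \<epsilon>}"
  shows "\<exists>\<nu>\<in>sphere 0 1. measure_boundary E \<inter> ball 0 r\<^sub>0 \<subseteq> {x. \<bar>x \<bullet> \<nu>\<bar> \<le> \<epsilon> / 2 * r\<^sub>0}"
proof -
  note n = assms(1) and H = assms(2) and E = assms(10) and S0 = assms(11) and flat = assms(13)
  define n' where "n' = real CARD('n)"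
  \<comment> \<open>The accuracy aimed at: \<open>q\<close> is r0 / (2^17 n), so errors of order q
    \<epsilon> are negligible against \<epsilon> r0.\<close>
  define q where "q = 1 / (2^33 * n'^3)"
  have n2: "n' \<ge> 2" using n by (simp add: n'_def)
  have r0: "r\<^sub>0 = 1 / (2^16 * n'^2)" using assms(8) by (simp add: n'_def)
  have n'sq: "n'^2 \<ge> 1" using n2 by simp
  have r0b: "r\<^sub>0 > 0" "r\<^sub>0 \<le> 1/2^16"
    unfolding r0 using n'sq n2 by (simp_all add: divide_le_eq)
  show ?thesis
  proof (cases "\<epsilon> > 0")
    \<comment> \<open>The origin lies in the slab, so \<epsilon> is nonnegative and here equals 0;
      the boundary is then horizontal and the plane is not tilted.\<close>
    case False
    have "\<bar>y $ k - 0 \<bullet> y\<bar> \<le> \<epsilon> / 2 * r\<^sub>0" if "y \<in> measure_boundary E \<inter> ball 0 r\<^sub>0" for y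
    proof -
      have "0 \<in> measure_boundary E \<inter> ball 0 1" "y \<in> measure_boundary E \<inter> ball 0 1" using S0 that r0b by auto
      then have "\<bar>(0::real^'n) $ k\<bar> \<le> \<epsilon>" "\<bar>y $ k\<bar> \<le> \<epsilon>" using flat by blast+
      then show ?thesis using False by simp
    qed
    then show ?thesis by (intro flat_in_tilted_slab[where a = 0]) auto
  next
    case True
    have \<epsilon>1: "\<epsilon>\<^sub>1 > 0" and \<eta>: "\<eta> > 0" using H by (auto simp: harnack_constants_def)
    have "n' \<ge> 1" using n2 by simp
    then obtain N :: nat where N: "(1 - \<eta>) ^ N \<le> q" "(1/2) ^ N \<le> q" "\<epsilon>\<^sub>0 \<le> \<epsilon>\<^sub>1 * (1/2) ^ (20 * N)"
      using scale_choice[OF _ \<epsilon>1 assms(3) \<eta> assms(4,6) _ assms(7), of n'] assms(5,6,9)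
      unfolding q_def n'_def by metis
    define s where "s = (1/2::real) ^ N"
    have s: "s > 0" "s \<le> q" using N by (auto simp: s_def)
    have n'3: "n'^3 \<ge> 1" using n2 by simp
    have q33: "q \<le> 1 / 2^33" unfolding q_def using n'3 n2 by (intro divide_left_mono) auto
    have s20: "(1/2::real) ^ (20 * N) = s ^ 20" by (simp add: s_def power_mult[symmetric] mult.commute)
    have \<epsilon>s: "\<epsilon> \<le> \<epsilon>\<^sub>1 * s ^ 20" using N(3) assms(12) unfolding s20 by linarith
    also have "\<dots> \<le> 1 * s ^ 20" using assms(3) s by (intro mult_right_mono) auto
    finally have \<epsilon>s': "\<epsilon> \<le> s ^ 20" by simp
    have s33: "s \<le> 1/2^33" using s q33 by linarith
    \<comment> \<open>The slab has to stay below \<open>\<epsilon>\<^sub>1\<close> after all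
      \<open>N\<close> magnifications: one factor \<open>s\<close> cancels \<open>2 ^ N\<close>, and
      the others absorb the remaining 2.\<close>
    have "2 ^ (N + 1) * \<epsilon> \<le> \<epsilon>\<^sub>1"
    proof -
      have "2 ^ (N + 1) * \<epsilon> \<le> 2 ^ (N + 1) * (\<epsilon>\<^sub>1 * s ^ 20)" using \<epsilon>s by (intro mult_left_mono) auto
      also have "s ^ 20 = s ^ 19 * s" using power_add[of s 19 1] by simp
      also have "2 ^ (N + 1) * (\<epsilon>\<^sub>1 * (s ^ 19 * s)) = \<epsilon>\<^sub>1 * (2 * s ^ 19 * (2 ^ N * s))"
        by (simp only: power_add power_one_right mult_ac)
      also have "2 ^ N * s = 1" by (simp add: s_def power_mult_distrib[symmetric])
      also have "\<epsilon>\<^sub>1 * (2 * s ^ 19 * 1) \<le> \<epsilon>\<^sub>1 * 1"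
      proof (rule mult_left_mono)
        have "s ^ 19 \<le> s ^ 1" using s s33 by (intro power_decreasing) auto
        then show "2 * s ^ 19 * 1 \<le> 1" using s33 by simp
      qed (use \<epsilon>1 in simp)
      finally show ?thesis by simp
    qed
    note iter = harnack_iterate[OF H assms(4) E flat True _ _ this]
    \<comment> \<open>The last ball of the iteration has radius \<open>(1/2) ^ (N + 1)\<close>, that
      is s / 2.\<close>
    have osc: "y $ k - z $ k \<le> 2 * \<epsilon> * q"
      if "y \<in> measure_boundary E" "z \<in> measure_boundary E" "norm y < 1/2" "norm (y - z) < s / 2" for y z
    proof -
      have "z \<in> ball y ((1/2) ^ (N + 1))" using that(4) by (simp add: dist_norm s_def)
      then have "\<bar>z $ k - y $ k\<bar> \<le> 2 * \<epsilon> * (1 - \<eta>) ^ N" using iter[OF that(1,3)] that(2) by blast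
      also have "\<dots> \<le> 2 * \<epsilon> * q" using N(1) True by (intro mult_left_mono) auto
      finally show ?thesis by linarith
    qed
    obtain v where v: "hpoly k v" "lap v = (\<lambda>x. 0)" "\<And>x. x \<in> disc k (1/4) \<Longrightarrow> \<bar>v x\<bar> \<le> 2 * \<epsilon>"
      "\<And>y. y \<in> measure_boundary E \<Longrightarrow> norm y \<le> 1/4 \<Longrightarrow> \<bar>y $ k - v y\<bar> \<le> 4 * q * \<epsilon>"
      using boundary_near_harmonic[OF n E S0 flat True \<epsilon>s' s q33 osc] by blast
    define a :: "real^'n" where "a = (\<chi> i. pd i v 0)"
    have ak: "a $ k = 0" using pd_missing[OF v(1)] by (simp add: a_def)
    have "\<bar>y $ k - a \<bullet> y\<bar> \<le> \<epsilon> / 2 * r\<^sub>0" if y: "y \<in> measure_boundary E \<inter> ball 0 r\<^sub>0" for y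
    proof -
      have yr: "norm y < r\<^sub>0" "norm y \<le> 1/4" using y r0b by auto
      have v0: "\<bar>v 0\<bar> \<le> 4 * q * \<epsilon>" using v(4)[OF S0] by simp
      have vy: "\<bar>y $ k - v y\<bar> \<le> 4 * q * \<epsilon>" using v(4)[of y] y yr by simp
      \<comment> \<open>\<open>y\<close> need not be horizontal, so the Taylor bound is applied at
        its projection; neither \<open>v\<close> nor the product with \<open>a\<close> depends on
        the coordinate \<open>k\<close>.\<close>
      have pn: "norm (proj k y) \<le> r\<^sub>0" using norm_proj_le[of k y] yr by linarith
      then have d: "proj k y \<in> disc k (1/4/4)" using r0b by simp
      have "(\<Sum>i\<in>UNIV. proj k y $ i * pd i v 0) = a \<bullet> y"
        using pd_missing[OF v(1)] unfolding a_def inner_vec_def by (intro sum.cong) (auto simp: mult.commute)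
      then have "\<bar>v y - v 0 - a \<bullet> y\<bar> \<le> 64 * n' / (1/4)\<^sup>2 * (2 * \<epsilon>) * (norm (proj k y))\<^sup>2"
        using harmonic_second_order[OF n v(1,2) _ v(3) d] hpoly_proj[OF v(1), of y] by (simp add: n'_def)
      also have "\<dots> \<le> 64 * n' / (1/4)\<^sup>2 * (2 * \<epsilon>) * r\<^sub>0\<^sup>2"
        using pn n2 True by (intro mult_left_mono power_mono) auto
      also have "\<dots> = \<epsilon> * r\<^sub>0 * (2048 * n' * r\<^sub>0)" by (simp add: power2_eq_square)
      also have "\<dots> \<le> \<epsilon> * r\<^sub>0 * (1/32)"
      proof (rule mult_left_mono)
        have "n' * 1 \<le> n' * n'" using n2 by (intro mult_left_mono) auto
        then show "2048 * n' * r\<^sub>0 \<le> 1/32" unfolding r0 using n2 by (simp add: power2_eq_square divide_le_eq)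
      qed (use True r0b in simp)
      finally have quad: "\<bar>v y - v 0 - a \<bullet> y\<bar> \<le> \<epsilon> * r\<^sub>0 * (1/32)" .
      \<comment> \<open>The approximation error counts twice, at \<open>y\<close> and at the origin,
        where \<open>v\<close> need not vanish. Together with the quadratic error the total is at
        most \<epsilon> r0 / 16.\<close>
      have "8 * q \<le> r\<^sub>0 * (1/32)"
      proof -
        have "q = r\<^sub>0 * (1 / (2^17 * n'))" unfolding q_def r0 by (simp add: power2_eq_square power3_eq_cube)
        moreover have "1 / (2^17 * n') \<le> 1 / 2^17" using n2 by (intro divide_left_mono) auto
        then have "r\<^sub>0 * (1 / (2^17 * n')) \<le> r\<^sub>0 * (1 / 2^17)" using r0b by (intro mult_left_mono) auto
        ultimately show ?thesis using r0b by simp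
      qed
      then have "\<epsilon> * (8 * q) \<le> \<epsilon> * (r\<^sub>0 * (1/32))" using True by (intro mult_left_mono) auto
      then have "8 * q * \<epsilon> \<le> \<epsilon> * r\<^sub>0 * (1/32)" by (simp add: mult_ac)
      moreover have "\<bar>y $ k - a \<bullet> y\<bar> \<le> 8 * q * \<epsilon> + \<epsilon> * r\<^sub>0 * (1/32)"
        using v0 vy quad by linarith
      moreover have "\<epsilon> * r\<^sub>0 > 0" using True r0b by simp
      ultimately show ?thesis by simp
    qed
    then show ?thesis by (rule flat_in_tilted_slab[OF ak])
  qed
qed

end
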